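(* Let $(\Omega,\mu,\rho)$ be a space of homogeneous type satisfying the volume conditions (V1) and (V2) with exponent $d>0$ (see context), and let $T_t=\exp(-tA)$ be a semigroup which acts on all $L^p(\Omega)$, $1<p<\infty$. Assume that $T_z=\exp(-zA)$ is analytic on $L^2(\Omega)$ for $z\in\mathbb{C}_+=\{z\in\mathbb{C}:\operatorname{Re} z>0\}$ and that $T_z$ has an integral kernel $k_z(x,y)$, i.e. $(T_zf)(x)=\int_\Omega k_z(x,y)f(y)\,d\mu(y)$ for $f\in L^2(\Omega)$, which for some constants $C,\beta\ge 0$ satisfies $$|k_z(x,y)|\le C(\cos\arg z)^{-\beta}\,\frac{1}{\mu(B(x,|z|))}\,\frac{1}{\left|1+\frac{\rho(x,y)^2}{z^2}\right|^{\frac{d+1}{2}}}\qquad(z\in\mathbb{C}_+,\ x,y\in\Omega).$$ Assume further that there is a constant $C'$ such that for all $z\in\mathbb{C}_+$ $$\|\exp(-zA)\|_{B(L^2(\Omega))}\le C'(\cos(\arg z))^{-\frac{d-1}{2}-\beta}\,(1+|\log(\cos(\arg z))|)^2$$ (which is the case e.g. when $A$ is self-adjoint). Then for every $1<p<\infty$ there is a constant $C''$ such that on $X=L^p(\Omega)$, for all $\theta\in(-\frac{\pi}{2},\frac{\pi}{2})$ and all $t>0$, the following $R$-bound estimate holds: $$R\left(\{\exp(-e^{i\theta}2^jtA):\ j\in\mathbb{Z}\}\right)\le C''(\cos\theta)^{-\frac{d-1}{2}-\beta}\,(1+|\log(\cos\theta)|)^2 .$$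
   Context: A space of homogeneous type $(\Omega,\mu,\rho)$ is a metric space $(\Omega,\rho)$ with a nonnegative Borel measure $\mu$ satisfying the doubling condition: there is $C>0$ with $\mu(B(x,2r))\le C\mu(B(x,r))<\infty$ for all $x\in\Omega$, $r>0$, where $B(x,r)=\{y\in\Omega:\rho(x,y)<r\}$. Write $\operatorname{diam}(\Omega)=\sup\{\rho(x,y):x,y\in\Omega\}$ and $B(x,r,R)=B(x,R)\setminus B(x,r)$. The notation $a\cong b$ means two-sided estimates with constants independent of the variables. (V1): $\mu(B(x,r))\cong r^d$ for all $x\in\Omega$, $r>0$ if $\operatorname{diam}(\Omega)=\infty$; $\mu(B(x,r))\cong\min(r^d,1)$ for all $x\in\Omega$, $r>0$ if $\operatorname{diam}(\Omega)<\infty$. (V2): there is $C$ such that $\mu(B(x,r,R))\le C(R^d-r^d)$ for $x\in\Omega$, $R>r>0$ if $\operatorname{diam}(\Omega)=\infty$; $\mu(B(x,r,R))\le C(R-r)\min(R^{d-1},1)$ for $x\in\Omega$, $R>r>\frac12R>0$ if $\operatorname{diam}(\Omega)<\infty$. $R$-boundedness: let $(\epsilon_n)$ be independent Rademacher variables ($\pm1$ with probability $\frac12$ each) and $X$ a Banach space. A set $\tau\subset B(X)$ is $R$-bounded if there is $C>0$ such that for all finite families $S_1,\dots,S_n\in\tau$, $x_1,\dots,x_n\in X$, $\left(\mathbb{E}\|\sum_k\epsilon_kS_kx_k\|_X^2\right)^{1/2}\le C\left(\mathbb{E}\|\sum_k\epsilon_kx_k\|_X^2\right)^{1/2}$. The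 least such $C$ is denoted $R(\tau)$ (and $R(\tau)=\infty$ if there is none). *)

theory Defs
  imports "HOL-Probability.Probability" "HOL-Probability.Product_PMF"
begin

section \<open>Spaces of homogeneous type\<close>

definition homogeneous_type :: "'a::metric_space measure \<Rightarrow> bool" where
  "homogeneous_type M \<longleftrightarrow> sets M = sets borel \<and>
     (\<exists>C::real. C > 0 \<and> (\<forall>x r. r > 0 \<longrightarrow>
        emeasure M (ball x (2 * r)) \<le> ennreal C * emeasure M (ball x r) \<and>
        ennreal C * emeasure M (ball x r) < \<infinity>))"

(* The library's diameter is 0 on unbounded sets, hence an extended version. *)
definition ediam :: "'a::metric_space set \<Rightarrow> ennreal" where
  "ediam S = (SUP x\<in>S. SUP y\<in>S. ennreal (dist x y))"

definition annulus :: "'a::metric_space \<Rightarrow> real \<Rightarrow> real \<Rightarrow> 'a set" where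
  "annulus x r R = ball x R - ball x r"

definition volume_V1 :: "real \<Rightarrow> 'a::metric_space measure \<Rightarrow> bool" where
  "volume_V1 d M \<longleftrightarrow>
     (let v = (\<lambda>r. if ediam (UNIV :: 'a set) = \<infinity> then r powr d else min (r powr d) 1)
      in \<exists>c C::real. c > 0 \<and> C > 0 \<and> (\<forall>x r. r > 0 \<longrightarrow>
           ennreal (c * v r) \<le> emeasure M (ball x r) \<and>
           emeasure M (ball x r) \<le> ennreal (C * v r)))"

definition volume_V2 :: "real \<Rightarrow> 'a::metric_space measure \<Rightarrow> bool" where
  "volume_V2 d M \<longleftrightarrow> (\<exists>C::real. C > 0 \<and>
     (if ediam (UNIV :: 'a set) = \<infinity>
      then \<forall>x r R. 0 < r \<and> r < R \<longrightarrow>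
             emeasure M (annulus x r R) \<le> ennreal (C * (R powr d - r powr d))
      else \<forall>x r R. 0 < R / 2 \<and> R / 2 < r \<and> r < R \<longrightarrow>
             emeasure M (annulus x r R) \<le> ennreal (C * (R - r) * min (R powr (d - 1)) 1)))"

section \<open>Lebesgue spaces and their operators\<close>

text \<open>
  Elements of \<open>L\<^sup>p\<close> are handled through representatives: \<open>Lp p M\<close> is the
  space of \<open>p\<close>-integrable functions, \<open>Lp_norm\<close> is a seminorm on it whose kernel
  is the set of functions vanishing almost everywhere, and all identities between
  elements of \<open>L\<^sup>p\<close> are required almost everywhere.
\<close>

definition Lp :: "real \<Rightarrow> 'a measure \<Rightarrow> ('a \<Rightarrow> complex) set" where
  "Lp p M = {f \<in> borel_measurable M. integrable M (\<lambda>x. norm (f x) powr p)}"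

definition Lp_norm :: "real \<Rightarrow> 'a measure \<Rightarrow> ('a \<Rightarrow> complex) \<Rightarrow> real" where
  "Lp_norm p M f = (\<integral>x. norm (f x) powr p \<partial>M) powr (1 / p)"

type_synonym 'a operator = "('a \<Rightarrow> complex) \<Rightarrow> 'a \<Rightarrow> complex"

(* The space B(L^p) of bounded complex-linear operators. Linearity and boundedness together
   imply that S respects almost everywhere equality, so S acts on equivalence classes. *)
definition Lp_bounded :: "real \<Rightarrow> 'a measure \<Rightarrow> 'a operator \<Rightarrow> bool" where
  "Lp_bounded p M S \<longleftrightarrow>
     (\<forall>f\<in>Lp p M. S f \<in> Lp p M) \<and>
     (\<forall>f\<in>Lp p M. \<forall>g\<in>Lp p M. AE x in M. S (\<lambda>y. f y + g y) x = S f x + S g x) \<and>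
     (\<forall>c. \<forall>f\<in>Lp p M. AE x in M. S (\<lambda>y. c * f y) x = c * S f x) \<and>
     (\<exists>C. \<forall>f\<in>Lp p M. Lp_norm p M (S f) \<le> C * Lp_norm p M f)"

(* Meaningful only for Lp_bounded operators, for which the infimum is over a nonempty set. *)
definition Lp_opnorm :: "real \<Rightarrow> 'a measure \<Rightarrow> 'a operator \<Rightarrow> real" where
  "Lp_opnorm p M S = Inf {C. 0 \<le> C \<and> (\<forall>f\<in>Lp p M. Lp_norm p M (S f) \<le> C * Lp_norm p M f)}"

section \<open>Semigroups\<close>

definition C0_semigroup :: "real \<Rightarrow> 'a measure \<Rightarrow> (real \<Rightarrow> 'a operator) \<Rightarrow> bool" where
  "C0_semigroup p M T \<longleftrightarrow>
     (\<forall>t\<ge>0. Lp_bounded p M (T t)) \<and>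
     (\<forall>f\<in>Lp p M. AE x in M. T 0 f x = f x) \<and>
     (\<forall>s\<ge>0. \<forall>t\<ge>0. \<forall>f\<in>Lp p M. AE x in M. T (s + t) f x = T s (T t f) x) \<and>
     (\<forall>f\<in>Lp p M. ((\<lambda>t. Lp_norm p M (\<lambda>x. T t f x - f x)) \<longlongrightarrow> 0) (at_right 0))"

(* Graph of the operator A for which T t = exp (- t A): the infinitesimal generator is - A. *)
definition neg_generator ::
  "real \<Rightarrow> 'a measure \<Rightarrow> (real \<Rightarrow> 'a operator) \<Rightarrow> (('a \<Rightarrow> complex) \<times> ('a \<Rightarrow> complex)) set" where
  "neg_generator p M T = {(f, g). f \<in> Lp p M \<and> g \<in> Lp p M \<and>
     ((\<lambda>t. Lp_norm p M (\<lambda>x. (f x - T t f x) / complex_of_real t - g x)) \<longlongrightarrow> 0) (at_right 0)}"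

(* Holomorphy on the open right half-plane is complex differentiability in operator norm. *)
definition analytic_semigroup :: "real \<Rightarrow> 'a measure \<Rightarrow> (complex \<Rightarrow> 'a operator) \<Rightarrow> bool" where
  "analytic_semigroup p M T \<longleftrightarrow>
     (\<forall>z. Re z > 0 \<longrightarrow> Lp_bounded p M (T z)) \<and>
     (\<forall>z w. Re z > 0 \<and> Re w > 0 \<longrightarrow>
        (\<forall>f\<in>Lp p M. AE x in M. T (z + w) f x = T z (T w f) x)) \<and>
     (\<forall>z. Re z > 0 \<longrightarrow> (\<exists>D. Lp_bounded p M D \<and>
        ((\<lambda>w. Lp_opnorm p M (\<lambda>f x. (T w f x - T z f x) / (w - z) - D f x)) \<longlongrightarrow> 0) (at z)))"

definition has_integral_kernel ::
  "'a measure \<Rightarrow> 'a operator \<Rightarrow> ('a \<Rightarrow> 'a \<Rightarrow> complex) \<Rightarrow> bool" where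
  "has_integral_kernel M S k \<longleftrightarrow>
     (\<lambda>(x, y). k x y) \<in> borel_measurable (M \<Otimes>\<^sub>M M) \<and>
     (\<forall>f\<in>Lp 2 M. AE x in M. integrable M (\<lambda>y. k x y * f y) \<and> S f x = (\<integral>y. k x y * f y \<partial>M))"

(* The bounded operators on L^p induced by S, an operator on L^2. By density of the
   intersection they all agree almost everywhere, but there may be none. *)
definition Lp_extensions :: "real \<Rightarrow> 'a measure \<Rightarrow> 'a operator \<Rightarrow> 'a operator set" where
  "Lp_extensions p M S =
     {S'. Lp_bounded p M S' \<and> (\<forall>f\<in>Lp p M \<inter> Lp 2 M. AE x in M. S' f x = S f x)}"

section \<open>R-boundedness on Lebesgue spaces\<close>

(* Joint law of n independent Rademacher variables, indexed by {..<n}. *)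
definition rademacher :: "nat \<Rightarrow> (nat \<Rightarrow> real) pmf" where
  "rademacher n = Pi_pmf {..<n} 0 (\<lambda>_. pmf_of_set {-1, 1})"

definition rademacher_norm :: "real \<Rightarrow> 'a measure \<Rightarrow> nat \<Rightarrow> (nat \<Rightarrow> 'a \<Rightarrow> complex) \<Rightarrow> real" where
  "rademacher_norm p M n u =
     sqrt (measure_pmf.expectation (rademacher n)
       (\<lambda>\<epsilon>. (Lp_norm p M (\<lambda>y. \<Sum>k<n. complex_of_real (\<epsilon> k) * u k y))\<^sup>2))"

(* The infimum of the empty set is infinity. *)
definition R_bound :: "real \<Rightarrow> 'a measure \<Rightarrow> 'a operator set \<Rightarrow> ennreal" where
  "R_bound p M \<tau> = Inf {ennreal C | C::real. C > 0 \<and>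
     (\<forall>n S f. (\<forall>k<n. S k \<in> \<tau> \<and> f k \<in> Lp p M) \<longrightarrow>
        rademacher_norm p M n (\<lambda>k. S k (f k)) \<le> C * rademacher_norm p M n f)}"

end

theory Submission
  imports Defs
begin

text \<open>
  Write \<open>z = r e\<^bsup>i\<theta>\<^esup>\<close>, \<open>\<delta> = cos \<theta>\<close> and \<open>L = 1 + \<bar>ln \<delta>\<bar>\<close>. On the ray of angle \<open>\<theta>\<close> the kernel bound depends on the distance
  \<open>\<rho>\<close> through \<open>s = \<rho> / r\<close> only: up to constants and the factor \<open>\<delta>\<^bsup>-\<beta>\<^esup>\<close>, it is \<open>r\<^bsup>-d\<^esup>\<close> times
  \<open>((1 - s\<^sup>2)\<^sup>2 + 4 s\<^sup>2 \<delta>\<^sup>2)\<^bsup>-(d+1)/4\<^esup>\<close>, which is positive, symmetric in the two points and concentrated near the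
  sphere \<open>\<rho> = r\<close>. The \<open>R\<close>-bound is deduced from this domination. The operators \<open>kop \<delta> r\<close> with this
  kernel (\<open>kop\<close> for ``kernel operator'') carry the whole argument.

  On \<open>L\<^sup>p\<close> the Rademacher norm is equivalent to the norm of the square function, by the inequalities of
  Khintchine and Minkowski (\<open>rademacher_norm_equiv_square_function\<close>). An \<open>R\<close>-bound is therefore a bound
  for \<open>(\<Sum>k. \<bar>S\<^sub>k f\<^sub>k\<bar>\<^sup>2)\<^bsup>1/2\<^esup>\<close> by \<open>(\<Sum>k. \<bar>f\<^sub>k\<bar>\<^sup>2)\<^bsup>1/2\<^esup>\<close> in \<open>L\<^sup>p\<close>. For symmetric positive kernels such a bound follows
  from two numbers (\<open>square_function_ge_2\<close>): the largest total mass of the kernels, which enters through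
  Cauchy-Schwarz, and the norm of the maximal operator \<open>g \<mapsto> sup\<^sub>j kop \<delta> (2\<^sup>j t) g\<close> on \<open>L\<^sup>q\<close> with
  \<open>q = (p/2)'\<close>, which enters by moving the operators to the other side of a pairing. The constant is the
  geometric mean of the two. This is for \<open>p \<ge> 2\<close>; the rest is duality (\<open>square_function_lt_2\<close>).

  To estimate the two numbers, choose \<open>m\<close> with \<open>2\<^bsup>-m\<^esup>\<close> of order \<open>\<delta>\<close>, so that \<open>m = O(L)\<close>. The kernel is
  at most a sum over \<open>1 \<le> k \<le> m\<close> of indicators of shells \<open>\<bar>\<rho> - r\<bar> < 2\<^bsup>-k\<^esup> r\<close> with weights \<open>2\<^bsup>k(d+1)/2\<^esup> r\<^bsup>-d\<^esup>\<close>, and of a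
  tail controlled by the ordinary maximal function (\<open>kop_le\<close>). By the annulus condition a shell has
  volume \<open>O(2\<^bsup>-k\<^esup> r\<^sup>d)\<close>. So the \<open>k\<close>-th shell has mass \<open>O(2\<^bsup>k(d-1)/2\<^esup>)\<close>, which is at most of order \<open>\<delta>\<^bsup>-(d-1)/2\<^esup>\<close>, and the
  total mass is \<open>O(\<delta>\<^bsup>-(d-1)/2\<^esup> L)\<close> (\<open>ker_mass\<close>).

  The decisive point is that the maximal function over the dyadic dilates of one normalised shell of
  relative width \<open>2\<^bsup>-k\<^esup>\<close> is bounded on \<open>L\<^sup>q\<close> with norm polynomial in \<open>k\<close>, although comparison of shells with
  balls loses \<open>2\<^sup>k\<close> (\<open>shell_max_level_sets\<close>). A shell does not see oscillations of \<open>f\<close> finer than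
  its own width, so \<open>f\<close> may be averaged at scale \<open>2\<^bsup>-k\<^esup> r\<close>. Where these averages are large, either averages
  at scales above \<open>r\<close> are large as well, and then the ordinary maximal function is large at the centre, or
  they drop between the scales \<open>2\<^bsup>-k\<^esup> r\<close> and \<open>r\<close>. At a given point the latter can happen for \<open>k\<close> dyadic
  values of \<open>r\<close> only, so that the \<open>L\<^sup>1\<close> bounds for the single shells may simply be added. In total the
  maximal operator has norm \<open>O(\<delta>\<^bsup>-(d-1)/2\<^esup> L\<^sup>3)\<close> (\<open>kop_max_strong_type\<close>), and the geometric mean with the
  total mass is \<open>O(\<delta>\<^bsup>-(d-1)/2\<^esup> L\<^sup>2)\<close>, as claimed.

  Three points remain. The volume conditions imply \<open>d \<ge> 1\<close> (\<open>dimension_ge_1\<close>) and the separability of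
  the space, on which measurability of the distance in both variables rests. In a bounded space the volume of large balls does not
  grow, but the kernels at radii beyond the diameter are all comparable to one of fixed radius
  (\<open>volume_kernel_dominated\<close>). Finally the integral operator is defined on \<open>L\<^sup>p\<close> by the domination and is
  the only bounded extension of the operator on \<open>L\<^sup>2\<close> (\<open>extension_eq_kernel_op\<close>), up to null sets.
\<close>

section \<open>Powers and level sets\<close>

text \<open>
  Maximal functions take the value \<open>\<top>\<close>, so powers are needed on \<open>ennreal\<close>. The value
  at \<open>\<top>\<close> is the right one for exponents \<open>q > 0\<close>; for these \<open>epowr\<close> is monotone and multiplicative.
\<close>

definition epowr :: "ennreal \<Rightarrow> real \<Rightarrow> ennreal" where
  "epowr x q = (if x = \<infinity> then \<infinity> else ennreal (enn2real x powr q))"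

lemma epowr_ennreal [simp]: "0 \<le> x \<Longrightarrow> epowr (ennreal x) q = ennreal (x powr q)"
  by (simp add: epowr_def)

lemma epowr_top [simp]: "epowr \<top> q = \<top>"
  by (simp add: epowr_def)

lemma epowr_zero [simp]: "epowr 0 q = 0"
  by (simp add: epowr_def)

lemma epowr_mono: "x \<le> y \<Longrightarrow> 0 \<le> q \<Longrightarrow> epowr x q \<le> epowr y q"
  by (cases x; cases y) (auto simp: top_unique intro!: powr_mono2)

lemma epowr_mult: "0 \<le> c \<Longrightarrow> 0 < q \<Longrightarrow> epowr (ennreal c * x) q = ennreal (c powr q) * epowr x q"
  by (cases x; cases "c = 0")
     (auto simp: ennreal_mult[symmetric] powr_mult ennreal_mult_top)

lemma borel_measurable_epowr [measurable (raw)]: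
  assumes [measurable]: "f \<in> borel_measurable N"
  shows "(\<lambda>x. epowr (f x) q) \<in> borel_measurable N"
  unfolding epowr_def by measurable

text \<open>
  The larger of the two numbers dominates: the product is at most its \<open>q\<close>-th power.
\<close>

lemma epowr_Young:
  assumes "1 < q"
  shows "x * epowr y (q - 1) \<le> epowr x q + epowr y q"
proof (cases x; cases y)
  fix a b :: real assume ab: "0 \<le> a" "x = ennreal a" "0 \<le> b" "y = ennreal b"
  have "a * b powr (q - 1) \<le> a powr q + b powr q"
  proof (cases "a \<le> b")
    case True
    then have "a * b powr (q - 1) \<le> b * b powr (q - 1)" by (intro mult_right_mono) auto
    also have "\<dots> = b powr q" using ab by (cases "b = 0") (auto simp: powr_mult_base)
    finally show ?thesis by (simp add: add_increasing)
  next
    case False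
    then have "a * b powr (q - 1) \<le> a * a powr (q - 1)"
      using ab assms by (intro mult_left_mono powr_mono2) auto
    also have "\<dots> = a powr q" using ab by (cases "a = 0") (auto simp: powr_mult_base)
    finally show ?thesis by (simp add: add_increasing2)
  qed
  then show ?thesis using ab by (simp add: ennreal_mult[symmetric] ennreal_plus[symmetric] del: ennreal_plus)
qed (auto simp: )

lemma layer_cake_pointwise:
  assumes "0 < q"
  shows "(\<integral>\<^sup>+l. ennreal (q * l powr (q - 1)) * indicator {l. 0 < l \<and> ennreal l < x} l \<partial>lborel) = epowr x q"
proof -
  have fin: "(\<integral>\<^sup>+l. ennreal (q * l powr (q - 1)) * indicator {l. 0 < l \<and> ennreal l < ennreal a} l \<partial>lborel)
      = ennreal (a powr q)" if a: "0 \<le> a" for a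
  proof -
    have "((\<lambda>l. q * l powr (q - 1)) has_integral (q * (a powr ((q - 1) + 1) / ((q - 1) + 1)))) {0..a}"
      using assms a by (intro has_integral_mult_right has_integral_powr_from_0) auto
    then have hi: "((\<lambda>l. q * l powr (q - 1)) has_integral (a powr q)) {0..a}"
      using assms by simp
    have "(\<integral>\<^sup>+l. ennreal (q * l powr (q - 1)) * indicator {0..a} l \<partial>lborel) = ennreal (a powr q)"
      by (rule nn_integral_has_integral_lebesgue'[OF _ hi]) (use assms in auto)
    moreover have "(\<integral>\<^sup>+l. ennreal (q * l powr (q - 1)) * indicator {l. 0 < l \<and> ennreal l < ennreal a} l \<partial>lborel)
       = (\<integral>\<^sup>+l. ennreal (q * l powr (q - 1)) * indicator {0..a} l \<partial>lborel)"
    proof (rule nn_integral_cong_AE)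
      have "AE l in lborel. l \<noteq> 0 \<and> l \<noteq> a"
        using AE_lborel_singleton[of 0] AE_lborel_singleton[of a] by eventually_elim auto
      then show "AE l in lborel. ennreal (q * l powr (q - 1)) * indicator {l. 0 < l \<and> ennreal l < ennreal a} l
           = ennreal (q * l powr (q - 1)) * indicator {0..a} l"
        by eventually_elim (use a in \<open>auto simp: indicator_def ennreal_less_iff\<close>)
    qed
    ultimately show ?thesis by simp
  qed
  show ?thesis
  proof (cases x)
    case (real a) then show ?thesis using fin[of a] by simp
  next
    case top
    have low: "ennreal (a powr q) \<le> (\<integral>\<^sup>+l. ennreal (q * l powr (q - 1)) * indicator {l. 0 < l \<and> ennreal l < x} l \<partial>lborel)"
      if "0 \<le> a" for a
      unfolding fin[OF that, symmetric] using top
      by (intro nn_integral_mono mult_left_mono) (auto simp: indicator_def)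
    have *: "ennreal b \<le> (\<integral>\<^sup>+l. ennreal (q * l powr (q - 1)) * indicator {l. 0 < l \<and> ennreal l < x} l \<partial>lborel)"
      if "0 \<le> b" for b using low[of "b powr (1 / q)"] that assms by (simp add: powr_powr)
    have "(\<integral>\<^sup>+l. ennreal (q * l powr (q - 1)) * indicator {l. 0 < l \<and> ennreal l < x} l \<partial>lborel) = \<top>"
      (is "?I = \<top>")
    proof (rule ccontr)
      assume "?I \<noteq> \<top>"
      then obtain c where c: "0 \<le> c" "?I = ennreal c" by (cases ?I) auto
      with *[of "c + 1"] show False by (simp add: ennreal_le_iff)
    qed
    then show ?thesis using top by simp
  qed
qed

text \<open>
  Tonelli's theorem for the pointwise identity. The weight \<open>f\<close> is carried along because level set
  estimates for maximal functions bound a measure by the mass of \<open>f\<close> over another level set.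
\<close>

lemma (in sigma_finite_measure) layer_cake:
  assumes [measurable]: "h \<in> borel_measurable M" "f \<in> borel_measurable M" and q: "0 < q"
  shows "(\<integral>\<^sup>+l. ennreal (q * l powr (q - 1)) * indicator {0<..} l * (\<integral>\<^sup>+x. f x * indicator {x. ennreal l < h x} x \<partial>M) \<partial>lborel)
     = (\<integral>\<^sup>+x. f x * epowr (h x) q \<partial>M)"
proof -
  interpret P: pair_sigma_finite M lborel by standard
  have "(\<integral>\<^sup>+x. f x * epowr (h x) q \<partial>M) =
     (\<integral>\<^sup>+x. \<integral>\<^sup>+l. f x * (ennreal (q * l powr (q - 1)) * indicator {l. 0 < l \<and> ennreal l < h x} l) \<partial>lborel \<partial>M)"
    by (subst nn_integral_cmult) (simp_all add: layer_cake_pointwise[OF q])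
  also have "\<dots> = (\<integral>\<^sup>+l. \<integral>\<^sup>+x. f x * (ennreal (q * l powr (q - 1)) * indicator {l. 0 < l \<and> ennreal l < h x} l) \<partial>M \<partial>lborel)"
    by (rule P.Fubini'[symmetric]) measurable
  also have "\<dots> = (\<integral>\<^sup>+l. ennreal (q * l powr (q - 1)) * indicator {0<..} l * (\<integral>\<^sup>+x. f x * indicator {x. ennreal l < h x} x \<partial>M) \<partial>lborel)"
    by (subst nn_integral_cmult[symmetric])
       (auto intro!: nn_integral_cong simp: indicator_def mult_ac)
  finally show ?thesis by simp
qed

text \<open>
  Marcinkiewicz interpolation against \<open>L\<^sup>\<infinity>\<close>: integrating the hypothesis against \<open>q l\<^bsup>q-1\<^esup> dl\<close>,
  the additional factor \<open>1/l\<close> lowers the exponent of the last level set function from \<open>q\<close> to \<open>q - 1\<close>.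
  The constant stays linear in \<open>c\<close>; this is what keeps the losses below logarithmic.
\<close>

lemma (in sigma_finite_measure) strong_type_from_level_sets:
  assumes [measurable]: "h \<in> borel_measurable M" "g \<in> borel_measurable M" "f \<in> borel_measurable M"
    "u \<in> borel_measurable M"
    and q: "1 < q" and c: "0 \<le> c"
    and le: "\<And>l. 0 < l \<Longrightarrow> emeasure M {x\<in>space M. ennreal l < h x} \<le> emeasure M {x\<in>space M. ennreal l < g x}
        + ennreal (c / l) * (\<integral>\<^sup>+x. f x * indicator {x. ennreal l < u x} x \<partial>M)"
  shows "(\<integral>\<^sup>+x. epowr (h x) q \<partial>M) \<le> (\<integral>\<^sup>+x. epowr (g x) q \<partial>M)
     + ennreal (c * q / (q - 1)) * (\<integral>\<^sup>+x. f x * epowr (u x) (q - 1) \<partial>M)"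
proof -
  interpret P: pair_sigma_finite M lborel by standard
  have em: "emeasure M {x\<in>space M. ennreal l < v x} = (\<integral>\<^sup>+x. 1 * indicator {x. ennreal l < v x} x \<partial>M)"
    if [measurable]: "v \<in> borel_measurable M" for v l
    by (subst nn_integral_indicator[symmetric], measurable, rule nn_integral_cong) (auto simp: indicator_def)
  have [measurable]: "(\<lambda>l. \<integral>\<^sup>+x. v x * indicator {x. ennreal l < w x} x \<partial>M) \<in> borel_measurable lborel"
    if [measurable]: "v \<in> borel_measurable M" "w \<in> borel_measurable M" for v w
    by measurable
  have "(\<integral>\<^sup>+x. epowr (h x) q \<partial>M) = (\<integral>\<^sup>+l. ennreal (q * l powr (q - 1)) * indicator {0<..} l * (\<integral>\<^sup>+x. 1 * indicator {x. ennreal l < h x} x \<partial>M) \<partial>lborel)"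
    using q by (subst layer_cake) auto
  also have "\<dots> \<le> (\<integral>\<^sup>+l. ennreal (q * l powr (q - 1)) * indicator {0<..} l * (\<integral>\<^sup>+x. 1 * indicator {x. ennreal l < g x} x \<partial>M)
      + ennreal (c * q / (q - 1)) * (ennreal ((q - 1) * l powr ((q - 1) - 1)) * indicator {0<..} l * (\<integral>\<^sup>+x. f x * indicator {x. ennreal l < u x} x \<partial>M)) \<partial>lborel)"
  proof (rule nn_integral_mono)
    fix l :: real
    show "ennreal (q * l powr (q - 1)) * indicator {0<..} l * (\<integral>\<^sup>+x. 1 * indicator {x. ennreal l < h x} x \<partial>M) \<le>
      ennreal (q * l powr (q - 1)) * indicator {0<..} l * (\<integral>\<^sup>+x. 1 * indicator {x. ennreal l < g x} x \<partial>M)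
      + ennreal (c * q / (q - 1)) * (ennreal ((q - 1) * l powr ((q - 1) - 1)) * indicator {0<..} l * (\<integral>\<^sup>+x. f x * indicator {x. ennreal l < u x} x \<partial>M))"
    proof (cases "0 < l")
      case True
      have eq: "ennreal (c * q / (q - 1)) * ennreal ((q - 1) * l powr ((q - 1) - 1)) = ennreal (q * l powr (q - 1)) * ennreal (c / l)"
      proof -
        have "c * q / (q - 1) * ((q - 1) * l powr ((q - 1) - 1)) = c * q * l powr ((q - 1) - 1)"
          using q by simp
        also have "\<dots> = q * l powr (q - 1) * (c / l)"
          using True powr_diff[of l "q - 1" 1] by simp
        finally show ?thesis using q c True by (simp add: ennreal_mult[symmetric])
      qed
      have "ennreal (q * l powr (q - 1)) * (\<integral>\<^sup>+x. 1 * indicator {x. ennreal l < h x} x \<partial>M) \<le>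
        ennreal (q * l powr (q - 1)) * ((\<integral>\<^sup>+x. 1 * indicator {x. ennreal l < g x} x \<partial>M)
        + ennreal (c / l) * (\<integral>\<^sup>+x. f x * indicator {x. ennreal l < u x} x \<partial>M))"
        using le[OF True] by (intro mult_left_mono) (auto simp: em)
      also have "\<dots> = ennreal (q * l powr (q - 1)) * (\<integral>\<^sup>+x. 1 * indicator {x. ennreal l < g x} x \<partial>M)
        + (ennreal (c * q / (q - 1)) * ennreal ((q - 1) * l powr ((q - 1) - 1))) * (\<integral>\<^sup>+x. f x * indicator {x. ennreal l < u x} x \<partial>M)"
        unfolding eq by (simp add: distrib_left mult.assoc)
      finally show ?thesis using True by (simp add: mult.assoc)
    qed simp
  qed
  also have "\<dots> = (\<integral>\<^sup>+x. epowr (g x) q \<partial>M)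
     + ennreal (c * q / (q - 1)) * (\<integral>\<^sup>+x. f x * epowr (u x) (q - 1) \<partial>M)"
    using q by (subst nn_integral_add, simp, simp, subst nn_integral_cmult, simp, subst layer_cake, simp, simp, simp, subst layer_cake) auto
  finally show ?thesis .
qed

section \<open>The dyadic maximal function\<close>

text \<open>
  Vitali's covering argument with sizes in \<open>\<int>\<close> bounded above. Consider the disjoint families
  such that every set meeting the family meets a member of at least its own size. A maximal one among
  them meets every set: otherwise a set of largest size among those not met could be added. With \<open>size\<close> constant this
  produces a maximal separated set.
\<close>

lemma Vitali_selection:
  fixes B :: "'i \<Rightarrow> 'b set" and size :: "'i \<Rightarrow> int"
  assumes nonempty: "\<And>x. x \<in> E \<Longrightarrow> B x \<noteq> {}" and bounded: "\<And>x. x \<in> E \<Longrightarrow> size x \<le> N"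
  obtains P where "P \<subseteq> E" "disjoint_family_on B P"
    "\<And>x. x \<in> E \<Longrightarrow> \<exists>p\<in>P. B x \<inter> B p \<noteq> {} \<and> size x \<le> size p"
proof -
  define good where "good = {P. P \<subseteq> E \<and> disjoint_family_on B P \<and>
    (\<forall>x\<in>E. (\<exists>p\<in>P. B x \<inter> B p \<noteq> {}) \<longrightarrow> (\<exists>p\<in>P. B x \<inter> B p \<noteq> {} \<and> size x \<le> size p))}"
  have "\<Union>\<C> \<in> good" if ch: "subset.chain good \<C>" for \<C>
  proof -
    have sub: "\<And>P. P \<in> \<C> \<Longrightarrow> P \<in> good" and tot: "\<And>P Q. P \<in> \<C> \<Longrightarrow> Q \<in> \<C> \<Longrightarrow> P \<subseteq> Q \<or> Q \<subseteq> P"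
      using ch by (auto simp: subset.chain_def)
    have "disjoint_family_on B (\<Union>\<C>)"
      unfolding disjoint_family_on_def
    proof (intro ballI impI)
      fix p q assume "p \<in> \<Union>\<C>" "q \<in> \<Union>\<C>" "p \<noteq> q"
      then obtain P where "P \<in> \<C>" "p \<in> P" "q \<in> P" using tot by blast
      then show "B p \<inter> B q = {}" using sub \<open>p \<noteq> q\<close> by (auto simp: good_def disjoint_family_on_def)
    qed
    moreover have "\<Union>\<C> \<subseteq> E" using sub unfolding good_def by blast
    moreover have "\<exists>p\<in>\<Union>\<C>. B x \<inter> B p \<noteq> {} \<and> size x \<le> size p"
      if x: "x \<in> E" and p: "p \<in> \<Union>\<C>" "B x \<inter> B p \<noteq> {}" for x p
    proof -
      obtain P where P: "P \<in> \<C>" "p \<in> P" using p by blast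
      then have "\<exists>p\<in>P. B x \<inter> B p \<noteq> {} \<and> size x \<le> size p"
        using sub[OF P(1)] x p unfolding good_def by blast
      then show ?thesis using P by blast
    qed
    ultimately show ?thesis unfolding good_def by blast
  qed
  from subset_Zorn'[OF this] obtain P where P: "P \<in> good" and max: "\<And>X. X \<in> good \<Longrightarrow> P \<subseteq> X \<Longrightarrow> X = P"
    by blast
  have meet: "\<exists>p\<in>P. B x \<inter> B p \<noteq> {}" if "x \<in> E" for x
  proof (rule ccontr)
    assume "\<not> (\<exists>p\<in>P. B x \<inter> B p \<noteq> {})"
    then have "x \<in> E \<and> (\<forall>p\<in>P. B x \<inter> B p = {})" using that by blast
    from ex_has_least_nat[of "\<lambda>x. x \<in> E \<and> (\<forall>p\<in>P. B x \<inter> B p = {})", OF this, of "\<lambda>x. nat (N - size x)"]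
    obtain z where z: "z \<in> E" "\<forall>p\<in>P. B z \<inter> B p = {}"
      and least: "\<And>y. y \<in> E \<Longrightarrow> \<forall>p\<in>P. B y \<inter> B p = {} \<Longrightarrow> nat (N - size z) \<le> nat (N - size y)" by blast
    have size: "size y \<le> size z" if "y \<in> E" "\<forall>p\<in>P. B y \<inter> B p = {}" for y
      using least[OF that] bounded[OF that(1)] bounded[OF z(1)] by simp
    have "insert z P \<in> good"
      unfolding good_def
    proof (intro CollectI conjI ballI impI)
      fix x assume x: "x \<in> E"
        and meets: "\<exists>p\<in>insert z P. B x \<inter> B p \<noteq> {}"
      show "\<exists>p\<in>insert z P. B x \<inter> B p \<noteq> {} \<and> size x \<le> size p"
      proof (cases "\<exists>p\<in>P. B x \<inter> B p \<noteq> {}")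
        case True
        then show ?thesis using P x unfolding good_def by blast
      next
        case False
        then show ?thesis using size[OF x] meets by blast
      qed
    next
      have "z \<notin> P" using z nonempty[OF z(1)] by auto
      then show "disjoint_family_on B (insert z P)"
        using P z by (subst disjoint_family_on_insert) (auto simp: good_def)
    qed (use P z in \<open>auto simp: good_def\<close>)
    from max[OF this] have "z \<in> P" by blast
    then show False using z nonempty[OF z(1)] by auto
  qed
  show ?thesis
    by (rule that[of P]) (use P meet in \<open>auto simp: good_def\<close>)
qed

definition rad :: "real \<Rightarrow> int \<Rightarrow> real" where
  "rad t i = 2 powi i * t"

lemma rad_pos: "0 < t \<Longrightarrow> 0 < rad t i"
  by (simp add: rad_def)

lemma rad_mono: "0 < t \<Longrightarrow> i \<le> j \<Longrightarrow> rad t i \<le> rad t j"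
  unfolding rad_def by (intro mult_right_mono power_int_increasing) auto

lemma rad_Suc: "rad t (i + 1) = 2 * rad t i"
  by (simp add: rad_def power_int_add)

lemma rad_shift: "(1/2) ^ m * rad t j = rad t (j - int m)"
  by (simp add: rad_def power_int_diff power_one_over)

lemma rad_add: "2 ^ n * rad t j = rad t (j + int n)"
  by (simp add: rad_def power_int_add)

text \<open>
  What the argument needs of the space, in a form that covers bounded and unbounded spaces alike.
  An annulus at distance \<open>R\<close> of thickness \<open>h\<close> has measure \<open>O(h R\<^bsup>d-1\<^esup>)\<close>; Lower bounds for balls enter
  through doubling. Separability makes the distance measurable for the product \<open>\<sigma>\<close>-algebra, which in general is
  smaller than the Borel \<open>\<sigma>\<close>-algebra of the product space.
\<close>

locale thin_annulus_space =
  fixes M :: "'a::metric_space measure" and d D V :: real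
  assumes sets_M: "sets M = sets borel"
    and separable: "\<exists>S::'a set. countable S \<and> (\<forall>x. \<forall>e>0. \<exists>y\<in>S. dist x y < e)"
    and ball_finite: "emeasure M (ball x r) < \<infinity>"
    and ball_pos: "0 < r \<Longrightarrow> 0 < measure M (ball x r)"
    and ball_le: "0 < r \<Longrightarrow> measure M (ball x r) \<le> V * r powr d"
    and doubling: "0 < r \<Longrightarrow> measure M (ball x (2 * r)) \<le> D * measure M (ball x r)"
    and annulus_le: "0 < R \<Longrightarrow> R / 2 < r \<Longrightarrow> r < R \<Longrightarrow> measure M (annulus x r R) \<le> V * (R - r) * R powr (d - 1)"
    and d: "1 \<le> d" and D: "1 \<le> D" and V: "0 < V"
begin

lemma space_M [simp]: "space M = UNIV"
  using sets_eq_imp_space_eq[OF sets_M] by simp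

lemma ball_meas [measurable]: "ball x r \<in> sets M"
  by (simp add: sets_M)

lemma emeasure_ball: "emeasure M (ball x r) = ennreal (measure M (ball x r))"
  using ball_finite by (intro emeasure_eq_ennreal_measure) (auto simp: top_unique less_top[symmetric])

sublocale sigma_finite_measure M
proof
  show "\<exists>A. countable A \<and> A \<subseteq> sets M \<and> \<Union>A = space M \<and> (\<forall>a\<in>A. emeasure M a \<noteq> \<infinity>)"
  proof (intro exI conjI)
    fix x0 :: 'a
    show "countable (range (\<lambda>n::nat. ball x0 (real n)))" by simp
    show "\<Union>(range (\<lambda>n::nat. ball x0 (real n))) = space M"
      using reals_Archimedean2 by auto
    show "\<forall>a\<in>range (\<lambda>n::nat. ball x0 (real n)). emeasure M a \<noteq> \<infinity>"
      using ball_finite by (auto simp: less_top[symmetric])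
  qed auto
qed

sublocale MM: pair_sigma_finite M M ..

text \<open>
  Over a countable dense set \<open>S\<close> the distance is the infimum of the separately measurable functions
  \<open>dist u s + dist v s\<close>.
\<close>

lemma borel_measurable_dist_M [measurable (raw)]:
  assumes f: "f \<in> measurable N M" and g: "g \<in> measurable N M"
  shows "(\<lambda>x. dist (f x) (g x)) \<in> borel_measurable N"
proof -
  obtain S :: "'a set" where S: "countable S" "\<And>x e. 0 < e \<Longrightarrow> \<exists>y\<in>S. dist x y < e" using separable by blast
  have S0: "S \<noteq> {}" using S(2)[of 1] by auto
  have const: "(\<lambda>x. dist (h x) s) \<in> borel_measurable N" if h: "h \<in> measurable N M" for h s
  proof -
    have "(\<lambda>y. dist y s) \<in> borel_measurable borel" by (intro borel_measurable_continuous_onI continuous_intros)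
    moreover have "h \<in> measurable N borel" using h measurable_cong_sets[OF refl sets_M] by blast
    ultimately show ?thesis by (rule measurable_compose[rotated])
  qed
  have eq: "dist u v = (INF s\<in>S. dist u s + dist v s)" for u v
  proof (rule antisym)
    show "dist u v \<le> (INF s\<in>S. dist u s + dist v s)"
      using S0 by (intro cINF_greatest) (auto intro: dist_triangle2)
    show "(INF s\<in>S. dist u s + dist v s) \<le> dist u v"
    proof (rule field_le_epsilon)
      fix e :: real assume "0 < e"
      then obtain s where s: "s \<in> S" "dist v s < e / 2" using S(2)[of "e / 2" v] by auto
      have "(INF s\<in>S. dist u s + dist v s) \<le> dist u s + dist v s"
        using s by (intro cINF_lower bdd_belowI2[where m=0]) auto
      also have "\<dots> \<le> (dist u v + dist v s) + dist v s" using dist_triangle[of u s v] by simp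
      finally show "(INF s\<in>S. dist u s + dist v s) \<le> dist u v + e" using s by simp
    qed
  qed
  have "(\<lambda>x. dist (f x) (g x)) = (\<lambda>x. INF s\<in>S. dist (f x) s + dist (g x) s)"
    by (rule ext, rule eq)
  also have "\<dots> \<in> borel_measurable N"
  proof (rule borel_measurable_cINF[OF S(1)])
    show "(\<lambda>x. dist (f x) s + dist (g x) s) \<in> borel_measurable N" for s
      by (rule borel_measurable_add[OF const[OF f] const[OF g]])
    show "bdd_below ((\<lambda>s. dist (f x) s + dist (g x) s) ` S)" for x
      by (rule bdd_belowI2[where m=0]) simp
  qed
  finally show ?thesis .
qed

lemma indicator_ball: "indicator (ball x r) y = indicator {y. dist x y < r} y"
  by (simp add: indicator_def)

lemma borel_measurable_volume [measurable (raw)]: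
  assumes [measurable]: "f \<in> measurable N M"
  shows "(\<lambda>x. measure M (ball (f x) r)) \<in> borel_measurable N"
proof -
  have eq: "measure M (ball x r) = enn2real (\<integral>\<^sup>+y. indicator {y. dist x y < r} y \<partial>M)" for x
    unfolding measure_def indicator_ball[symmetric] by simp
  show ?thesis unfolding eq by measurable
qed

definition avg :: "real \<Rightarrow> ('a \<Rightarrow> ennreal) \<Rightarrow> 'a \<Rightarrow> ennreal" where
  "avg s f x = ennreal (1 / measure M (ball x s)) * (\<integral>\<^sup>+y. f y * indicator {y. dist x y < s} y \<partial>M)"

lemma borel_measurable_avg [measurable (raw)]:
  assumes [measurable]: "f \<in> borel_measurable M" "g \<in> measurable N M"
  shows "(\<lambda>x. avg s f (g x)) \<in> borel_measurable N"
  unfolding avg_def by measurable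

text \<open>
  Inclusion of the ball in \<open>ball y (2 ^ n * s)\<close>, followed by \<open>n\<close> doublings.
\<close>

lemma ball_doubling_le:
  assumes "0 < s" "dist x y + r \<le> 2 ^ n * s"
  shows "measure M (ball x r) \<le> D ^ n * measure M (ball y s)"
proof -
  have "measure M (ball y (2 ^ n * s)) \<le> D ^ n * measure M (ball y s)"
  proof (induction n)
    case (Suc n)
    have "measure M (ball y (2 ^ Suc n * s)) \<le> D * measure M (ball y (2 ^ n * s))"
      using doubling[of "2 ^ n * s" y] assms(1) by (simp add: mult.assoc)
    also have "\<dots> \<le> D * (D ^ n * measure M (ball y s))"
      using Suc D by (intro mult_left_mono) auto
    finally show ?case by (simp add: mult.assoc)
  qed simp
  moreover have "ball x r \<subseteq> ball y (2 ^ n * s)"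
  proof
    fix z assume "z \<in> ball x r"
    then show "z \<in> ball y (2 ^ n * s)" using assms(2) dist_triangle3[of y z x] by simp
  qed
  then have "measure M (ball x r) \<le> measure M (ball y (2 ^ n * s))"
    using ball_finite[of y "2 ^ n * s"] by (intro measure_mono_fmeasurable) (auto simp: fmeasurable_def)
  ultimately show ?thesis by linarith
qed

lemma avg_le_avg:
  assumes s: "0 < s" "0 < s'" and near: "dist x y + s \<le> s'" and n: "dist x y + s' \<le> 2 ^ n * s"
  shows "avg s f x \<le> ennreal (D ^ n) * avg s' f y"
proof -
  have "measure M (ball y s') \<le> D ^ n * measure M (ball x s)"
    using n s by (intro ball_doubling_le) (auto simp: dist_commute)
  then have "1 / measure M (ball x s) \<le> D ^ n * (1 / measure M (ball y s'))"
    using ball_pos[OF s(1), of x] ball_pos[OF s(2), of y] D by (simp add: field_simps)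
  then have "ennreal (1 / measure M (ball x s)) \<le> ennreal (D ^ n) * ennreal (1 / measure M (ball y s'))"
    using D by (subst ennreal_mult[symmetric]) (auto intro!: ennreal_leI)
  moreover have "(\<integral>\<^sup>+z. f z * indicator {z. dist x z < s} z \<partial>M) \<le> (\<integral>\<^sup>+z. f z * indicator {z. dist y z < s'} z \<partial>M)"
  proof (intro nn_integral_mono mult_left_mono)
    fix z show "indicator {z. dist x z < s} z \<le> (indicator {z. dist y z < s'} z :: ennreal)"
      using near dist_triangle3[of y z x] by (auto simp: indicator_def dist_commute)
  qed simp
  ultimately show ?thesis
    unfolding avg_def mult.assoc[symmetric] by (intro mult_mono) auto
qed

text \<open>
  The classical weak type (1,1) bound. A Vitali family of balls on which the average exceeds \<open>l\<close> is
  disjoint, and the doubled balls cover. Only dyadic radii occur, so the sizes are integers; they are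
  first truncated at \<open>2\<^sup>N t\<close> to have a largest one, and \<open>N\<close> then tends to infinity.
\<close>

lemma avg_weak_type:
  assumes [measurable]: "f \<in> borel_measurable M" and t: "0 < t" and l: "0 < l"
  shows "emeasure M {x. \<exists>i. ennreal l < avg (rad t i) f x} \<le> ennreal (D / l) * (\<integral>\<^sup>+x. f x \<partial>M)"
proof -
  have r: "0 < rad t i" for i using t by (rule rad_pos)
  define E where "E N = {x. \<exists>i\<le>int N. ennreal l < avg (rad t i) f x}" for N
  have [measurable]: "E N \<in> sets M" for N
  proof -
    have "E N = {x\<in>space M. \<exists>i. i \<le> int N \<and> ennreal l < avg (rad t i) f x}" by (simp add: E_def)
    also have "\<dots> \<in> sets M" by measurable
    finally show ?thesis .
  qed
  have bound: "emeasure M (E N) \<le> ennreal (D / l) * (\<integral>\<^sup>+x. f x \<partial>M)" for N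
  proof -
    have "\<forall>x\<in>E N. \<exists>i\<le>int N. ennreal l < avg (rad t i) f x" by (auto simp: E_def)
    then obtain idx where idx: "\<And>x. x \<in> E N \<Longrightarrow> idx x \<le> int N \<and> ennreal l < avg (rad t (idx x)) f x"
      by metis
    define B where "B x = ball x (rad t (idx x))" for x
    have Bx: "x \<in> B x" for x using r by (simp add: B_def)
    obtain P where P: "P \<subseteq> E N" "disjoint_family_on B P"
      and cover: "\<And>x. x \<in> E N \<Longrightarrow> \<exists>p\<in>P. B x \<inter> B p \<noteq> {} \<and> idx x \<le> idx p"
      using Vitali_selection[of "E N" B idx "int N"] idx Bx by (metis empty_iff)
    obtain S :: "'a set" where S: "countable S" "\<And>x e. 0 < e \<Longrightarrow> \<exists>y\<in>S. dist x y < e" using separable by blast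
    have "\<forall>p. \<exists>s\<in>S. s \<in> B p" using S(2)[OF r] by (auto simp: B_def)
    then obtain pt where pt: "\<And>p. pt p \<in> S" "\<And>p. pt p \<in> B p" by metis
    \<comment> \<open>The disjoint balls contain distinct points of a countable dense set.\<close>
    have "inj_on pt P"
    proof (rule inj_onI, rule ccontr)
      fix p q assume "p \<in> P" "q \<in> P" "pt p = pt q" "p \<noteq> q"
      then have "B p \<inter> B q = {}" using P(2) by (auto simp: disjoint_family_on_def)
      then show False using pt(2)[of p] pt(2)[of q] \<open>pt p = pt q\<close> by auto
    qed
    then have cP: "countable P"
      using S(1) pt(1) by (metis countable_image_inj_on countable_subset image_subsetI)
    have single: "(\<integral>\<^sup>+p. f x * indicator (B p) x \<partial>count_space P) \<le> f x" for x
    proof (cases "\<exists>p\<in>P. x \<in> B p")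
      case True
      then obtain p where p: "p \<in> P" "x \<in> B p" by blast
      have uniq: "q = p" if "q \<in> P" "x \<in> B q" for q
        using disjoint_family_onD[OF P(2) that(1) p(1)] p(2) that(2) by (cases "q = p") auto
      have "f x * indicator (B q) x = f x * indicator {p} q" if "q \<in> P" for q
        using p(2) uniq[OF that] by (cases "x \<in> B q") (auto simp: indicator_def)
      then have "(\<integral>\<^sup>+q. f x * indicator (B q) x \<partial>count_space P) = (\<integral>\<^sup>+q. f x * indicator {p} q \<partial>count_space P)"
        by (intro nn_integral_cong) simp
      also have "\<dots> = f x" using p by (subst nn_integral_cmult) simp_all
      finally show ?thesis by simp
    next
      case False
      then have "(\<integral>\<^sup>+q. f x * indicator (B q) x \<partial>count_space P) = (\<integral>\<^sup>+q. 0 \<partial>count_space P)"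
        by (intro nn_integral_cong) (auto simp: indicator_def)
      then show ?thesis by simp
    qed
    have vol: "emeasure M (ball p (2 * rad t (idx p))) \<le> ennreal (D / l) * (\<integral>\<^sup>+y. f y * indicator (B p) y \<partial>M)"
      if p: "p \<in> P" for p
    proof -
      let ?v = "measure M (ball p (rad t (idx p)))"
      let ?J = "\<integral>\<^sup>+y. f y * indicator (B p) y \<partial>M"
      have v: "0 < ?v" using r by (rule ball_pos)
      have "p \<in> E N" using p P by blast
      then have "ennreal l < ennreal (1 / ?v) * ?J"
        using idx by (simp add: avg_def B_def indicator_ball)
      then have "ennreal ?v * ennreal l \<le> ennreal ?v * (ennreal (1 / ?v) * ?J)"
        by (intro mult_left_mono) auto
      also have "\<dots> = ?J" using v by (simp add: mult.assoc[symmetric] ennreal_mult[symmetric])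
      finally have "ennreal ?v * ennreal l \<le> ?J" .
      then have "ennreal (D / l) * (ennreal ?v * ennreal l) \<le> ennreal (D / l) * ?J" by (intro mult_left_mono) auto
      also have "ennreal (D / l) * (ennreal ?v * ennreal l) = ennreal (D * ?v)"
        using l D v by (simp add: ennreal_mult[symmetric])
      finally have "ennreal (D * ?v) \<le> ennreal (D / l) * ?J" .
      moreover have "emeasure M (ball p (2 * rad t (idx p))) \<le> ennreal (D * ?v)"
        using doubling[OF r, of p] by (subst emeasure_ball) (rule ennreal_leI)
      ultimately show ?thesis by (rule order_trans[rotated])
    qed
    have "emeasure M (E N) = (\<integral>\<^sup>+x. indicator (E N) x \<partial>M)" by simp
    also have "\<dots> \<le> (\<integral>\<^sup>+x. \<integral>\<^sup>+p. indicator (ball p (2 * rad t (idx p))) x \<partial>count_space P \<partial>M)"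
    proof (rule nn_integral_mono)
      fix x
      show "indicator (E N) x \<le> (\<integral>\<^sup>+p. (indicator (ball p (2 * rad t (idx p))) x::ennreal) \<partial>count_space P)"
      proof (cases "x \<in> E N")
        case True
        then obtain p where p: "p \<in> P" "B x \<inter> B p \<noteq> {}" "idx x \<le> idx p" using cover by blast
        then obtain z where z: "dist x z < rad t (idx x)" "dist p z < rad t (idx p)" by (auto simp: B_def)
        have "rad t (idx x) \<le> rad t (idx p)" using p t by (intro rad_mono) auto
        then have "dist p x < 2 * rad t (idx p)" using z dist_triangle2[of p x z] by simp
        then have "(indicator {p} q::ennreal) \<le> indicator (ball q (2 * rad t (idx q))) x" for q
          by (auto simp: indicator_def)
        then have "(\<integral>\<^sup>+q. indicator {p} q \<partial>count_space P) \<le> (\<integral>\<^sup>+q. (indicator (ball q (2 * rad t (idx q))) x::ennreal) \<partial>count_space P)"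
          by (intro nn_integral_mono)
        moreover have "(\<integral>\<^sup>+q. indicator {p} q \<partial>count_space P) = 1" using p by simp
        ultimately show ?thesis by (simp add: indicator_def)
      qed simp
    qed
    also have "\<dots> = (\<integral>\<^sup>+p. \<integral>\<^sup>+x. indicator (ball p (2 * rad t (idx p))) x \<partial>M \<partial>count_space P)"
      by (rule nn_integral_count_space_nn_integral[OF cP]) simp
    also have "\<dots> = (\<integral>\<^sup>+p. emeasure M (ball p (2 * rad t (idx p))) \<partial>count_space P)"
      by simp
    also have "\<dots> \<le> (\<integral>\<^sup>+p. ennreal (D / l) * (\<integral>\<^sup>+y. f y * indicator (B p) y \<partial>M) \<partial>count_space P)"
      using vol by (intro nn_integral_mono) simp
    also have "\<dots> = ennreal (D / l) * (\<integral>\<^sup>+p. \<integral>\<^sup>+y. f y * indicator (B p) y \<partial>M \<partial>count_space P)"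
      by (rule nn_integral_cmult) simp
    also have "(\<integral>\<^sup>+p. \<integral>\<^sup>+y. f y * indicator (B p) y \<partial>M \<partial>count_space P) = (\<integral>\<^sup>+y. \<integral>\<^sup>+p. f y * indicator (B p) y \<partial>count_space P \<partial>M)"
      by (rule nn_integral_count_space_nn_integral[OF cP, symmetric]) (simp add: B_def)
    also have "ennreal (D / l) * \<dots> \<le> ennreal (D / l) * (\<integral>\<^sup>+x. f x \<partial>M)"
      by (intro mult_left_mono nn_integral_mono single) simp
    finally show ?thesis .
  qed
  have "{x. \<exists>i. ennreal l < avg (rad t i) f x} = (\<Union>N. E N)"
  proof -
    have "\<exists>N. i \<le> int N" for i by (rule exI[of _ "nat i"]) simp
    then show ?thesis by (fastforce simp: E_def)
  qed
  moreover have "emeasure M (\<Union>N. E N) = (SUP N. emeasure M (E N))"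
  proof (rule SUP_emeasure_incseq[symmetric])
    have "E m \<subseteq> E n" if "m \<le> n" for m n
    proof -
      have "int m \<le> int n" using that by simp
      then show ?thesis unfolding E_def by (blast intro: order_trans)
    qed
    then show "incseq E" by (simp add: incseq_def)
  qed auto
  ultimately show ?thesis using bound by (auto intro: SUP_least)
qed

definition HL_max :: "real \<Rightarrow> ('a \<Rightarrow> ennreal) \<Rightarrow> 'a \<Rightarrow> ennreal" where
  "HL_max t f x = (SUP i. avg (rad t i) f x)"

lemma borel_measurable_HL_max [measurable (raw)]:
  assumes [measurable]: "f \<in> borel_measurable M" "g \<in> measurable N M"
  shows "(\<lambda>x. HL_max t f (g x)) \<in> borel_measurable N"
  unfolding HL_max_def by measurable

lemma avg_le_HL_max: "avg (rad t i) f x \<le> HL_max t f x"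
  unfolding HL_max_def by (rule SUP_upper) simp

lemma avg_const: "0 < s \<Longrightarrow> avg s (\<lambda>_. ennreal c) x = ennreal c"
  using ball_pos[of s x]
  by (simp add: avg_def nn_integral_cmult_indicator ball_def[symmetric] emeasure_ball ennreal_mult'[symmetric] ennreal_mult''[symmetric])
 
text \<open>
  Weak type (1,1) applied to the part of \<open>f\<close> above \<open>l / 2\<close>: the rest contributes at most \<open>l / 2\<close> to every
  average. Integration of the level sets then gives the strong type bound.
\<close>

lemma HL_max_strong_type:
  assumes [measurable]: "f \<in> borel_measurable M" and t: "0 < t" and q: "1 < q"
  shows "(\<integral>\<^sup>+x. epowr (HL_max t f x) q \<partial>M) \<le> ennreal (2 * D * q / (q - 1) * 2 powr (q - 1)) * (\<integral>\<^sup>+x. epowr (f x) q \<partial>M)"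
proof -
  have "(\<integral>\<^sup>+x. epowr (HL_max t f x) q \<partial>M) \<le> (\<integral>\<^sup>+x. epowr 0 q \<partial>M) + ennreal (2 * D * q / (q - 1)) * (\<integral>\<^sup>+x. f x * epowr (2 * f x) (q - 1) \<partial>M)"
  proof (rule strong_type_from_level_sets[where g="\<lambda>_. 0" and u="\<lambda>x. 2 * f x" and f=f and h="HL_max t f" and c="2 * D"])
    fix l :: real assume l: "0 < l"
    define f' where "f' x = f x * indicator {x. ennreal l < 2 * f x} x" for x
    have [measurable]: "f' \<in> borel_measurable M" unfolding f'_def by measurable
    have split: "f x \<le> f' x + ennreal (l / 2)" for x
    proof (cases "ennreal l < 2 * f x")
      case False
      then have "2 * f x \<le> ennreal l" by simp
      then have "f x \<le> ennreal (l / 2)"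
        using l by (cases "f x") (auto simp: ennreal_mult[symmetric] numeral_mult_ennreal top_unique ennreal_mult_top)
      then show ?thesis by (simp add: add_increasing)
    qed (simp add: f'_def)
    have split_avg: "avg s f x \<le> avg s f' x + ennreal (l / 2)" if s: "0 < s" for s x
    proof -
      have "avg s f x \<le> ennreal (1 / measure M (ball x s)) * (\<integral>\<^sup>+y. f' y * indicator {y. dist x y < s} y + ennreal (l / 2) * indicator {y. dist x y < s} y \<partial>M)"
        unfolding avg_def using split
        by (intro mult_left_mono nn_integral_mono) (auto simp: indicator_def)
      also have "\<dots> = avg s f' x + avg s (\<lambda>_. ennreal (l / 2)) x"
        unfolding avg_def by (subst nn_integral_add) (auto simp: distrib_left)
      finally show ?thesis using avg_const[OF s] by simp
    qed
    have *: "\<exists>i. ennreal (l / 2) < avg (rad t i) f' x" if above: "ennreal l < HL_max t f x" for x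
    proof -
      obtain i where "ennreal l < avg (rad t i) f x" using above unfolding HL_max_def less_SUP_iff by blast
      also have "\<dots> \<le> avg (rad t i) f' x + ennreal (l / 2)" using split_avg[OF rad_pos[OF t]] .
      finally have "ennreal (l / 2) + ennreal (l / 2) < avg (rad t i) f' x + ennreal (l / 2)"
        using l by (simp add: ennreal_plus[symmetric] del: ennreal_plus)
      then have "ennreal (l / 2) < avg (rad t i) f' x"
        by (rule_tac ccontr) (auto simp: not_less dest: add_right_mono[of _ _ "ennreal (l / 2)"])
      then show ?thesis by blast
    qed
    have "emeasure M {x\<in>space M. ennreal l < HL_max t f x} \<le> emeasure M {x\<in>space M. \<exists>i. ennreal (l / 2) < avg (rad t i) f' x}"
    proof (rule emeasure_mono)
      show "{x\<in>space M. \<exists>i. ennreal (l / 2) < avg (rad t i) f' x} \<in> sets M" by measurable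
    qed (use * in auto)
    also have "\<dots> \<le> ennreal (D / (l / 2)) * (\<integral>\<^sup>+x. f' x \<partial>M)"
      using avg_weak_type[of f' t "l / 2"] t l by simp
    finally show "emeasure M {x\<in>space M. ennreal l < HL_max t f x} \<le> emeasure M {x\<in>space M. ennreal l < 0}
        + ennreal (2 * D / l) * (\<integral>\<^sup>+x. f x * indicator {x. ennreal l < 2 * f x} x \<partial>M)"
      by (simp add: f'_def mult.commute)
  qed (use q D in auto)
  also have "(\<integral>\<^sup>+x. f x * epowr (2 * f x) (q - 1) \<partial>M) = ennreal (2 powr (q - 1)) * (\<integral>\<^sup>+x. epowr (f x) q \<partial>M)"
  proof (subst nn_integral_cmult[symmetric], simp, rule nn_integral_cong)
    fix x
    have "f x * epowr (f x) (q - 1) = epowr (f x) q"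
      using q by (cases "f x") (auto simp: ennreal_mult[symmetric] powr_mult_base ennreal_mult_top)
    moreover have "epowr (2 * f x) (q - 1) = ennreal (2 powr (q - 1)) * epowr (f x) (q - 1)"
      using epowr_mult[of 2 "q - 1" "f x"] q by simp
    ultimately show "f x * epowr (2 * f x) (q - 1) = ennreal (2 powr (q - 1)) * epowr (f x) q"
      by (metis mult.left_commute)
  qed
  finally show ?thesis using q D by (simp add: mult.assoc[symmetric] ennreal_mult[symmetric])
qed

end

section \<open>Averages over thin shells\<close>

context thin_annulus_space
begin

text \<open>
  A shell of relative width \<open>2\<^bsup>-m\<^esup>\<close> has volume \<open>O(2\<^bsup>-m\<^esup> r\<^sup>d)\<close> but no lower bound of this order. The normalisation
  uses the upper bound, so that constants have bounded averages.
\<close>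

definition shell_avg :: "nat \<Rightarrow> real \<Rightarrow> ('a \<Rightarrow> ennreal) \<Rightarrow> 'a \<Rightarrow> ennreal" where
  "shell_avg m r f x = ennreal (2 ^ m / r powr d) *
     (\<integral>\<^sup>+y. f y * indicator {y. \<bar>dist x y - r\<bar> < (1/2) ^ m * r} y \<partial>M)"

definition wide_avg :: "nat \<Rightarrow> real \<Rightarrow> ('a \<Rightarrow> ennreal) \<Rightarrow> 'a \<Rightarrow> ennreal" where
  "wide_avg m r f x = ennreal (2 ^ m / r powr d) *
     (\<integral>\<^sup>+y. f y * indicator {y. \<bar>dist x y - r\<bar> < 2 * (1/2) ^ m * r} y \<partial>M)"

lemma borel_measurable_shell_avg [measurable (raw)]:
  assumes [measurable]: "f \<in> borel_measurable M" "g \<in> measurable N M"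
  shows "(\<lambda>x. shell_avg m r f (g x)) \<in> borel_measurable N"
  unfolding shell_avg_def by measurable

lemma borel_measurable_wide_avg [measurable (raw)]:
  assumes [measurable]: "f \<in> borel_measurable M" "g \<in> measurable N M"
  shows "(\<lambda>x. wide_avg m r f (g x)) \<in> borel_measurable N"
  unfolding wide_avg_def by measurable

definition W :: real where "W = 4 * V * 3 powr d"

lemma W_pos: "0 < W"
  using V by (simp add: W_def)

lemma shell_meas [measurable]: "{y. \<bar>dist x y - r\<bar> < s} \<in> sets M"
proof -
  have "{y\<in>space M. \<bar>dist x y - r\<bar> < s} \<in> sets M" by measurable
  then show ?thesis by simp
qed

lemma emeasure_le_of_subset:
  assumes "A \<subseteq> B" "B \<subseteq> ball x R" "B \<in> sets M" "measure M B \<le> c"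
  shows "emeasure M A \<le> ennreal c"
proof -
  have "emeasure M B \<le> emeasure M (ball x R)" using assms by (intro emeasure_mono) auto
  then have "emeasure M B < \<top>" using ball_finite[of x R] by (simp add: le_less_trans)
  then have "emeasure M B = ennreal (measure M B)" by (intro emeasure_eq_ennreal_measure) auto
  moreover have "emeasure M A \<le> emeasure M B" using assms by (intro emeasure_mono) auto
  ultimately show ?thesis using assms(4) by (auto intro: order_trans ennreal_leI)
qed

text \<open>
  For \<open>m \<ge> 3\<close> the shell lies in an annulus whose inner radius exceeds half the outer one, as the annulus
  bound requires. For smaller \<open>m\<close> the enclosing ball of radius \<open>3 r\<close> has comparable volume.
\<close>

lemma wide_shell_volume:
  assumes r: "0 < r"
  shows "emeasure M {y. \<bar>dist x y - r\<bar> < 2 * (1/2) ^ m * r} \<le> ennreal (W * (r powr d / 2 ^ m))"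
proof (cases "3 \<le> m")
  case True
  define h :: real where "h = (1/2) ^ m"
  have "h \<le> (1/2) ^ 3" unfolding h_def using True by (intro power_decreasing) auto
  then have h: "0 < h" "h \<le> 1/8" by (simp_all add: h_def power3_eq_cube)
  let ?a = "(1 - 2 * h) * r" and ?b = "(1 + 2 * h) * r"
  have hr: "h * r \<le> r / 8" "0 < h * r" using h r by simp_all
  have "measure M (annulus x ?a ?b) \<le> V * (?b - ?a) * ?b powr (d - 1)"
  proof (rule annulus_le)
    define z where "z = h * r"
    have eqs: "?a = r - 2 * z" "?b = r + 2 * z" by (simp_all add: z_def algebra_simps)
    have hr: "z \<le> r / 8" "0 < z" using hr by (simp_all add: z_def)
    show "0 < ?b" unfolding eqs using hr r by simp
    show "?b / 2 < ?a" unfolding eqs using hr r by (simp add: field_simps)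
    show "?a < ?b" unfolding eqs using hr r by simp
  qed
  also have "\<dots> \<le> V * (?b - ?a) * (3 * r) powr (d - 1)"
    using V h hr r d by (intro mult_left_mono powr_mono2) (simp_all add: algebra_simps)
  also have "\<dots> = (4 / 3) * V * h * ((3 * r) powr (d - 1) * (3 * r))"
    by (simp add: algebra_simps)
  also have "(3 * r) powr (d - 1) * (3 * r) = (3 * r) powr d"
    using r by (simp add: powr_mult_base mult.commute[of _ "3 * r"])
  also have "(4 / 3) * V * h * (3 * r) powr d \<le> 4 * V * h * (3 * r) powr d"
    using V h by (intro mult_right_mono) auto
  also have "\<dots> = W * (r powr d / 2 ^ m)"
    using r by (simp add: W_def h_def powr_mult power_one_over)
  finally have "measure M (annulus x ?a ?b) \<le> W * (r powr d / 2 ^ m)" .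
  then show ?thesis
    by (rule emeasure_le_of_subset[where x=x and R="?b", rotated 3])
       (auto simp: annulus_def h_def[symmetric] algebra_simps abs_less_iff)
next
  case False
  then have "(2::real) ^ m \<le> 2 ^ 2" by (intro power_increasing) auto
  then have m: "1 \<le> 4 / (2 ^ m :: real)" by simp
  have "measure M (ball x (3 * r)) \<le> V * (3 * r) powr d" using r by (intro ball_le) simp
  also have "\<dots> \<le> V * (3 * r) powr d * (4 / 2 ^ m)"
    using m V mult_left_mono[OF m, of "V * (3 * r) powr d"] by simp
  also have "\<dots> = W * (r powr d / 2 ^ m)" using r by (simp add: W_def powr_mult)
  finally have le: "measure M (ball x (3 * r)) \<le> W * (r powr d / 2 ^ m)" .
  have "(1/2::real) ^ m \<le> 1" by (simp add: power_le_one)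
  then have "(1/2) ^ m * r \<le> r" using r by simp
  then show ?thesis
    by (intro emeasure_le_of_subset[OF _ _ _ le]) auto
qed

lemma wide_avg_const_le:
  assumes "0 < r"
  shows "wide_avg m r (\<lambda>_. c) x \<le> ennreal W * c"
proof -
  have "wide_avg m r (\<lambda>_. c) x \<le> ennreal (2 ^ m / r powr d) * (c * ennreal (W * (r powr d / 2 ^ m)))"
    unfolding wide_avg_def using wide_shell_volume[OF assms, of x m]
    by (subst nn_integral_cmult_indicator) (auto intro!: mult_left_mono)
  also have "\<dots> = c * (ennreal (2 ^ m / r powr d) * ennreal (W * (r powr d / 2 ^ m)))"
    by (simp add: mult_ac)
  also have "ennreal (2 ^ m / r powr d) * ennreal (W * (r powr d / 2 ^ m)) = ennreal W"
    using assms W_pos by (subst ennreal_mult[symmetric]) auto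
  finally show ?thesis by (simp add: mult.commute)
qed

lemma shell_avg_le_wide_avg: "0 < r \<Longrightarrow> shell_avg m r f x \<le> wide_avg m r f x"
  unfolding shell_avg_def wide_avg_def
  by (intro mult_left_mono nn_integral_mono) (auto simp: indicator_def intro: order.strict_trans2)

lemma nn_integral_wide_avg_le:
  assumes [measurable]: "f \<in> borel_measurable M" and r: "0 < r"
  shows "(\<integral>\<^sup>+x. wide_avg m r f x \<partial>M) \<le> ennreal W * (\<integral>\<^sup>+x. f x \<partial>M)"
proof -
  have "(\<integral>\<^sup>+x. wide_avg m r f x \<partial>M)
      = (\<integral>\<^sup>+x. \<integral>\<^sup>+y. ennreal (2 ^ m / r powr d) * (f y * indicator {y. \<bar>dist x y - r\<bar> < 2 * (1/2) ^ m * r} y) \<partial>M \<partial>M)"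
    unfolding wide_avg_def by (subst nn_integral_cmult) simp_all
  also have "\<dots> = (\<integral>\<^sup>+y. \<integral>\<^sup>+x. ennreal (2 ^ m / r powr d) * (f y * indicator {y. \<bar>dist x y - r\<bar> < 2 * (1/2) ^ m * r} y) \<partial>M \<partial>M)"
    by (rule MM.Fubini'[symmetric]) measurable
  also have "\<dots> = (\<integral>\<^sup>+y. f y * wide_avg m r (\<lambda>_. 1) y \<partial>M)"
    unfolding wide_avg_def
    by (subst nn_integral_cmult[symmetric], measurable, subst nn_integral_cmult[symmetric], measurable)
       (auto intro!: nn_integral_cong simp: indicator_def mult_ac dist_commute)
  also have "\<dots> \<le> (\<integral>\<^sup>+y. f y * ennreal W \<partial>M)"
    using wide_avg_const_le[OF r, of m 1] by (intro nn_integral_mono mult_left_mono) auto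
  also have "\<dots> = ennreal W * (\<integral>\<^sup>+x. f x \<partial>M)"
    by (simp add: nn_integral_multc mult.commute)
  finally show ?thesis .
qed

text \<open>
  Up to the doubling constant, \<open>1 / measure M (ball z s)\<close> is an approximate identity of width \<open>s\<close> in \<open>z\<close>. This
  permits replacing a function by its averages at scale \<open>s\<close> and back.
\<close>

lemma inverse_volume_mass:
  assumes s: "0 < s"
  shows "1 \<le> ennreal D * (\<integral>\<^sup>+z. ennreal (1 / measure M (ball z s)) * indicator {z. dist y z < s} z \<partial>M)"
    and "(\<integral>\<^sup>+z. ennreal (1 / measure M (ball z s)) * indicator {z. dist y z < s} z \<partial>M) \<le> ennreal D"
proof -
  let ?v = "measure M (ball y s)"
  have v: "0 < ?v" using s by (rule ball_pos)
  have near: "?v \<le> D * measure M (ball z s)" "measure M (ball z s) \<le> D * ?v" if "dist y z < s" for z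
    using ball_doubling_le[of s y z s 1] ball_doubling_le[of s z y s 1] that s by (auto simp: dist_commute)
  have const: "(\<integral>\<^sup>+z. ennreal c * indicator {z. dist y z < s} z \<partial>M) = ennreal (c * ?v)" if "0 \<le> c" for c
    using that by (simp add: nn_integral_cmult_indicator ball_def[symmetric] emeasure_ball ennreal_mult[symmetric])
  have "1 = ennreal D * ennreal (1 / (D * ?v) * ?v)"
    using D v by (simp add: ennreal_mult[symmetric])
  also have "\<dots> = ennreal D * (\<integral>\<^sup>+z. ennreal (1 / (D * ?v)) * indicator {z. dist y z < s} z \<partial>M)"
    using D v by (subst const) auto
  also have "\<dots> \<le> ennreal D * (\<integral>\<^sup>+z. ennreal (1 / measure M (ball z s)) * indicator {z. dist y z < s} z \<partial>M)"
  proof (intro mult_left_mono nn_integral_mono)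
    fix z
    show "ennreal (1 / (D * ?v)) * indicator {z. dist y z < s} z \<le> ennreal (1 / measure M (ball z s)) * indicator {z. dist y z < s} z"
      using near(2)[of z] ball_pos[OF s, of z] D v
      by (auto simp: indicator_def intro!: ennreal_leI divide_left_mono)
  qed simp
  finally show "1 \<le> ennreal D * (\<integral>\<^sup>+z. ennreal (1 / measure M (ball z s)) * indicator {z. dist y z < s} z \<partial>M)" .
  have "(\<integral>\<^sup>+z. ennreal (1 / measure M (ball z s)) * indicator {z. dist y z < s} z \<partial>M)
     \<le> (\<integral>\<^sup>+z. ennreal (D / ?v) * indicator {z. dist y z < s} z \<partial>M)"
  proof (intro nn_integral_mono)
    fix z
    have "1 / measure M (ball z s) \<le> D / ?v" if "dist y z < s"
      using near(1)[OF that] ball_pos[OF s, of z] v by (simp add: field_simps)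
    then show "ennreal (1 / measure M (ball z s)) * indicator {z. dist y z < s} z \<le> ennreal (D / ?v) * indicator {z. dist y z < s} z"
      by (auto simp: indicator_def intro!: ennreal_leI)
  qed
  also have "\<dots> = ennreal D" using D v by (subst const) auto
  finally show "(\<integral>\<^sup>+z. ennreal (1 / measure M (ball z s)) * indicator {z. dist y z < s} z \<partial>M) \<le> ennreal D" .
qed

text \<open>
  A shell of width \<open>s = 2\<^bsup>-m\<^esup> r\<close> does not distinguish \<open>f\<close> from its average at scale \<open>s\<close>, if it is
  allowed to become twice as wide.
\<close>

lemma shell_avg_le_wide_avg_avg:
  assumes [measurable]: "f \<in> borel_measurable M" and r: "0 < r"
  shows "shell_avg m r f x \<le> ennreal D * wide_avg m r (avg ((1/2) ^ m * r) f) x"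
proof -
  define s where "s = (1/2) ^ m * r"
  have s: "0 < s" using r by (simp add: s_def)
  let ?i = "\<lambda>z. ennreal (1 / measure M (ball z s))"
  let ?near = "\<lambda>y z. indicator {z. dist y z < s} z :: ennreal"
  let ?S = "\<lambda>y. indicator {y. \<bar>dist x y - r\<bar> < s} y :: ennreal"
  let ?S' = "\<lambda>y. indicator {y. \<bar>dist x y - r\<bar> < 2 * s} y :: ennreal"
  have "(\<integral>\<^sup>+y. f y * ?S y \<partial>M) \<le> (\<integral>\<^sup>+y. f y * ?S y * (ennreal D * (\<integral>\<^sup>+z. ?i z * ?near y z \<partial>M)) \<partial>M)"
    using mult_left_mono[OF inverse_volume_mass(1)[OF s]] by (intro nn_integral_mono) (auto)
  also have "\<dots> = (\<integral>\<^sup>+y. \<integral>\<^sup>+z. ennreal D * (f y * ?S y * (?i z * ?near y z)) \<partial>M \<partial>M)"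
    by (subst nn_integral_cmult[symmetric], measurable, subst nn_integral_cmult[symmetric], measurable)
       (simp add: mult_ac)
  also have "\<dots> \<le> (\<integral>\<^sup>+y. \<integral>\<^sup>+z. ennreal D * (?S' z * (?i z * (f y * indicator {y. dist z y < s} y))) \<partial>M \<partial>M)"
  proof (intro nn_integral_mono mult_left_mono)
    fix y z
    have "\<bar>dist x z - r\<bar> < 2 * s" if "\<bar>dist x y - r\<bar> < s" "dist y z < s"
      using that dist_triangle[of x z y] dist_triangle2[of x y z] by (simp add: abs_less_iff)
    then show "f y * ?S y * (?i z * ?near y z) \<le> ?S' z * (?i z * (f y * indicator {y. dist z y < s} y))"
      by (auto simp: indicator_def dist_commute mult_ac)
  qed simp
  also have "\<dots> = (\<integral>\<^sup>+z. \<integral>\<^sup>+y. ennreal D * (?S' z * (?i z * (f y * indicator {y. dist z y < s} y))) \<partial>M \<partial>M)"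
    by (rule MM.Fubini'[symmetric]) measurable
  also have "\<dots> = (\<integral>\<^sup>+z. ennreal D * (avg s f z * ?S' z) \<partial>M)"
  proof (rule nn_integral_cong)
    fix z
    have "(\<integral>\<^sup>+y. ennreal D * (?S' z * (?i z * (f y * indicator {y. dist z y < s} y))) \<partial>M)
      = ennreal D * (?S' z * (?i z * (\<integral>\<^sup>+y. f y * indicator {y. dist z y < s} y \<partial>M)))"
      by (simp add: nn_integral_cmult)
    then show "(\<integral>\<^sup>+y. ennreal D * (?S' z * (?i z * (f y * indicator {y. dist z y < s} y))) \<partial>M) = ennreal D * (avg s f z * ?S' z)"
      by (simp add: avg_def mult_ac)
  qed
  also have "\<dots> = ennreal D * (\<integral>\<^sup>+z. avg s f z * ?S' z \<partial>M)"
    by (rule nn_integral_cmult) measurable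
  finally have "(\<integral>\<^sup>+y. f y * ?S y \<partial>M) \<le> ennreal D * (\<integral>\<^sup>+z. avg s f z * ?S' z \<partial>M)" .
  then have "ennreal (2 ^ m / r powr d) * (\<integral>\<^sup>+y. f y * ?S y \<partial>M) \<le> ennreal (2 ^ m / r powr d) * (ennreal D * (\<integral>\<^sup>+z. avg s f z * ?S' z \<partial>M))"
    by (rule mult_left_mono) simp
  then show ?thesis unfolding shell_avg_def wide_avg_def s_def by (simp add: mult_ac)
qed

definition shell_max :: "nat \<Rightarrow> real \<Rightarrow> int set \<Rightarrow> ('a \<Rightarrow> ennreal) \<Rightarrow> 'a \<Rightarrow> ennreal" where
  "shell_max m t F f x = (SUP j\<in>F. shell_avg m (rad t j) f x)"

lemma borel_measurable_shell_max [measurable (raw)]: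
  assumes [measurable]: "f \<in> borel_measurable M" "g \<in> measurable N M"
  shows "(\<lambda>x. shell_max m t F f (g x)) \<in> borel_measurable N"
  unfolding shell_max_def by measurable

text \<open>
  Averaging at scale \<open>s\<close> moves mass by less than \<open>s\<close>, so what it puts into \<open>B\<close> comes from the
  \<open>s\<close>-neighbourhood of \<open>B\<close>.
\<close>

lemma nn_integral_avg_restrict_le:
  assumes [measurable]: "f \<in> borel_measurable M" "B \<in> sets M" "J \<in> sets M" and s: "0 < s"
    and near: "\<And>y z. z \<in> B \<Longrightarrow> dist y z < s \<Longrightarrow> y \<in> J"
  shows "(\<integral>\<^sup>+z. avg s f z * indicator B z \<partial>M) \<le> ennreal D * (\<integral>\<^sup>+y. f y * indicator J y \<partial>M)"
proof -
  let ?i = "\<lambda>z. ennreal (1 / measure M (ball z s))"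
  have "(\<integral>\<^sup>+z. avg s f z * indicator B z \<partial>M) = (\<integral>\<^sup>+z. \<integral>\<^sup>+y. indicator B z * (?i z * (f y * indicator {y. dist z y < s} y)) \<partial>M \<partial>M)"
  proof (rule nn_integral_cong)
    fix z
    have "(\<integral>\<^sup>+y. indicator B z * (?i z * (f y * indicator {y. dist z y < s} y)) \<partial>M)
      = indicator B z * (?i z * (\<integral>\<^sup>+y. f y * indicator {y. dist z y < s} y \<partial>M))"
      by (simp add: nn_integral_cmult)
    then show "avg s f z * indicator B z = (\<integral>\<^sup>+y. indicator B z * (?i z * (f y * indicator {y. dist z y < s} y)) \<partial>M)"
      by (simp add: avg_def mult_ac)
  qed
  also have "\<dots> = (\<integral>\<^sup>+y. \<integral>\<^sup>+z. indicator B z * (?i z * (f y * indicator {y. dist z y < s} y)) \<partial>M \<partial>M)"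
    by (rule MM.Fubini'[symmetric]) measurable
  also have "\<dots> \<le> (\<integral>\<^sup>+y. \<integral>\<^sup>+z. f y * indicator J y * (?i z * indicator {z. dist y z < s} z) \<partial>M \<partial>M)"
    using near by (intro nn_integral_mono) (auto simp: indicator_def dist_commute mult_ac)
  also have "\<dots> = (\<integral>\<^sup>+y. f y * indicator J y * (\<integral>\<^sup>+z. ?i z * indicator {z. dist y z < s} z \<partial>M) \<partial>M)"
    by (subst nn_integral_cmult) simp_all
  also have "\<dots> \<le> (\<integral>\<^sup>+y. f y * indicator J y * ennreal D \<partial>M)"
    using inverse_volume_mass(2)[OF s] by (intro nn_integral_mono mult_left_mono) auto
  also have "\<dots> = ennreal D * (\<integral>\<^sup>+y. f y * indicator J y \<partial>M)"
    by (subst nn_integral_multc, measurable) (rule mult.commute)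
  finally show ?thesis .
qed

lemma card_window_le:
  fixes J :: "int set"
  assumes fin: "finite J" and win: "\<And>i j. i \<in> J \<Longrightarrow> j \<in> J \<Longrightarrow> i < j \<Longrightarrow> j < i + int m"
    and m0: "J \<noteq> {} \<Longrightarrow> 0 < m"
  shows "card J \<le> m"
proof (cases "J = {}")
  case False
  have "J \<subseteq> {Min J ..< Min J + int m}"
  proof
    fix j assume j: "j \<in> J"
    then have "Min J \<le> j" "Min J \<in> J" using fin False by auto
    then show "j \<in> {Min J ..< Min J + int m}"
      using win[OF _ j, of "Min J"] m0 False by (cases "Min J = j") auto
  qed
  from card_mono[OF _ this] show ?thesis by simp
qed simp

text \<open>
  The heart of the matter: thin shells cost only a factor \<open>m\<close>, not \<open>2\<^sup>m\<close>. At radius \<open>r\<^sub>j = rad t j\<close> the function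
  \<open>f\<close> may be replaced by its averages \<open>h j\<close> at the width \<open>r\<^bsub>j-m\<^esub>\<close> of the shell. Points \<open>y\<close> of the shell
  are of three kinds.
  
  \<^item> \<open>h j y\<close> is of order \<open>l\<close> at most: then so is its contribution to the shell average.
  
  \<^item> Some average at \<open>y\<close> over a scale of at least \<open>r\<^sub>j\<close> exceeds \<open>l\<close>: as \<open>y\<close> is at distance \<open>O(r\<^sub>j)\<close> from
  the centre \<open>x\<close>, the point \<open>x\<close> itself lies in the level set of the ordinary maximal function.
  
  \<^item> The averages at \<open>y\<close> are large at scale \<open>r\<^bsub>j-m\<^esub>\<close> and small from \<open>r\<^sub>j\<close> on: this is the set \<open>B j\<close>. The
  mass of \<open>f\<close> responsible for it sits in \<open>J j\<close>, where the same holds with slightly different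
  constants, and no point belongs to \<open>J j\<close> for more than \<open>m\<close> values of \<open>j\<close>: the transition from large to small
  has to take place between \<open>r\<^bsub>j-m\<^esub>\<close> and \<open>r\<^sub>j\<close>. Hence the sum over \<open>j\<close> of the \<open>L\<^sup>1\<close>
  bounds for the shell averages costs a factor \<open>m\<close> only.
\<close>

lemma shell_max_level_sets:
  assumes [measurable]: "f \<in> borel_measurable M" and t: "0 < t" and F: "finite F" and l: "0 < l"
  shows "emeasure M {x\<in>space M. ennreal (2 * D ^ 5 * W * l) < shell_max m t F f x}
    \<le> emeasure M {x\<in>space M. ennreal l < ennreal (D ^ 3) * HL_max t f x}
      + ennreal (D * real m / l) * (\<integral>\<^sup>+x. f x * indicator {x. ennreal l < HL_max t f x} x \<partial>M)"
proof -
  have r: "0 < rad t j" for j using t by (rule rad_pos)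
  have D0: "0 < D" using D by simp
  define h where "h j = avg (rad t (j - int m)) f" for j
  \<comment> \<open>Each change of centre in an average costs a power of \<open>D\<close>. The exponents are chosen so that a point
    at distance less than \<open>r\<^bsub>j-m\<^esub>\<close> from \<open>B j\<close> lies in \<open>J j\<close>, at the price \<open>D\<^sup>2\<close> at both ends.\<close>
  define B where "B j = {y\<in>space M. ennreal (D ^ 4 * l) < h j y \<and> (\<forall>i. j \<le> i \<longrightarrow> avg (rad t i) f y \<le> ennreal l)}" for j
  define J where "J j = {y\<in>space M. ennreal (D ^ 2 * l) < avg (rad t (j - int m + 1)) f y
      \<and> (\<forall>i. j + 1 \<le> i \<longrightarrow> avg (rad t i) f y \<le> ennreal (D ^ 2 * l))}" for j
  have [measurable]: "h j \<in> borel_measurable M" for j unfolding h_def by measurable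
  have [measurable]: "B j \<in> sets M" for j unfolding B_def by measurable
  have [measurable]: "J j \<in> sets M" for j unfolding J_def by measurable
  define b where "b j x = wide_avg m (rad t j) (\<lambda>y. h j y * indicator (B j) y) x" for j x
  have [measurable]: "b j \<in> borel_measurable M" for j unfolding b_def by measurable
  have sub: "ennreal (W * l) \<le> (\<Sum>j\<in>F. b j x)"
    if big: "ennreal (2 * D ^ 5 * W * l) < shell_max m t F f x" and small: "ennreal (D ^ 3) * HL_max t f x \<le> ennreal l" for x
  proof -
    obtain j where j: "j \<in> F" "ennreal (2 * D ^ 5 * W * l) < shell_avg m (rad t j) f x"
      using big unfolding shell_max_def less_SUP_iff by blast
    have h_le: "h j y \<le> ennreal (D ^ 4 * l) + h j y * indicator (B j) y"
      if y: "\<bar>dist x y - rad t j\<bar> < 2 * (1/2) ^ m * rad t j" for y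
    proof (cases "h j y \<le> ennreal (D ^ 4 * l) \<or> y \<in> B j")
      case False
      then obtain i where i: "j \<le> i" "ennreal l < avg (rad t i) f y" by (auto simp: B_def not_le)
      have "(1/2::real) ^ m \<le> 1" by (simp add: power_le_one)
      then have "(1/2) ^ m * rad t j \<le> 1 * rad t j" by (rule mult_right_mono) (rule less_imp_le[OF r])
      then have "dist x y < 3 * rad t j" using y by linarith
      also have "\<dots> \<le> 3 * rad t i" using rad_mono[OF t i(1)] by simp
      finally have dxy: "dist x y < 3 * rad t i" .
      have "avg (rad t i) f y \<le> ennreal (D ^ 3) * avg (4 * rad t i) f x"
        using r[of i] dxy by (intro avg_le_avg) (auto simp: dist_commute)
      also have "4 * rad t i = rad t (i + 2)" using rad_add[of 2 t i] by simp
      also have "ennreal (D ^ 3) * avg (rad t (i + 2)) f x \<le> ennreal (D ^ 3) * HL_max t f x"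
        by (intro mult_left_mono avg_le_HL_max) simp
      finally show ?thesis using i(2) small by (meson not_le order_trans)
    qed (auto simp: add_increasing add_increasing2)
    have "shell_avg m (rad t j) f x \<le> ennreal D * wide_avg m (rad t j) (h j) x"
      using shell_avg_le_wide_avg_avg[OF assms(1) r, of m j x] unfolding h_def rad_shift .
    also have "wide_avg m (rad t j) (h j) x \<le> wide_avg m (rad t j) (\<lambda>_. ennreal (D ^ 4 * l)) x + b j x"
      unfolding wide_avg_def b_def distrib_left[symmetric]
      by (subst nn_integral_add[symmetric], measurable)
         (auto intro!: mult_left_mono nn_integral_mono h_le simp: indicator_def[of "{y. _ y}"])
    also have "\<dots> \<le> ennreal W * ennreal (D ^ 4 * l) + b j x"
      by (intro add_right_mono wide_avg_const_le r)
    finally have "shell_avg m (rad t j) f x \<le> ennreal D * (ennreal W * ennreal (D ^ 4 * l) + b j x)"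
      by (simp add: mult_left_mono)
    also have "\<dots> = ennreal (D ^ 5 * W * l) + ennreal D * b j x"
      using D0 W_pos l by (simp add: distrib_left ennreal_mult[symmetric] mult_ac power_numeral_reduce)
    finally have upper: "shell_avg m (rad t j) f x \<le> ennreal (D ^ 5 * W * l) + ennreal D * b j x" .
    have "ennreal (D ^ 5 * W * l) + ennreal (D ^ 5 * W * l) < ennreal (D ^ 5 * W * l) + ennreal D * b j x"
    proof -
      have "ennreal (D ^ 5 * W * l) + ennreal (D ^ 5 * W * l) = ennreal (2 * D ^ 5 * W * l)"
        using D0 W_pos l by (subst ennreal_plus[symmetric]) simp_all
      then show ?thesis using order.strict_trans2[OF j(2) upper] by simp
    qed
    then have "ennreal (D ^ 5 * W * l) \<le> ennreal D * b j x"
      by (rule_tac ccontr) (auto simp: not_le dest: add_left_mono[of _ _ "ennreal (D ^ 5 * W * l)"] less_imp_le)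
    then have "ennreal (1 / D) * ennreal (D ^ 5 * W * l) \<le> ennreal (1 / D) * (ennreal D * b j x)"
      by (intro mult_left_mono) auto
    also have "\<dots> = b j x" using D0 by (simp add: mult.assoc[symmetric] ennreal_mult[symmetric])
    also have "ennreal (1 / D) * ennreal (D ^ 5 * W * l) = ennreal (D ^ 4 * (W * l))"
      using D0 W_pos l by (simp add: ennreal_mult[symmetric] power_numeral_reduce)
    finally have "ennreal (D ^ 4 * (W * l)) \<le> b j x" .
    moreover have "W * l \<le> D ^ 4 * (W * l)"
      using D W_pos l mult_right_mono[of 1 "D ^ 4" "W * l"] by (simp add: one_le_power)
    ultimately have "ennreal (W * l) \<le> b j x" by (meson ennreal_leI order_trans)
    also have "\<dots> \<le> (\<Sum>j\<in>F. b j x)" using F j(1) by (intro member_le_sum) auto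
    finally show ?thesis .
  qed
  have int_b: "(\<integral>\<^sup>+x. b j x \<partial>M) \<le> ennreal W * (ennreal D * (\<integral>\<^sup>+y. f y * indicator (J j) y \<partial>M))" for j
  proof -
    have "(\<integral>\<^sup>+x. b j x \<partial>M) \<le> ennreal W * (\<integral>\<^sup>+x. h j x * indicator (B j) x \<partial>M)"
      unfolding b_def by (intro nn_integral_wide_avg_le r) measurable
    also have "\<dots> \<le> ennreal W * (ennreal D * (\<integral>\<^sup>+y. f y * indicator (J j) y \<partial>M))"
      unfolding h_def
    proof (intro mult_left_mono nn_integral_avg_restrict_le r)
      fix y z assume z: "z \<in> B j" and yz: "dist y z < rad t (j - int m)"
      have dd: "ennreal (D ^ 2) * ennreal (D ^ 2 * l) = ennreal (D ^ 4 * l)"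
        using D0 l by (simp add: ennreal_mult[symmetric] power_numeral_reduce)
      have "ennreal (D ^ 4 * l) < avg (rad t (j - int m)) f z"
        using z by (simp add: B_def h_def)
      also have "\<dots> \<le> ennreal (D ^ 2) * avg (rad t (j - int m + 1)) f y"
        unfolding rad_Suc using yz r[of "j - int m"] by (intro avg_le_avg) (auto simp: dist_commute)
      finally have "ennreal (D ^ 2) * ennreal (D ^ 2 * l) < ennreal (D ^ 2) * avg (rad t (j - int m + 1)) f y"
        by (simp add: dd)
      then have 1: "ennreal (D ^ 2 * l) < avg (rad t (j - int m + 1)) f y"
        by (rule_tac ccontr) (auto simp: not_less dest: mult_left_mono[of _ _ "ennreal (D ^ 2)"])
      have 2: "avg (rad t i) f y \<le> ennreal (D ^ 2 * l)" if i: "j + 1 \<le> i" for i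
      proof -
        have "rad t (j - int m) \<le> rad t i" using i by (intro rad_mono t) auto
        then have "avg (rad t i) f y \<le> ennreal (D ^ 2) * avg (rad t (i + 1)) f z"
          unfolding rad_Suc using yz r[of i] by (intro avg_le_avg) auto
        also have "avg (rad t (i + 1)) f z \<le> ennreal l" using z i by (simp add: B_def)
        finally show ?thesis using D0 l by (simp add: ennreal_mult mult_left_mono)
      qed
      show "y \<in> J j" using 1 2 by (simp add: J_def)
    qed simp_all
    finally show ?thesis .
  qed
  have count: "(\<Sum>j\<in>F. indicator (J j) y) \<le> ennreal (real m) * indicator {x. ennreal l < HL_max t f x} y" for y
  proof (cases "\<exists>j\<in>F. y \<in> J j")
    case True
    then obtain j where j: "y \<in> J j" by blast
    have "l \<le> D ^ 2 * l" using D l mult_right_mono[of 1 "D ^ 2" l] by (simp add: one_le_power)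
    then have "ennreal l \<le> ennreal (D ^ 2 * l)" by (rule ennreal_leI)
    also have "\<dots> < avg (rad t (j - int m + 1)) f y" using j by (simp add: J_def)
    also have "\<dots> \<le> HL_max t f y" by (rule avg_le_HL_max)
    finally have large: "ennreal l < HL_max t f y" .
    have excl: "\<not> j + 1 \<le> i - int m + 1" if "y \<in> J i" "y \<in> J j" for i j
      using that by (auto simp: J_def not_le[symmetric])
    have "card {j\<in>F. y \<in> J j} \<le> m"
    proof (rule card_window_le)
      show "j < i + int m" if "i \<in> {j\<in>F. y \<in> J j}" "j \<in> {j\<in>F. y \<in> J j}" for i j
        using excl[of j i] that by simp
      show "0 < m" using excl[OF j j] by simp
    qed (use F in auto)
    then have "ennreal (real (card {j\<in>F. y \<in> J j})) \<le> ennreal (real m)" by (intro ennreal_leI) simp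
    moreover have "(\<Sum>j\<in>F. indicator (J j) y) = (of_nat (card {j\<in>F. y \<in> J j}) :: ennreal)"
      using F by (simp add: indicator_def sum.If_cases Int_def of_bool_def)
    ultimately show ?thesis using large by (simp add: ennreal_of_nat_eq_real_of_nat)
  next
    case False
    then have "(\<Sum>j\<in>F. indicator (J j) y) = (0::ennreal)" by (intro sum.neutral) auto
    then show ?thesis by simp
  qed
  have "emeasure M {x\<in>space M. ennreal (2 * D ^ 5 * W * l) < shell_max m t F f x}
    \<le> emeasure M ({x\<in>space M. ennreal l < ennreal (D ^ 3) * HL_max t f x} \<union> {x\<in>space M. 1 \<le> ennreal (1 / (W * l)) * (\<Sum>j\<in>F. b j x)})"
  proof (rule emeasure_mono)
    have "1 \<le> ennreal (1 / (W * l)) * (\<Sum>j\<in>F. b j x)" if "ennreal (W * l) \<le> (\<Sum>j\<in>F. b j x)" for x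
    proof -
      have "1 = ennreal (1 / (W * l)) * ennreal (W * l)"
        using W_pos l by (simp add: ennreal_mult[symmetric])
      also have "\<dots> \<le> ennreal (1 / (W * l)) * (\<Sum>j\<in>F. b j x)" using that by (intro mult_left_mono) auto
      finally show ?thesis .
    qed
    then show "{x\<in>space M. ennreal (2 * D ^ 5 * W * l) < shell_max m t F f x} \<subseteq> 
      {x\<in>space M. ennreal l < ennreal (D ^ 3) * HL_max t f x} \<union> {x\<in>space M. 1 \<le> ennreal (1 / (W * l)) * (\<Sum>j\<in>F. b j x)}"
      using sub by (auto simp: not_less[symmetric])
  qed measurable
  also have "\<dots> \<le> emeasure M {x\<in>space M. ennreal l < ennreal (D ^ 3) * HL_max t f x} + emeasure M {x\<in>space M. 1 \<le> ennreal (1 / (W * l)) * (\<Sum>j\<in>F. b j x)}"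
    by (rule emeasure_subadditive) measurable
  also have "\<dots> \<le> emeasure M {x\<in>space M. ennreal l < ennreal (D ^ 3) * HL_max t f x}
      + ennreal (D * real m / l) * (\<integral>\<^sup>+x. f x * indicator {x. ennreal l < HL_max t f x} x \<partial>M)"
  proof (rule add_left_mono)
    have "(\<integral>\<^sup>+x. (\<Sum>j\<in>F. b j x) \<partial>M) = (\<Sum>j\<in>F. \<integral>\<^sup>+x. b j x \<partial>M)"
      by (rule nn_integral_sum) simp
    also have "\<dots> \<le> (\<Sum>j\<in>F. ennreal W * (ennreal D * (\<integral>\<^sup>+y. f y * indicator (J j) y \<partial>M)))"
      by (intro sum_mono int_b)
    also have "\<dots> = ennreal W * (ennreal D * (\<integral>\<^sup>+y. f y * (\<Sum>j\<in>F. indicator (J j) y) \<partial>M))"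
      by (simp add: sum_distrib_left nn_integral_sum)
    also have "\<dots> \<le> ennreal W * (ennreal D * (\<integral>\<^sup>+y. f y * (ennreal (real m) * indicator {x. ennreal l < HL_max t f x} y) \<partial>M))"
      by (intro mult_left_mono nn_integral_mono count) auto
    also have "\<dots> = ennreal W * (ennreal D * (ennreal (real m) * (\<integral>\<^sup>+y. f y * indicator {x. ennreal l < HL_max t f x} y \<partial>M)))"
      by (subst nn_integral_cmult[symmetric]) (auto simp: mult_ac)
    finally have sum_b: "(\<integral>\<^sup>+x. (\<Sum>j\<in>F. b j x) \<partial>M) \<le> \<dots>" .
    have "emeasure M {x\<in>space M. 1 \<le> ennreal (1 / (W * l)) * (\<Sum>j\<in>F. b j x)} \<le> ennreal (1 / (W * l)) * (\<integral>\<^sup>+x. (\<Sum>j\<in>F. b j x) \<partial>M)"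
      using nn_integral_Markov_inequality[of "\<lambda>x. \<Sum>j\<in>F. b j x" "space M" M "ennreal (1 / (W * l))"] sets.top[of M] by simp
    also have "\<dots> \<le> ennreal (1 / (W * l)) * (ennreal W * (ennreal D * (ennreal (real m) * (\<integral>\<^sup>+y. f y * indicator {x. ennreal l < HL_max t f x} y \<partial>M))))"
      by (rule mult_left_mono[OF sum_b]) simp
    also have "\<dots> = ennreal (D * real m / l) * (\<integral>\<^sup>+y. f y * indicator {x. ennreal l < HL_max t f x} y \<partial>M)"
      using W_pos D0 l by (simp add: mult.assoc[symmetric] ennreal_mult[symmetric])
    finally show "emeasure M {x\<in>space M. 1 \<le> ennreal (1 / (W * l)) * (\<Sum>j\<in>F. b j x)}
      \<le> ennreal (D * real m / l) * (\<integral>\<^sup>+x. f x * indicator {x. ennreal l < HL_max t f x} x \<partial>M)" .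
  qed
  finally show ?thesis .
qed

text \<open>
  Integration of the level set estimate, scaled by \<open>Q = 2 D\<^sup>5 W\<close>; Young's inequality separates the remaining
  product of \<open>f\<close> and its maximal function. The norm itself grows like \<open>(m + 1)\<^bsup>1/q\<^esup>\<close>.
\<close>

lemma shell_max_strong_type:
  assumes q: "1 < q"
  obtains K where "0 < K" "\<And>m t F (f :: 'a \<Rightarrow> ennreal). f \<in> borel_measurable M \<Longrightarrow> 0 < t \<Longrightarrow> finite F \<Longrightarrow>
    (\<integral>\<^sup>+x. epowr (shell_max m t F f x) q \<partial>M) \<le> ennreal (K * (real m + 1)) * (\<integral>\<^sup>+x. epowr (f x) q \<partial>M)"
proof -
  define Q where "Q = 2 * D ^ 5 * W"
  define H where "H = 2 * D * q / (q - 1) * 2 powr (q - 1)"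
  define c where "c = D * q / (q - 1)"
  define K where "K = Q powr q * ((D ^ 3) powr q * H + c * (1 + H))"
  have D0: "0 < D" using D by simp
  have Q: "0 < Q" using D0 W_pos by (simp add: Q_def)
  have H: "0 < H" using D0 q by (simp add: H_def)
  have c: "0 < c" using D0 q by (simp add: c_def)
  show ?thesis
  proof (rule that[of K])
    show "0 < K" using Q H c D0 by (simp add: K_def add_pos_pos)
    fix m :: nat and t :: real and F :: "int set" and f :: "'a \<Rightarrow> ennreal"
    assume [measurable]: "f \<in> borel_measurable M" and t: "0 < t" and F: "finite F"
    let ?I = "\<integral>\<^sup>+x. epowr (f x) q \<partial>M"
    let ?A = "\<integral>\<^sup>+x. epowr (shell_max m t F f x) q \<partial>M"
    have HL: "(\<integral>\<^sup>+x. epowr (HL_max t f x) q \<partial>M) \<le> ennreal H * ?I"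
      unfolding H_def by (rule HL_max_strong_type) (use t q in auto)
    have scale: "epowr (ennreal (1 / Q) * y) q = ennreal ((1 / Q) powr q) * epowr y q" for y
      using Q q by (intro epowr_mult) auto
    have strong: "(\<integral>\<^sup>+x. epowr (ennreal (1 / Q) * shell_max m t F f x) q \<partial>M)
      \<le> (\<integral>\<^sup>+x. epowr (ennreal (D ^ 3) * HL_max t f x) q \<partial>M)
        + ennreal (D * real m * q / (q - 1)) * (\<integral>\<^sup>+x. f x * epowr (HL_max t f x) (q - 1) \<partial>M)"
    proof (rule strong_type_from_level_sets)
      fix l :: real assume l: "0 < l"
      have "ennreal (Q * l) < shell_max m t F f x" if "ennreal l < ennreal (1 / Q) * shell_max m t F f x" for x
      proof (rule ccontr)
        assume "\<not> ?thesis"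
        then have "ennreal (1 / Q) * shell_max m t F f x \<le> ennreal (1 / Q) * ennreal (Q * l)"
          by (intro mult_left_mono) auto
        also have "\<dots> = ennreal l" using Q l by (simp add: ennreal_mult[symmetric])
        finally show False using that by simp
      qed
      then have "{x\<in>space M. ennreal l < ennreal (1 / Q) * shell_max m t F f x} \<subseteq> {x\<in>space M. ennreal (Q * l) < shell_max m t F f x}"
        by auto
      then have "emeasure M {x\<in>space M. ennreal l < ennreal (1 / Q) * shell_max m t F f x}
        \<le> emeasure M {x\<in>space M. ennreal (Q * l) < shell_max m t F f x}"
        by (rule emeasure_mono) measurable
      also have "\<dots> \<le> emeasure M {x\<in>space M. ennreal l < ennreal (D ^ 3) * HL_max t f x}
        + ennreal (D * real m / l) * (\<integral>\<^sup>+x. f x * indicator {x. ennreal l < HL_max t f x} x \<partial>M)"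
        unfolding Q_def by (rule shell_max_level_sets) (use t F l in auto)
      finally show "emeasure M {x\<in>space M. ennreal l < ennreal (1 / Q) * shell_max m t F f x}
        \<le> emeasure M {x\<in>space M. ennreal l < ennreal (D ^ 3) * HL_max t f x}
        + ennreal (D * real m / l) * (\<integral>\<^sup>+x. f x * indicator {x. ennreal l < HL_max t f x} x \<partial>M)" .
    qed (use q D in auto)
    have "(\<integral>\<^sup>+x. f x * epowr (HL_max t f x) (q - 1) \<partial>M) \<le> (\<integral>\<^sup>+x. epowr (f x) q + epowr (HL_max t f x) q \<partial>M)"
      by (intro nn_integral_mono epowr_Young q)
    also have "\<dots> = ?I + (\<integral>\<^sup>+x. epowr (HL_max t f x) q \<partial>M)"
      by (rule nn_integral_add) measurable
    also have "\<dots> \<le> ?I + ennreal H * ?I" using HL by (rule add_left_mono)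
    finally have Young: "(\<integral>\<^sup>+x. f x * epowr (HL_max t f x) (q - 1) \<partial>M) \<le> ?I + ennreal H * ?I" .
    have "(\<integral>\<^sup>+x. epowr (ennreal (D ^ 3) * HL_max t f x) q \<partial>M) = ennreal ((D ^ 3) powr q) * (\<integral>\<^sup>+x. epowr (HL_max t f x) q \<partial>M)"
      using D0 q by (subst epowr_mult) (auto simp: nn_integral_cmult)
    also have "\<dots> \<le> ennreal ((D ^ 3) powr q) * (ennreal H * ?I)" by (intro mult_left_mono HL) simp
    finally have first: "(\<integral>\<^sup>+x. epowr (ennreal (D ^ 3) * HL_max t f x) q \<partial>M) \<le> ennreal ((D ^ 3) powr q) * (ennreal H * ?I)" .
    have "D * real m * q / (q - 1) \<le> c * (real m + 1)"
      using D0 q by (simp add: c_def divide_right_mono)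
    then have coeff: "ennreal (D * real m * q / (q - 1)) \<le> ennreal (c * (real m + 1))" by (rule ennreal_leI)
    have "ennreal ((1 / Q) powr q) * ?A = (\<integral>\<^sup>+x. epowr (ennreal (1 / Q) * shell_max m t F f x) q \<partial>M)"
      unfolding scale by (simp add: nn_integral_cmult)
    also note strong
    also have "(\<integral>\<^sup>+x. epowr (ennreal (D ^ 3) * HL_max t f x) q \<partial>M)
        + ennreal (D * real m * q / (q - 1)) * (\<integral>\<^sup>+x. f x * epowr (HL_max t f x) (q - 1) \<partial>M)
      \<le> ennreal ((D ^ 3) powr q) * (ennreal H * ?I) + ennreal (c * (real m + 1)) * (?I + ennreal H * ?I)"
      by (intro add_mono mult_mono first coeff Young) auto
    also have "\<dots> = ennreal ((D ^ 3) powr q * H + c * (real m + 1) * (1 + H)) * ?I"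
    proof -
      have e1: "?I + ennreal H * ?I = ennreal (1 + H) * ?I" using H by (simp add: distrib_right)
      have e2: "0 \<le> c * (real m + 1) * (1 + H)" "0 \<le> (D ^ 3) powr q * H" using c H by simp_all
      show ?thesis unfolding e1 ennreal_plus[OF e2(2) e2(1)] distrib_right
        using c H by (simp add: mult.assoc[symmetric] ennreal_mult[symmetric] del: ennreal_plus)
    qed
    also have "\<dots> \<le> ennreal (((D ^ 3) powr q * H + c * (1 + H)) * (real m + 1)) * ?I"
      using H c D0 by (intro mult_right_mono ennreal_leI) (auto simp: algebra_simps)
    finally have "ennreal ((1 / Q) powr q) * ?A \<le> ennreal (((D ^ 3) powr q * H + c * (1 + H)) * (real m + 1)) * ?I" .
    then have "ennreal (Q powr q) * (ennreal ((1 / Q) powr q) * ?A) \<le> ennreal (Q powr q) * (ennreal (((D ^ 3) powr q * H + c * (1 + H)) * (real m + 1)) * ?I)"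
      by (intro mult_left_mono) auto
    also have "ennreal (Q powr q) * (ennreal ((1 / Q) powr q) * ?A) = ?A"
      using Q by (simp add: mult.assoc[symmetric] ennreal_mult[symmetric] powr_divide)
    also have "ennreal (Q powr q) * (ennreal (((D ^ 3) powr q * H + c * (1 + H)) * (real m + 1)) * ?I) = ennreal (K * (real m + 1)) * ?I"
      using Q H c by (simp add: mult.assoc[symmetric] ennreal_mult[symmetric] K_def)
    finally show "?A \<le> ennreal (K * (real m + 1)) * ?I" .
  qed
qed

end

section \<open>Poisson-type kernels in the complex half-plane\<close>

text \<open>
  For \<open>\<delta> = cos \<theta>\<close> this is \<open>\<bar>1 + s\<^sup>2 e\<^bsup>-2i\<theta>\<^esup>\<bar>\<^bsup>-(d+1)/2\<^esup>\<close>, the spatial factor of the kernel bound at the point \<open>z = r e\<^bsup>i\<theta>\<^esup>\<close>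
  and the distance \<open>s r\<close>. The denominator nearly vanishes at \<open>s = 1\<close> when \<open>\<delta>\<close> is small.
\<close>

definition profile :: "real \<Rightarrow> real \<Rightarrow> real \<Rightarrow> real" where
  "profile d \<delta> s = ((1 - s\<^sup>2)\<^sup>2 + 4 * s\<^sup>2 * \<delta>\<^sup>2) powr (- (d + 1) / 4)"

lemma powr_neg_quarter_le:
  fixes b :: real
  assumes d: "0 < d" and a: "0 < a" and b: "a ^ 4 \<le> b"
  shows "b powr (- (d + 1) / 4) \<le> a powr (- (d + 1))"
proof -
  have a4: "0 < a ^ 4" using a by simp
  have "b powr (- (d + 1) / 4) \<le> (a ^ 4) powr (- (d + 1) / 4)"
    using d b a4 by (intro powr_mono2') auto
  also have "\<dots> = a powr (- (d + 1))"
  proof -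
    have "a ^ 4 = a powr 4" using a by (simp add: powr_numeral)
    then have "(a ^ 4) powr (- (d + 1) / 4) = a powr (4 * (- (d + 1) / 4))" by (simp only: powr_powr)
    moreover have "4 * (- (d + 1) / 4) = - (d + 1)" by (simp add: field_simps)
    ultimately show ?thesis by (simp only:)
  qed
  finally show ?thesis .
qed

text \<open>
  Near \<open>s = 1\<close> the base is at least \<open>max (\<bar>s - 1\<bar>, \<delta>)\<^sup>2\<close> up to a constant: the largest \<open>k \<le> m\<close> with \<open>\<bar>s - 1\<bar> < 2\<^bsup>-k\<^esup>\<close>
  measures this maximum. Away from \<open>s = 1\<close> the base is at least \<open>max (1, s)\<^sup>4\<close> up to a constant, and the least \<open>i\<close>
  with \<open>s < 2\<^sup>i\<close> measures the decay.
\<close>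

lemma profile_cases:
  assumes d: "0 < d" and \<delta>: "0 < \<delta>" and m: "1 \<le> m" "(1/2) ^ m \<le> \<delta>" and s: "0 \<le> s"
  shows "(\<exists>k\<in>{1..m}. \<bar>s - 1\<bar> < (1/2) ^ k \<and> profile d \<delta> s \<le> 2 powr (2 * (d + 1)) * 2 powr (real k * ((d + 1) / 2)))
    \<or> (\<exists>i. s < 2 ^ i \<and> profile d \<delta> s \<le> 2 powr (2 * (d + 1)) * 2 powr (- (real i * (d + 1))))"
proof -
  let ?b = "(1 - s\<^sup>2)\<^sup>2 + 4 * s\<^sup>2 * \<delta>\<^sup>2"
  have b1: "(1 - s\<^sup>2)\<^sup>2 \<le> ?b" and b2: "4 * s\<^sup>2 * \<delta>\<^sup>2 \<le> ?b" by simp_all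
  consider "s \<le> 1/2" | "3/2 \<le> s" | "\<bar>s - 1\<bar> < 1/2" by linarith
  then show ?thesis
  proof cases
    case 1
    then have "s\<^sup>2 \<le> (1/2)\<^sup>2" using s by (intro power_mono) auto
    then have "1/2 \<le> 1 - s\<^sup>2" by (simp add: power2_eq_square)
    then have "(1/2)\<^sup>2 \<le> (1 - s\<^sup>2)\<^sup>2" by (intro power_mono) auto
    moreover have "(1/2::real) ^ 4 \<le> (1/2)\<^sup>2" by (simp add: power2_eq_square power4_eq_xxxx)
    ultimately have "(1/2::real) ^ 4 \<le> ?b" using b1 by linarith
    from powr_neg_quarter_le[OF d _ this]
    have "profile d \<delta> s \<le> (1/2) powr (- (d + 1))" by (simp add: profile_def)
    also have "\<dots> = 2 powr (d + 1)"
    proof -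
      have "(1/2::real) = 2 powr (- 1)" by (simp add: powr_minus_divide)
      then have "(1/2::real) powr (- (d + 1)) = 2 powr (- 1 * - (d + 1))" by (simp only: powr_powr)
      then show ?thesis by (simp add: add.commute)
    qed
    also have "\<dots> \<le> 2 powr (2 * (d + 1)) * 2 powr (- (real 0 * (d + 1)))" using d by simp
    finally show ?thesis using 1 s by (intro disjI2 exI[of _ 0]) auto
  next
    case 2
    obtain n where n: "s < 2 ^ n" using real_arch_pow[of 2 s] by auto
    define i where "i = (LEAST i. s < 2 ^ i)"
    have i: "s < 2 ^ i" unfolding i_def by (rule LeastI[of _ n]) (rule n)
    then have "i \<noteq> 0" using 2 by (intro notI) simp
    then obtain i' where i': "i = Suc i'" by (cases i) auto
    have low: "2 ^ i' \<le> s"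
      using not_less_Least[of i' "\<lambda>i. s < 2 ^ i"] i' unfolding i_def[symmetric] by simp
    have "(3/2)\<^sup>2 \<le> s\<^sup>2" using 2 by (intro power_mono) auto
    then have "s\<^sup>2 / 2 \<le> s\<^sup>2 - 1" by (simp add: power2_eq_square)
    then have "(s\<^sup>2 / 2)\<^sup>2 \<le> (s\<^sup>2 - 1)\<^sup>2" by (intro power_mono) auto
    also have "(s\<^sup>2 - 1)\<^sup>2 = (1 - s\<^sup>2)\<^sup>2" by (rule power2_commute)
    also have "\<dots> \<le> ?b" by (rule b1)
    finally have "s ^ 4 / 4 \<le> ?b" by (simp add: power_divide flip: power_mult)
    moreover have "(s / 2) ^ 4 \<le> s ^ 4 / 4" using s by (simp add: power_divide)
    ultimately have "(s / 2) ^ 4 \<le> ?b" by linarith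
    from powr_neg_quarter_le[OF d _ this]
    have "profile d \<delta> s \<le> (s / 2) powr (- (d + 1))" using 2 by (simp add: profile_def)
    also have "\<dots> \<le> (2 ^ i' / 2) powr (- (d + 1))" using low d by (intro powr_mono2') auto
    also have "\<dots> = 2 powr (2 * (d + 1)) * 2 powr (- (real i * (d + 1)))"
    proof -
      have "(2::real) ^ i' / 2 = 2 powr (real i - 2)"
        by (simp add: i' powr_diff powr_realpow[symmetric] powr_add)
      then show ?thesis by (simp add: powr_powr powr_add[symmetric] algebra_simps)
    qed
    finally show ?thesis using i by blast
  next
    case 3
    have s1: "1/2 < s" using 3 by linarith
    let ?P = "\<lambda>k. k \<in> {1..m} \<and> \<bar>s - 1\<bar> < (1/2::real) ^ k"
    have "?P 1" using 3 m by simp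
    moreover have fin: "finite {k. ?P k}" by (rule finite_subset[of _ "{1..m}"]) auto
    ultimately have "Max {k. ?P k} \<in> {k. ?P k}" by (intro Max_in) blast+
    then obtain k where k: "?P k" and kmax: "\<And>j. ?P j \<Longrightarrow> j \<le> k"
      using Max_ge[OF fin] by blast
    have "(1/2) ^ (2 * (k + 1)) \<le> ?b"
    proof (cases "k = m")
      case True
      have "((1/2::real) ^ (k + 1))\<^sup>2 \<le> ((1/2) ^ m)\<^sup>2" using True by (intro power_mono power_decreasing) auto
      also have "\<dots> \<le> \<delta>\<^sup>2" using m by (intro power_mono) auto
      also have "\<dots> \<le> 4 * s\<^sup>2 * \<delta>\<^sup>2"
      proof -
        have "(1/2)\<^sup>2 \<le> s\<^sup>2" using s1 by (intro power_mono) auto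
        then have "1 \<le> 4 * s\<^sup>2" by (simp add: power2_eq_square)
        then show ?thesis using mult_right_mono[of 1 "4 * s\<^sup>2" "\<delta>\<^sup>2"] by simp
      qed
      also have "\<dots> \<le> ?b" by (rule b2)
      finally show ?thesis by (simp only: power_mult[symmetric] mult.commute)
    next
      case False
      then have "\<not> ?P (Suc k)" using kmax[of "Suc k"] by auto
      then have "(1/2) ^ (k + 1) \<le> \<bar>s - 1\<bar>" using k False by auto
      then have "((1/2) ^ (k + 1))\<^sup>2 \<le> \<bar>s - 1\<bar>\<^sup>2" by (intro power_mono) auto
      also have "\<dots> \<le> \<bar>s - 1\<bar>\<^sup>2 * (s + 1)\<^sup>2"
        using s mult_left_mono[of 1 "(s + 1)\<^sup>2" "\<bar>s - 1\<bar>\<^sup>2"] by (simp add: one_le_power)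
      also have "\<dots> = (1 - s\<^sup>2)\<^sup>2" by (simp add: power2_eq_square algebra_simps)
      also have "\<dots> \<le> ?b" by (rule b1)
      finally show ?thesis by (simp only: power_mult[symmetric] mult.commute)
    qed
    moreover have "(2 powr (- (real (k + 1) / 2))) ^ 4 = (1/2::real) ^ (2 * (k + 1))"
    proof -
      have "(2 powr (- (real (k + 1) / 2))) ^ 4 = ((2::real) powr (- (real (k + 1) / 2))) powr real 4"
        by (rule powr_realpow[symmetric]) simp
      also have "\<dots> = 2 powr (- (real (k + 1) / 2) * real 4)" by (rule powr_powr)
      also have "- (real (k + 1) / 2) * real 4 = - real (2 * (k + 1))" by (simp add: field_simps)
      also have "(2::real) powr (- real (2 * (k + 1))) = (1/2) ^ (2 * (k + 1))"
        by (simp only: powr_minus powr_realpow[OF zero_less_numeral] power_one_over inverse_eq_divide)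
      finally show ?thesis .
    qed
    ultimately have "(2 powr (- (real (k + 1) / 2))) ^ 4 \<le> ?b" by simp
    from powr_neg_quarter_le[OF d _ this]
    have "profile d \<delta> s \<le> (2 powr (- (real (k + 1) / 2))) powr (- (d + 1))" by (simp add: profile_def)
    also have "\<dots> = 2 powr ((d + 1) / 2) * 2 powr (real k * ((d + 1) / 2))"
    proof -
      have "- (real (k + 1) / 2) * (- (d + 1)) = (d + 1) / 2 + real k * ((d + 1) / 2)" by (simp add: field_simps)
      then show ?thesis by (simp only: powr_powr powr_add)
    qed
    also have "\<dots> \<le> 2 powr (2 * (d + 1)) * 2 powr (real k * ((d + 1) / 2))"
      using d by (intro mult_right_mono powr_mono) auto
    finally show ?thesis using k by blast
  qed
qed

lemma ennreal_le_suminf: "f i \<le> (\<Sum>i. f i)" for f :: "nat \<Rightarrow> ennreal"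
proof -
  have "sum f {i} \<le> (\<Sum>i. f i)" by (rule sum_le_suminf) auto
  then show ?thesis by simp
qed

lemma distribute_over_series:
  fixes a S :: "'b \<Rightarrow> ennreal" and b B :: "nat \<Rightarrow> ennreal"
  shows "(c * ((\<Sum>k\<in>A. a k * S k) + (\<Sum>i. b i * B i))) * (u * v)
    = c * ((\<Sum>k\<in>A. a k * (u * (v * S k))) + (\<Sum>i. b i * (u * (v * B i))))"
proof -
  have "(\<Sum>k\<in>A. a k * S k) * (u * v) = (\<Sum>k\<in>A. a k * (u * (v * S k)))"
    unfolding sum_distrib_right by (intro sum.cong) (simp_all add: mult_ac)
  moreover have "(\<Sum>i. b i * B i) * (u * v) = (\<Sum>i. b i * (u * (v * B i)))"
    unfolding ennreal_suminf_multc[symmetric] by (intro suminf_cong) (simp add: mult_ac)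
  ultimately show ?thesis by (simp only: mult.assoc distrib_right)
qed

lemma profile_le_sum:
  assumes d: "0 < d" and \<delta>: "0 < \<delta>" and m: "1 \<le> m" "(1/2) ^ m \<le> \<delta>" and s: "0 \<le> s"
  shows "ennreal (profile d \<delta> s) \<le> ennreal (2 powr (2 * (d + 1))) *
    ((\<Sum>k\<in>{1..m}. ennreal (2 powr (real k * ((d + 1) / 2))) * indicator {s. \<bar>s - 1\<bar> < (1/2) ^ k} s)
     + (\<Sum>i. ennreal (2 powr (- (real i * (d + 1)))) * indicator {..<2 ^ i} s))"
    (is "_ \<le> ?c * ((\<Sum>k\<in>_. ?f k) + (\<Sum>i. ?g i))")
  using profile_cases[OF assms]
proof
  assume "\<exists>k\<in>{1..m}. \<bar>s - 1\<bar> < (1/2) ^ k \<and> profile d \<delta> s \<le> 2 powr (2 * (d + 1)) * 2 powr (real k * ((d + 1) / 2))"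
  then obtain k where k: "k \<in> {1..m}" "\<bar>s - 1\<bar> < (1/2) ^ k"
    "profile d \<delta> s \<le> 2 powr (2 * (d + 1)) * 2 powr (real k * ((d + 1) / 2))" by blast
  have "ennreal (profile d \<delta> s) \<le> ?c * ?f k"
    using ennreal_leI[OF k(3)] k(2) by (simp add: ennreal_mult)
  also have "?f k \<le> (\<Sum>k\<in>{1..m}. ?f k)" using k(1) by (intro member_le_sum) auto
  finally show ?thesis by (auto simp: mult_left_mono add_increasing2 intro: order_trans)
next
  assume "\<exists>i. s < 2 ^ i \<and> profile d \<delta> s \<le> 2 powr (2 * (d + 1)) * 2 powr (- (real i * (d + 1)))"
  then obtain i where i: "s < 2 ^ i"
    "profile d \<delta> s \<le> 2 powr (2 * (d + 1)) * 2 powr (- (real i * (d + 1)))" by blast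
  have "ennreal (profile d \<delta> s) \<le> ?c * ?g i"
    using ennreal_leI[OF i(2)] i(1) by (simp add: ennreal_mult)
  also have "?g i \<le> (\<Sum>i. ?g i)"
    by (rule ennreal_le_suminf)
  finally show ?thesis by (auto simp: mult_left_mono add_increasing intro: order_trans)
qed

lemma epowr_sum_le:
  assumes A: "finite A" and q: "0 < q"
  shows "epowr (\<Sum>a\<in>A. h a) q \<le> ennreal (real (card A) powr q) * (\<Sum>a\<in>A. epowr (h a) q)"
proof (cases "A = {}")
  case False
  then have "Max (h ` A) \<in> h ` A" using A by (intro Max_in) auto
  then obtain a where a: "a \<in> A" "Max (h ` A) = h a" by auto
  then have "h b \<le> h a" if "b \<in> A" for b using A that by (metis Max_ge finite_imageI imageI)
  then have "(\<Sum>a\<in>A. h a) \<le> ennreal (real (card A)) * h a"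
    using sum_bounded_above[of A h "h a"] by (simp add: ennreal_of_nat_eq_real_of_nat)
  then have "epowr (\<Sum>a\<in>A. h a) q \<le> epowr (ennreal (real (card A)) * h a) q"
    using q by (intro epowr_mono) auto
  also have "\<dots> = ennreal (real (card A) powr q) * epowr (h a) q"
    using q by (intro epowr_mult) auto
  also have "epowr (h a) q \<le> (\<Sum>a\<in>A. epowr (h a) q)"
    using A a(1) by (intro member_le_sum) auto
  finally show ?thesis by (simp add: mult_left_mono)
qed simp

text \<open>
  The exponent \<open>m\<close> with \<open>2\<^bsup>-m\<^esup>\<close> comparable to \<open>\<delta>\<close>; it is of logarithmic size in \<open>\<delta>\<close>.
\<close>

lemma dyadic_scale:
  fixes \<delta> :: real
  assumes "0 < \<delta>" "\<delta> \<le> 1"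
  obtains m where "1 \<le> m" "(1/2) ^ m \<le> \<delta>" "2 ^ m \<le> 4 / \<delta>" "real m + 1 \<le> 3 * (1 + \<bar>ln \<delta>\<bar>)"
proof -
  obtain n where n: "(1/2) ^ n < \<delta>" using real_arch_pow_inv[of \<delta> "1/2"] assms by auto
  define k where "k = (LEAST k. (1/2) ^ k \<le> \<delta>)"
  have k: "(1/2) ^ k \<le> \<delta>" unfolding k_def by (rule LeastI[of _ n]) (use n in simp)
  have pk: "2 ^ k \<le> 2 / \<delta>"
  proof (cases k)
    case 0
    then show ?thesis using k assms by simp
  next
    case (Suc k')
    have "\<not> (1/2) ^ k' \<le> \<delta>"
      using not_less_Least[of k' "\<lambda>k. (1/2) ^ k \<le> \<delta>"] Suc unfolding k_def[symmetric] by simp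
    then have "\<delta> * 2 ^ k' \<le> 1" by (simp add: power_one_over field_simps)
    then show ?thesis using assms Suc by (simp add: field_simps)
  qed
  have m: "2 ^ Suc k \<le> 4 / \<delta>" using pk by simp
  have "real (Suc k) * ln 2 = ln (2 ^ Suc k)" by (subst ln_realpow) auto
  also have "\<dots> \<le> ln (4 / \<delta>)" using m assms by (subst ln_le_cancel_iff) auto
  also have "\<dots> = 2 * ln 2 - ln \<delta>" using assms ln_realpow[of 2 2] by (simp add: ln_div)
  finally have "real (Suc k) * ln 2 \<le> 2 * ln 2 + \<bar>ln \<delta>\<bar>" by linarith
  moreover have "\<bar>ln \<delta>\<bar> \<le> \<bar>ln \<delta>\<bar> * (3 * ln 2)"
    using ln2_ge_two_thirds mult_left_mono[of 1 "3 * ln 2" "\<bar>ln \<delta>\<bar>"] by simp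
  ultimately have "real (Suc k) * ln 2 \<le> (2 + 3 * \<bar>ln \<delta>\<bar>) * ln 2" by (simp add: algebra_simps)
  then have "real (Suc k) \<le> 2 + 3 * \<bar>ln \<delta>\<bar>" by (simp add: mult_le_cancel_right)
  then have "real (Suc k) + 1 \<le> 3 * (1 + \<bar>ln \<delta>\<bar>)" by simp
  moreover have "(1/2) ^ Suc k \<le> (1/2::real) ^ k" by simp
  then have "(1/2) ^ Suc k \<le> \<delta>" using k by (rule order_trans)
  ultimately show ?thesis using m by (intro that[of "Suc k"]) auto
qed

context thin_annulus_space
begin

text \<open>
  Compared with the given kernel bound, the volume of the ball is replaced by \<open>r\<^sup>d\<close>. This makes the kernel symmetric,
  so that the operator \<open>kop\<close> is its own adjoint.
\<close>

definition ker :: "real \<Rightarrow> real \<Rightarrow> 'a \<Rightarrow> 'a \<Rightarrow> real" where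
  "ker \<delta> r x y = profile d \<delta> (dist x y / r) / r powr d"

definition kop :: "real \<Rightarrow> real \<Rightarrow> ('a \<Rightarrow> ennreal) \<Rightarrow> 'a \<Rightarrow> ennreal" where
  "kop \<delta> r g x = (\<integral>\<^sup>+y. ennreal (ker \<delta> r x y) * g y \<partial>M)"

lemma ker_nonneg: "0 \<le> ker \<delta> r x y"
  by (simp add: ker_def profile_def)

lemma ker_commute: "ker \<delta> r x y = ker \<delta> r y x"
  by (simp add: ker_def dist_commute)

lemma borel_measurable_ker [measurable (raw)]:
  assumes [measurable]: "f \<in> measurable N M" "g \<in> measurable N M"
  shows "(\<lambda>x. ker \<delta> r (f x) (g x)) \<in> borel_measurable N"
  unfolding ker_def profile_def by measurable

lemma borel_measurable_kop [measurable (raw)]: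
  assumes [measurable]: "g \<in> borel_measurable M" "f \<in> measurable N M"
  shows "(\<lambda>x. kop \<delta> r g (f x)) \<in> borel_measurable N"
  unfolding kop_def by measurable

lemma nn_integral_ball_le:
  assumes "0 < t"
  shows "(\<integral>\<^sup>+y. g y * indicator {y. dist x y < rad t i} y \<partial>M) \<le> ennreal (V * rad t i powr d) * HL_max t g x"
proof -
  have r: "0 < rad t i" using assms by (rule rad_pos)
  have v: "0 < measure M (ball x (rad t i))" using r by (rule ball_pos)
  have "(\<integral>\<^sup>+y. g y * indicator {y. dist x y < rad t i} y \<partial>M) = ennreal (measure M (ball x (rad t i))) * avg (rad t i) g x"
    using v by (simp add: avg_def mult.assoc[symmetric] ennreal_mult[symmetric])
  also have "\<dots> \<le> ennreal (V * rad t i powr d) * HL_max t g x"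
    using ball_le[OF r, of x] by (intro mult_mono ennreal_leI avg_le_HL_max) auto
  finally show ?thesis .
qed

text \<open>
  The decomposition of the profile, integrated. A shell of relative width \<open>2\<^bsup>-k\<^esup>\<close> has weight \<open>2\<^bsup>k(d+1)/2\<^esup>\<close> and relative
  volume \<open>2\<^bsup>-k\<^esup>\<close>, which leaves \<open>2\<^bsup>k(d-1)/2\<^esup>\<close>. The balls of the tail have weights \<open>2\<^bsup>-i(d+1)\<^esup>\<close> and relative volumes \<open>2\<^bsup>id\<^esup>\<close>, so
  their contributions to the maximal function form a geometric series.
\<close>

lemma kop_le:
  assumes [measurable]: "g \<in> borel_measurable M" and t: "0 < t" and \<delta>: "0 < \<delta>"
    and m: "1 \<le> m" "(1/2) ^ m \<le> \<delta>"
  shows "kop \<delta> (rad t j) g x \<le> ennreal (2 powr (2 * (d + 1))) *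
    ((\<Sum>k\<in>{1..m}. ennreal (2 powr (real k * ((d - 1) / 2))) * shell_avg k (rad t j) g x)
     + ennreal (2 * V) * HL_max t g x)"
proof -
  define r where "r = rad t j"
  have r: "0 < r" using t unfolding r_def by (rule rad_pos)
  have d0: "0 < d" using d by simp
  let ?c = "ennreal (2 powr (2 * (d + 1)))"
  let ?i = "ennreal (1 / r powr d)"
  let ?a = "\<lambda>k::nat. ennreal (2 powr (real k * ((d + 1) / 2)))"
  let ?b = "\<lambda>i::nat. ennreal (2 powr (- (real i * (d + 1))))"
  let ?S = "\<lambda>k y. indicator {y. \<bar>dist x y - r\<bar> < (1/2) ^ k * r} y :: ennreal"
  let ?B = "\<lambda>i y. indicator {y. dist x y < 2 ^ i * r} y :: ennreal"
  have "kop \<delta> r g x \<le> (\<integral>\<^sup>+y. ?c * ((\<Sum>k\<in>{1..m}. ?a k * (?i * (g y * ?S k y))) + (\<Sum>i. ?b i * (?i * (g y * ?B i y)))) \<partial>M)"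
    unfolding kop_def
  proof (rule nn_integral_mono)
    fix y
    let ?s = "dist x y / r"
    have s: "0 \<le> ?s" using r by simp
    have S: "indicator {s. \<bar>s - 1\<bar> < (1/2) ^ k} ?s = ?S k y" for k
    proof -
      have "?s - 1 = (dist x y - r) / r" using r by (simp add: diff_divide_distrib)
      then have "\<bar>?s - 1\<bar> = \<bar>dist x y - r\<bar> / r" using r by (simp only: abs_divide abs_of_pos)
      then show ?thesis using r by (simp add: indicator_def pos_divide_less_eq)
    qed
    have B: "indicator {..<2 ^ i} ?s = ?B i y" for i
      using r by (simp add: indicator_def pos_divide_less_eq)
    have "ennreal (ker \<delta> r x y) * g y = ennreal (profile d \<delta> ?s) * (?i * g y)"
      using r by (simp add: ker_def ennreal_mult[symmetric] mult.assoc[symmetric] profile_def)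
    also have "\<dots> \<le> (?c * ((\<Sum>k\<in>{1..m}. ?a k * ?S k y) + (\<Sum>i. ?b i * ?B i y))) * (?i * g y)"
      using profile_le_sum[OF d0 \<delta> m s] unfolding S B by (intro mult_right_mono) auto
    also have "\<dots> = ?c * ((\<Sum>k\<in>{1..m}. ?a k * (?i * (g y * ?S k y))) + (\<Sum>i. ?b i * (?i * (g y * ?B i y))))"
      by (rule distribute_over_series)
    finally show "ennreal (ker \<delta> r x y) * g y \<le> \<dots>" .
  qed
  also have "\<dots> = ?c * ((\<Sum>k\<in>{1..m}. ?a k * (?i * (\<integral>\<^sup>+y. g y * ?S k y \<partial>M))) + (\<Sum>i. ?b i * (?i * (\<integral>\<^sup>+y. g y * ?B i y \<partial>M))))"
    by (simp add: nn_integral_cmult nn_integral_add nn_integral_sum nn_integral_suminf)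
  also have "\<dots> \<le> ?c * ((\<Sum>k\<in>{1..m}. ennreal (2 powr (real k * ((d - 1) / 2))) * shell_avg k r g x)
     + ennreal (2 * V) * HL_max t g x)"
  proof (intro mult_left_mono add_mono sum_mono)
    fix k
    have "2 powr (real k * ((d + 1) / 2)) * (1 / r powr d) = 2 powr (real k * ((d - 1) / 2)) * (2 ^ k / r powr d)"
      by (simp add: powr_realpow[symmetric] powr_add[symmetric] field_simps)
    then have "?a k * ?i = ennreal (2 powr (real k * ((d - 1) / 2))) * ennreal (2 ^ k / r powr d)"
      using r by (simp add: ennreal_mult[symmetric])
    then show "?a k * (?i * (\<integral>\<^sup>+y. g y * ?S k y \<partial>M)) \<le> ennreal (2 powr (real k * ((d - 1) / 2))) * shell_avg k r g x"
      unfolding shell_avg_def mult.assoc[symmetric] by simp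
  next
    have tail: "?b i * (?i * (\<integral>\<^sup>+y. g y * ?B i y \<partial>M)) \<le> ennreal ((1/2) ^ i * V) * HL_max t g x" for i
    proof -
      have "(\<integral>\<^sup>+y. g y * ?B i y \<partial>M) \<le> ennreal (V * (2 ^ i * r) powr d) * HL_max t g x"
        using nn_integral_ball_le[OF t, of g x "j + int i"] unfolding r_def rad_add .
      then have "?b i * (?i * (\<integral>\<^sup>+y. g y * ?B i y \<partial>M)) \<le> ?b i * (?i * (ennreal (V * (2 ^ i * r) powr d) * HL_max t g x))"
        by (intro mult_left_mono) auto
      also have "\<dots> = ennreal (2 powr (- (real i * (d + 1))) * (1 / r powr d * (V * (2 ^ i * r) powr d))) * HL_max t g x"
        using r V by (simp add: mult.assoc[symmetric] ennreal_mult[symmetric])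
      also have "2 powr (- (real i * (d + 1))) * (1 / r powr d * (V * (2 ^ i * r) powr d)) = (1/2) ^ i * V"
      proof -
        have "(2 ^ i * r) powr d = 2 powr (real i * d) * r powr d"
          using r by (simp add: powr_mult powr_realpow[symmetric] powr_powr)
        moreover have "2 powr (- (real i * (d + 1))) * 2 powr (real i * d) = (1/2::real) ^ i"
        proof -
          have "2 powr (- (real i * (d + 1))) * 2 powr (real i * d) = (2::real) powr (- real i)"
            by (simp add: powr_add[symmetric] algebra_simps)
          also have "\<dots> = (1/2) ^ i" by (simp add: powr_minus powr_realpow power_one_over inverse_eq_divide)
          finally show ?thesis .
        qed
        ultimately show ?thesis using r by simp
      qed
      finally show ?thesis .
    qed
    have "(\<Sum>i. ?b i * (?i * (\<integral>\<^sup>+y. g y * ?B i y \<partial>M))) \<le> (\<Sum>i. ennreal ((1/2) ^ i * V) * HL_max t g x)"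
      using tail by (intro suminf_le) auto
    also have "\<dots> = (\<Sum>i. ennreal ((1/2) ^ i * V)) * HL_max t g x" by simp
    also have "(\<Sum>i. ennreal ((1/2) ^ i * V)) = ennreal (\<Sum>i. (1/2) ^ i * V)"
      using V by (intro suminf_ennreal2 summable_mult2 summable_geometric) auto
    also have "(\<Sum>i. (1/2) ^ i * V) = 2 * V"
      using V by (subst suminf_mult2[symmetric]) (auto simp: suminf_geometric summable_geometric)
    finally show "(\<Sum>i. ?b i * (?i * (\<integral>\<^sup>+y. g y * ?B i y \<partial>M))) \<le> ennreal (2 * V) * HL_max t g x" .
  qed simp_all
  finally show ?thesis unfolding r_def .
qed

text \<open>
  The order of magnitude of the largest weight \<open>2\<^bsup>m(d-1)/2\<^esup>\<close> of a shell, where \<open>2\<^bsup>-m\<^esup>\<close> is comparable to \<open>\<delta>\<close>.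
\<close>

definition loss :: "real \<Rightarrow> real" where
  "loss \<delta> = \<delta> powr (- (d - 1) / 2)"

lemma loss_bound:
  assumes \<delta>: "0 < \<delta>" and m: "2 ^ m \<le> 4 / \<delta>"
  shows "2 powr (real m * ((d - 1) / 2)) \<le> 2 powr (d - 1) * loss \<delta>"
proof -
  have "2 powr (real m * ((d - 1) / 2)) = (2 ^ m) powr ((d - 1) / 2)"
    by (simp add: powr_realpow[symmetric] powr_powr)
  also have "\<dots> \<le> (4 / \<delta>) powr ((d - 1) / 2)" using m d by (intro powr_mono2) auto
  also have "\<dots> = (2 powr 2) powr ((d - 1) / 2) * loss \<delta>"
  proof -
    have "loss \<delta> = 1 / \<delta> powr ((d - 1) / 2)"
      unfolding loss_def powr_minus_divide[symmetric] minus_divide_left ..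
    moreover have "(2::real) powr 2 = 4" by (simp add: powr_numeral)
    ultimately show ?thesis using \<delta> by (simp add: powr_divide)
  qed
  also have "\<dots> = 2 powr (d - 1) * loss \<delta>" 
  proof -
    have "2 * ((d - 1) / 2) = d - 1" by simp
    then show ?thesis by (simp only: powr_powr)
  qed
  finally show ?thesis .
qed

text \<open>
  Each of the \<open>m\<close> shells contributes \<open>O(loss \<delta>)\<close>, and \<open>m\<close> is of the order of \<open>1 + \<bar>ln \<delta>\<bar>\<close>. Counting the shells with equal
  weight is wasteful for \<open>d > 1\<close>, but the factor is absorbed by the logarithms of the final bound.
\<close>

lemma ker_mass:
  obtains N where "0 < N" "\<And>\<delta> r x. 0 < \<delta> \<Longrightarrow> \<delta> \<le> 1 \<Longrightarrow> 0 < r \<Longrightarrow>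
    kop \<delta> r (\<lambda>_. 1) x \<le> ennreal (N * loss \<delta> * (1 + \<bar>ln \<delta>\<bar>))"
proof -
  let ?c = "2 powr (2 * (d + 1)) :: real"
  let ?N = "?c * (2 powr (d - 1) * (W + 2 * V) * 3)"
  show ?thesis
  proof (rule that[of ?N])
    show "0 < ?N" using W_pos V by simp
    fix \<delta> r :: real and x :: 'a assume \<delta>: "0 < \<delta>" "\<delta> \<le> 1" and r: "0 < r"
    obtain m where m: "1 \<le> m" "(1/2) ^ m \<le> \<delta>" "2 ^ m \<le> 4 / \<delta>" "real m + 1 \<le> 3 * (1 + \<bar>ln \<delta>\<bar>)"
      using dyadic_scale[OF \<delta>] by blast
    let ?w = "2 powr (real m * ((d - 1) / 2)) :: real"
    have w: "1 \<le> ?w" using d by (simp add: ge_one_powr_ge_zero)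
    have HL1: "HL_max r (\<lambda>_. 1) x = 1"
      unfolding HL_max_def using avg_const[OF rad_pos[OF r], where c=1 and x=x] by simp
    have "kop \<delta> (rad r 0) (\<lambda>_. 1) x \<le> ennreal ?c * ((\<Sum>k\<in>{1..m}. ennreal (2 powr (real k * ((d - 1) / 2))) * shell_avg k (rad r 0) (\<lambda>_. 1) x)
       + ennreal (2 * V) * HL_max r (\<lambda>_. 1) x)"
      by (rule kop_le) (use r \<delta> m in auto)
    also have "\<dots> \<le> ennreal ?c * ((\<Sum>k\<in>{1..m}. ennreal ?w * ennreal W) + ennreal (2 * V) * 1)"
      unfolding HL1
    proof (intro mult_left_mono add_mono sum_mono mult_mono ennreal_leI)
      fix k assume k: "k \<in> {1..m}"
      show "2 powr (real k * ((d - 1) / 2)) \<le> ?w" using k d by (intro powr_mono mult_right_mono) auto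
      show "shell_avg k (rad r 0) (\<lambda>_. 1) x \<le> ennreal W"
        using shell_avg_le_wide_avg[OF rad_pos[OF r], of k 0 "\<lambda>_. 1" x] wide_avg_const_le[OF rad_pos[OF r], of k 0 1 x]
        by simp
    qed auto
    also have "\<dots> = ennreal (?c * (real m * (?w * W) + 2 * V))"
      using W_pos V by (simp add: ennreal_mult[symmetric] ennreal_of_nat_eq_real_of_nat ennreal_plus[symmetric] del: ennreal_plus)
    also have "\<dots> \<le> ennreal (?N * loss \<delta> * (1 + \<bar>ln \<delta>\<bar>))"
    proof (rule ennreal_leI)
      have "real m * (?w * W) + 2 * V \<le> (real m + 1) * ?w * (W + 2 * V)"
      proof -
        have "2 * V \<le> ?w * (2 * V)" using w V by simp
        moreover have "0 \<le> ?w * W" "0 \<le> real m * (?w * (2 * V))" using W_pos V by simp_all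
        ultimately show ?thesis by (simp add: algebra_simps)
      qed
      also have "\<dots> \<le> (3 * (1 + \<bar>ln \<delta>\<bar>)) * (2 powr (d - 1) * loss \<delta>) * (W + 2 * V)"
        using m loss_bound[OF \<delta>(1) m(3)] W_pos V by (intro mult_right_mono mult_mono) auto
      finally have "?c * (real m * (?w * W) + 2 * V) \<le> ?c * ((3 * (1 + \<bar>ln \<delta>\<bar>)) * (2 powr (d - 1) * loss \<delta>) * (W + 2 * V))"
        by (rule mult_left_mono) simp
      also have "\<dots> = ?N * loss \<delta> * (1 + \<bar>ln \<delta>\<bar>)" by (simp only: mult_ac)
      finally show "?c * (real m * (?w * W) + 2 * V) \<le> ?N * loss \<delta> * (1 + \<bar>ln \<delta>\<bar>)" .
    qed
    finally show "kop \<delta> r (\<lambda>_. 1) x \<le> ennreal (?N * loss \<delta> * (1 + \<bar>ln \<delta>\<bar>))" by (simp add: rad_def)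
  qed
qed

text \<open>
  A sum of \<open>m + 1\<close> maximal functions, each of norm \<open>O((m + 1)\<^bsup>1/q\<^esup>)\<close> on \<open>L\<^sup>q\<close>. Crude estimates lead to the third power of
  \<open>m + 1\<close>, that is to three logarithms. This suffices, as the square function estimate sees the geometric
  mean with the kernel mass, which has only one.
\<close>

lemma kop_max_strong_type:
  assumes q: "1 < q"
  obtains K where "0 < K" "\<And>\<delta> t F (g :: 'a \<Rightarrow> ennreal). 0 < \<delta> \<Longrightarrow> \<delta> \<le> 1 \<Longrightarrow> 0 < t \<Longrightarrow> finite F \<Longrightarrow>
    g \<in> borel_measurable M \<Longrightarrow>
    (\<integral>\<^sup>+x. epowr (SUP j\<in>F. kop \<delta> (rad t j) g x) q \<partial>M)
      \<le> ennreal ((K * loss \<delta> * (1 + \<bar>ln \<delta>\<bar>) ^ 3) powr q) * (\<integral>\<^sup>+x. epowr (g x) q \<partial>M)"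
proof -
  obtain K0 where K0: "0 < K0" "\<And>m t F (f :: 'a \<Rightarrow> ennreal). f \<in> borel_measurable M \<Longrightarrow> 0 < t \<Longrightarrow> finite F \<Longrightarrow>
    (\<integral>\<^sup>+x. epowr (shell_max m t F f x) q \<partial>M) \<le> ennreal (K0 * (real m + 1)) * (\<integral>\<^sup>+x. epowr (f x) q \<partial>M)"
    using shell_max_strong_type[OF q] by blast
  define H where "H = 2 * D * q / (q - 1) * 2 powr (q - 1)"
  have H: "0 < H" using D q by (simp add: H_def)
  define c where "c = 2 powr (2 * (d + 1)) * (1 + 2 * V)"
  have c: "0 < c" using V by (simp add: c_def)
  define K where "K = c * (2 powr (d - 1) * (3 ^ 3 * (1 + K0 + H)))"
  show ?thesis
  proof (rule that[of K])
    show "0 < K" using c K0 H by (simp add: K_def)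
    fix \<delta> t :: real and F :: "int set" and g :: "'a \<Rightarrow> ennreal"
    assume \<delta>: "0 < \<delta>" "\<delta> \<le> 1" and t: "0 < t" and F: "finite F" and [measurable]: "g \<in> borel_measurable M"
    obtain m where m: "1 \<le> m" "(1/2) ^ m \<le> \<delta>" "2 ^ m \<le> 4 / \<delta>" "real m + 1 \<le> 3 * (1 + \<bar>ln \<delta>\<bar>)"
      using dyadic_scale[OF \<delta>] by blast
    define w where "w = 2 powr (real m * ((d - 1) / 2))"
    have w: "1 \<le> w" unfolding w_def using d by (simp add: ge_one_powr_ge_zero)
    let ?I = "\<integral>\<^sup>+x. epowr (g x) q \<partial>M"
    define h where "h k x = (if k = 0 then HL_max t g x else shell_max k t F g x)" for k x
    have [measurable]: "h k \<in> borel_measurable M" for k unfolding h_def by (cases "k = 0") simp_all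
    have "(SUP j\<in>F. kop \<delta> (rad t j) g x) \<le> ennreal (c * w) * (\<Sum>k\<in>{0..m}. h k x)" for x
    proof (rule SUP_least)
      fix j assume j: "j \<in> F"
      have "kop \<delta> (rad t j) g x \<le> ennreal (2 powr (2 * (d + 1))) *
        ((\<Sum>k\<in>{1..m}. ennreal (2 powr (real k * ((d - 1) / 2))) * shell_avg k (rad t j) g x) + ennreal (2 * V) * HL_max t g x)"
        by (rule kop_le) (use t \<delta> m in auto)
      also have "\<dots> \<le> ennreal (2 powr (2 * (d + 1))) * ((\<Sum>k\<in>{1..m}. ennreal (w * (1 + 2 * V)) * h k x) + ennreal (w * (1 + 2 * V)) * h 0 x)"
      proof (rule mult_left_mono[OF add_mono[OF sum_mono]])
        fix k assume k: "k \<in> {1..m}"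
        have "2 powr (real k * ((d - 1) / 2)) \<le> w" unfolding w_def using k d by (intro powr_mono mult_right_mono) auto
        also have "\<dots> \<le> w * (1 + 2 * V)" using w V by simp
        finally have coeff: "2 powr (real k * ((d - 1) / 2)) \<le> w * (1 + 2 * V)" .
        have "shell_avg k (rad t j) g x \<le> h k x"
          using k j unfolding h_def shell_max_def by (auto intro: SUP_upper)
        then show "ennreal (2 powr (real k * ((d - 1) / 2))) * shell_avg k (rad t j) g x \<le> ennreal (w * (1 + 2 * V)) * h k x"
          using ennreal_leI[OF coeff] by (intro mult_mono) auto
      next
        have "2 * V \<le> 1 * (1 + 2 * V)" by simp
        also have "\<dots> \<le> w * (1 + 2 * V)" using w V by (intro mult_right_mono) auto
        finally have "ennreal (2 * V) \<le> ennreal (w * (1 + 2 * V))" by (rule ennreal_leI)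
        then show "ennreal (2 * V) * HL_max t g x \<le> ennreal (w * (1 + 2 * V)) * h 0 x"
          by (auto simp: h_def intro: mult_right_mono)
      qed simp
      also have "\<dots> = ennreal (2 powr (2 * (d + 1))) * (ennreal (w * (1 + 2 * V)) * (\<Sum>k\<in>{0..m}. h k x))"
      proof -
        have "(\<Sum>k\<in>{0..m}. h k x) = h 0 x + (\<Sum>k\<in>{1..m}. h k x)"
          by (simp add: sum.atLeast_Suc_atMost)
        then show ?thesis by (simp only: sum_distrib_left distrib_left add.commute)
      qed
      also have "\<dots> = ennreal (c * w) * (\<Sum>k\<in>{0..m}. h k x)"
      proof -
        have "2 powr (2 * (d + 1)) * (w * (1 + 2 * V)) = c * w" by (simp add: c_def)
        moreover have "ennreal (2 powr (2 * (d + 1))) * ennreal (w * (1 + 2 * V)) = ennreal (2 powr (2 * (d + 1)) * (w * (1 + 2 * V)))"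
          using w V by (intro ennreal_mult[symmetric]) auto
        ultimately show ?thesis by (simp only: mult.assoc[symmetric])
      qed
      finally show "kop \<delta> (rad t j) g x \<le> ennreal (c * w) * (\<Sum>k\<in>{0..m}. h k x)" .
    qed
    then have mono: "epowr (SUP j\<in>F. kop \<delta> (rad t j) g x) q \<le> epowr (ennreal (c * w) * (\<Sum>k\<in>{0..m}. h k x)) q" for x
      using q by (intro epowr_mono) auto
    have scale: "epowr (ennreal (c * w) * (\<Sum>k\<in>{0..m}. h k x)) q = ennreal ((c * w) powr q) * epowr (\<Sum>k\<in>{0..m}. h k x) q" for x
      by (rule epowr_mult) (use c w q in auto)
    have card: "real (card {0..m}) = real m + 1" by simp
    have sum: "epowr (\<Sum>k\<in>{0..m}. h k x) q \<le> ennreal ((real m + 1) powr q) * (\<Sum>k\<in>{0..m}. epowr (h k x) q)" for x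
      using epowr_sum_le[of "{0..m}" q "\<lambda>k. h k x"] q unfolding card by simp
    have "(\<integral>\<^sup>+x. epowr (SUP j\<in>F. kop \<delta> (rad t j) g x) q \<partial>M)
      \<le> (\<integral>\<^sup>+x. ennreal ((c * w) powr q) * (ennreal ((real m + 1) powr q) * (\<Sum>k\<in>{0..m}. epowr (h k x) q)) \<partial>M)"
      by (rule nn_integral_mono, rule order_trans[OF mono], unfold scale, rule mult_left_mono[OF sum]) simp
    also have "\<dots> = ennreal ((c * w) powr q) * (ennreal ((real m + 1) powr q) * (\<Sum>k\<in>{0..m}. \<integral>\<^sup>+x. epowr (h k x) q \<partial>M))"
      by (simp add: nn_integral_cmult nn_integral_sum)
    also have "\<dots> \<le> ennreal ((c * w) powr q) * (ennreal ((real m + 1) powr q) * (\<Sum>k\<in>{0..m}. ennreal ((K0 + H) * (real m + 1)) * ?I))"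
    proof (intro mult_left_mono sum_mono)
      fix k assume k: "k \<in> {0..m}"
      have 1: "H \<le> (K0 + H) * (real m + 1)" "K0 * (real k + 1) \<le> (K0 + H) * (real m + 1)"
        using K0(1) H k by (auto intro!: mult_mono simp: algebra_simps add_increasing add_increasing2)
      show "(\<integral>\<^sup>+x. epowr (h k x) q \<partial>M) \<le> ennreal ((K0 + H) * (real m + 1)) * ?I"
      proof (cases "k = 0")
        case True
        then have "(\<integral>\<^sup>+x. epowr (h k x) q \<partial>M) \<le> ennreal H * ?I"
          unfolding h_def H_def using HL_max_strong_type[of g t q] t q by simp
        also have "\<dots> \<le> ennreal ((K0 + H) * (real m + 1)) * ?I" using 1 by (intro mult_right_mono ennreal_leI) auto
        finally show ?thesis .
      next
        case False
        then have "(\<integral>\<^sup>+x. epowr (h k x) q \<partial>M) \<le> ennreal (K0 * (real k + 1)) * ?I"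
          unfolding h_def using K0(2)[of g t F k] t F by simp
        also have "\<dots> \<le> ennreal ((K0 + H) * (real m + 1)) * ?I" using 1 by (intro mult_right_mono ennreal_leI) auto
        finally show ?thesis .
      qed
    qed simp_all
    also have "\<dots> = ennreal ((c * w) powr q * ((real m + 1) powr q * ((real m + 1) * ((K0 + H) * (real m + 1))))) * ?I"
    proof -
      have e: "(\<Sum>k\<in>{0..m}. ennreal ((K0 + H) * (real m + 1)) * ?I) = ennreal (real m + 1) * (ennreal ((K0 + H) * (real m + 1)) * ?I)"
        by (simp add: ennreal_of_nat_eq_real_of_nat add.commute)
      show ?thesis unfolding e using K0(1) H
        by (simp add: ennreal_mult mult.assoc del: ennreal_plus)
    qed
    also have "\<dots> \<le> ennreal ((K * loss \<delta> * (1 + \<bar>ln \<delta>\<bar>) ^ 3) powr q) * ?I"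
    proof (intro mult_right_mono ennreal_leI)
      let ?m = "real m + 1"
      have grow: "x \<le> x powr q" if "1 \<le> x" for x :: real using powr_mono[of 1 q x] that q by simp
      have "?m * ((K0 + H) * ?m) \<le> (1 + K0 + H) * ?m\<^sup>2"
        using K0(1) H by (simp add: power2_eq_square algebra_simps)
      also have "\<dots> \<le> ((1 + K0 + H) * ?m\<^sup>2) powr q"
        using K0(1) H by (intro grow mult_ge1_I one_le_power) auto
      finally have "(c * w) powr q * (?m powr q * (?m * ((K0 + H) * ?m))) \<le> (c * w) powr q * (?m powr q * ((1 + K0 + H) * ?m\<^sup>2) powr q)"
        by (intro mult_left_mono) auto
      also have "\<dots> = (c * w * ?m * ((1 + K0 + H) * ?m\<^sup>2)) powr q"
        using c w K0(1) H by (simp add: powr_mult mult.assoc)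
      also have "\<dots> \<le> (K * loss \<delta> * (1 + \<bar>ln \<delta>\<bar>) ^ 3) powr q"
      proof (rule powr_mono2)
        have "w * ?m ^ 3 \<le> (2 powr (d - 1) * loss \<delta>) * (3 * (1 + \<bar>ln \<delta>\<bar>)) ^ 3"
          unfolding w_def using m(4) loss_bound[OF \<delta>(1) m(3)] by (intro mult_mono power_mono) (auto simp: loss_def)
        then have scaled: "c * (1 + K0 + H) * (w * ?m ^ 3) \<le> c * (1 + K0 + H) * ((2 powr (d - 1) * loss \<delta>) * (3 * (1 + \<bar>ln \<delta>\<bar>)) ^ 3)"
          using c K0(1) H by (intro mult_left_mono) auto
        show "c * w * ?m * ((1 + K0 + H) * ?m\<^sup>2) \<le> K * loss \<delta> * (1 + \<bar>ln \<delta>\<bar>) ^ 3"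
        proof -
          have "c * w * ?m * ((1 + K0 + H) * ?m\<^sup>2) = c * (1 + K0 + H) * (w * ?m ^ 3)"
            by (simp only: power2_eq_square power3_eq_cube mult_ac)
          moreover have "c * (1 + K0 + H) * ((2 powr (d - 1) * l) * (3 * L) ^ 3) = K * l * L ^ 3" for l L
            unfolding K_def power_mult_distrib by (simp only: mult_ac)
          ultimately show ?thesis
            using scaled by (simp only:)
        qed
      qed (use q c w K0(1) H in auto)
      finally show "(c * w) powr q * (?m powr q * (?m * ((K0 + H) * ?m))) \<le> (K * loss \<delta> * (1 + \<bar>ln \<delta>\<bar>) ^ 3) powr q" .
    qed simp
    finally show "(\<integral>\<^sup>+x. epowr (SUP j\<in>F. kop \<delta> (rad t j) g x) q \<partial>M)
      \<le> ennreal ((K * loss \<delta> * (1 + \<bar>ln \<delta>\<bar>) ^ 3) powr q) * ?I" .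
  qed
qed

end

section \<open>Square functions\<close>

lemma epowr_epowr: "epowr (epowr x a) b = epowr x (a * b)"
  by (cases x) (auto simp: powr_powr)

lemma Young_epowr:
  assumes q: "1 < q" and q': "q' = q / (q - 1)"
  shows "x * z \<le> epowr x q' + epowr z q"
proof -
  have e: "(q - 1) * (q' - 1) = 1" "(q - 1) * q' = q" using q by (simp_all add: q' field_simps)
  have "1 < q'" using q by (simp add: q')
  from epowr_Young[OF this, of x "epowr z (q - 1)"]
  have "x * epowr z 1 \<le> epowr x q' + epowr z q" by (simp add: epowr_epowr e)
  moreover have "epowr z 1 = z" by (cases z) auto
  ultimately show ?thesis by simp
qed

lemma ennreal_absorb_half:
  assumes le: "X \<le> ennreal a * Y + ennreal (1/2) * X" and fin: "X < \<top>" and a: "0 < a"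
  shows "X \<le> ennreal (2 * a) * Y"
proof (cases Y)
  case (real y)
  obtain x where x: "X = ennreal x" "0 \<le> x" using fin by (cases X) auto
  have "ennreal (1/2) * ennreal x = ennreal (1/2 * x)" "ennreal a * ennreal y = ennreal (a * y)"
    using x a real by (intro ennreal_mult[symmetric]; simp)+
  moreover have "ennreal (a * y) + ennreal (1/2 * x) = ennreal (a * y + 1/2 * x)"
    using x a real by (intro ennreal_plus[symmetric]) auto
  ultimately have "ennreal x \<le> ennreal (a * y + 1/2 * x)"
    using le unfolding real x by (simp only:)
  then have "x \<le> a * y + 1/2 * x" using real a x by (subst (asm) ennreal_le_iff) auto
  then have "x \<le> 2 * a * y" by simp
  then show ?thesis using real x a by (simp add: ennreal_mult[symmetric] ennreal_leI)
next
  case top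
  then show ?thesis using a by (simp add: ennreal_mult_top)
qed

text \<open>
  Duality without dual spaces. Hoelder's inequality would give \<open>X \<le> c \<parallel>f\<parallel>\<^bsub>q'\<^esub> \<parallel>g\<parallel>\<^sub>q \<le> c B \<parallel>f\<parallel>\<^bsub>q'\<^esub> X\<^bsup>1/q\<^esup>\<close>, from
  which a power of the finite number \<open>X\<close> can be cancelled. Young's inequality with a parameter, chosen so
  that the second term is \<open>X / 2\<close>, has the same effect.
\<close>

lemma nn_integral_Young_absorb:
  assumes [measurable]: "f \<in> borel_measurable N" "g \<in> borel_measurable N"
    and q: "1 < q" and q': "q' = q / (q - 1)" and c: "0 < c" and B: "0 < B"
    and le: "X \<le> ennreal c * (\<integral>\<^sup>+x. f x * g x \<partial>N)"
    and g: "(\<integral>\<^sup>+x. epowr (g x) q \<partial>N) \<le> ennreal (B powr q) * X"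
    and fin: "X < \<top>"
  shows "X \<le> ennreal ((2 * c * B) powr q') * (\<integral>\<^sup>+x. epowr (f x) q' \<partial>N)"
proof -
  define a where "a = B * (2 * c) powr (1 / q)"
  have a: "0 < a" using B c by (simp add: a_def)
  have q'pos: "1 < q'" using q by (simp add: q')
  have aq: "a powr q = B powr q * (2 * c)" using B c q by (simp add: a_def powr_mult powr_powr)
  have "f x * g x \<le> ennreal (a powr q') * epowr (f x) q' + ennreal ((1 / a) powr q) * epowr (g x) q" for x
  proof -
    have "f x * g x = (ennreal a * f x) * (ennreal (1 / a) * g x)"
    proof -
      have "(ennreal a * f x) * (ennreal (1 / a) * g x) = (ennreal a * ennreal (1 / a)) * (f x * g x)"
        by (simp only: mult_ac)
      also have "ennreal a * ennreal (1 / a) = 1" using a by (simp add: ennreal_mult[symmetric])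
      finally show ?thesis by simp
    qed
    also have "\<dots> \<le> epowr (ennreal a * f x) q' + epowr (ennreal (1 / a) * g x) q"
      by (rule Young_epowr[OF q q'])
    also have "\<dots> = ennreal (a powr q') * epowr (f x) q' + ennreal ((1 / a) powr q) * epowr (g x) q"
      using a q q'pos by (simp add: epowr_mult)
    finally show ?thesis .
  qed
  then have "(\<integral>\<^sup>+x. f x * g x \<partial>N) \<le> (\<integral>\<^sup>+x. ennreal (a powr q') * epowr (f x) q' + ennreal ((1 / a) powr q) * epowr (g x) q \<partial>N)"
    by (rule nn_integral_mono)
  also have "\<dots> = ennreal (a powr q') * (\<integral>\<^sup>+x. epowr (f x) q' \<partial>N) + ennreal ((1 / a) powr q) * (\<integral>\<^sup>+x. epowr (g x) q \<partial>N)"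
    by (simp add: nn_integral_add nn_integral_cmult)
  also have "\<dots> \<le> ennreal (a powr q') * (\<integral>\<^sup>+x. epowr (f x) q' \<partial>N) + ennreal ((1 / a) powr q) * (ennreal (B powr q) * X)"
    by (intro add_left_mono mult_left_mono g) simp
  finally have fg: "(\<integral>\<^sup>+x. f x * g x \<partial>N) \<le> \<dots>" .
  have "X \<le> ennreal c * (ennreal (a powr q') * (\<integral>\<^sup>+x. epowr (f x) q' \<partial>N) + ennreal ((1 / a) powr q) * (ennreal (B powr q) * X))"
    by (rule order_trans[OF le mult_left_mono[OF fg]]) simp
  also have "\<dots> = ennreal (c * a powr q') * (\<integral>\<^sup>+x. epowr (f x) q' \<partial>N) + ennreal (c * ((1 / a) powr q * B powr q)) * X"
    using c by (simp add: distrib_left ennreal_mult mult.assoc)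
  also have "c * ((1 / a) powr q * B powr q) = 1/2"
    using a B c by (simp add: powr_divide aq)
  finally have "X \<le> ennreal (2 * (c * a powr q')) * (\<integral>\<^sup>+x. epowr (f x) q' \<partial>N)"
    using fin a c by (intro ennreal_absorb_half) auto
  also have "2 * (c * a powr q') = (2 * c * B) powr q'"
  proof -
    have "1 / q * q' + 1 = q'" using q by (simp add: q' field_simps)
    then have "(2 * c) powr q' = (2 * c) powr (1 / q * q') * (2 * c)"
      using c by (metis powr_add powr_one mult_pos_pos zero_less_numeral less_imp_le)
    moreover have "a powr q' = B powr q' * (2 * c) powr (1 / q * q')"
      using B c by (simp add: a_def powr_mult powr_powr)
    moreover have "(2 * c * B) powr q' = (2 * c) powr q' * B powr q'" using B c by (simp add: powr_mult)
    ultimately show ?thesis by simp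
  qed
  finally show ?thesis .
qed

lemma sum_sq_powr_le:
  fixes v :: "nat \<Rightarrow> real"
  assumes p: "0 < p"
  shows "(\<Sum>k<n. (v k)\<^sup>2) powr (p / 2) \<le> real n powr (p / 2) * (\<Sum>k<n. \<bar>v k\<bar> powr p)"
proof -
  have "ennreal ((\<Sum>k<n. (v k)\<^sup>2) powr (p / 2)) = epowr (\<Sum>k<n. ennreal ((v k)\<^sup>2)) (p / 2)"
    by (simp add: sum_nonneg)
  also have "\<dots> \<le> ennreal (real (card {..<n}) powr (p / 2)) * (\<Sum>k<n. epowr (ennreal ((v k)\<^sup>2)) (p / 2))"
    using p by (intro epowr_sum_le) auto
  also have "\<dots> = ennreal (real n powr (p / 2)) * (\<Sum>k<n. ennreal (\<bar>v k\<bar> powr p))"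
  proof -
    have "((v k)\<^sup>2) powr (p / 2) = \<bar>v k\<bar> powr p" for k
    proof -
      have "((v k)\<^sup>2) powr (p / 2) = (\<bar>v k\<bar> powr 2) powr (p / 2)" by (simp add: powr_numeral)
      then show ?thesis by (simp only: powr_powr) simp
    qed
    then show ?thesis by simp
  qed
  also have "\<dots> = ennreal (real n powr (p / 2) * (\<Sum>k<n. \<bar>v k\<bar> powr p))"
    by (simp add: ennreal_mult sum_nonneg)
  finally show ?thesis by (subst (asm) ennreal_le_iff) (auto intro!: mult_nonneg_nonneg sum_nonneg)
qed

context thin_annulus_space
begin

lemma loss_pos: "0 < \<delta> \<Longrightarrow> 0 < loss \<delta>"
  by (simp add: loss_def)

lemma kop_symmetric:
  assumes [measurable]: "f \<in> borel_measurable M" "g \<in> borel_measurable M"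
  shows "(\<integral>\<^sup>+x. kop \<delta> r f x * g x \<partial>M) = (\<integral>\<^sup>+x. f x * kop \<delta> r g x \<partial>M)"
proof -
  have "(\<integral>\<^sup>+x. kop \<delta> r f x * g x \<partial>M) = (\<integral>\<^sup>+x. \<integral>\<^sup>+y. ennreal (ker \<delta> r x y) * f y * g x \<partial>M \<partial>M)"
    unfolding kop_def by (intro nn_integral_cong nn_integral_multc[symmetric]) simp
  also have "\<dots> = (\<integral>\<^sup>+y. \<integral>\<^sup>+x. ennreal (ker \<delta> r x y) * f y * g x \<partial>M \<partial>M)"
    by (rule MM.Fubini'[symmetric]) measurable
  also have "\<dots> = (\<integral>\<^sup>+y. \<integral>\<^sup>+x. f y * (ennreal (ker \<delta> r y x) * g x) \<partial>M \<partial>M)"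
    by (intro nn_integral_cong) (simp add: ker_commute[of \<delta> r] mult_ac)
  also have "\<dots> = (\<integral>\<^sup>+x. f x * kop \<delta> r g x \<partial>M)"
    unfolding kop_def by (intro nn_integral_cong nn_integral_cmult) simp
  finally show ?thesis .
qed

text \<open>
  Cauchy-Schwarz for the measure \<open>ker \<delta> r x y dy\<close>.
\<close>

lemma kop_Cauchy_Schwarz:
  assumes [measurable]: "g \<in> borel_measurable M"
  shows "(kop \<delta> r g x)\<^sup>2 \<le> kop \<delta> r (\<lambda>_. 1) x * kop \<delta> r (\<lambda>y. (g y)\<^sup>2) x"
proof -
  let ?s = "\<lambda>y. ennreal (sqrt (ker \<delta> r x y))"
  have s: "?s y * ?s y = ennreal (ker \<delta> r x y)" for y
    using ker_nonneg[of \<delta> r x y] by (simp add: ennreal_mult[symmetric])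
  have "kop \<delta> r g x = (\<integral>\<^sup>+y. ?s y * (?s y * g y) \<partial>M)"
    unfolding kop_def by (simp add: mult.assoc[symmetric] s)
  moreover have "(\<integral>\<^sup>+y. ?s y * (?s y * g y) \<partial>M)\<^sup>2 \<le> (\<integral>\<^sup>+y. (?s y)\<^sup>2 \<partial>M) * (\<integral>\<^sup>+y. (?s y * g y)\<^sup>2 \<partial>M)"
    by (rule Cauchy_Schwarz_nn_integral) measurable
  moreover have "(?s y)\<^sup>2 = ennreal (ker \<delta> r x y)" "(?s y * g y)\<^sup>2 = ennreal (ker \<delta> r x y) * (g y)\<^sup>2" for y
    by (simp_all only: power2_eq_square s mult_ac)
  ultimately show ?thesis unfolding kop_def by simp
qed

text \<open>
  A qualitative bound: it supplies the finiteness without which nothing can be cancelled later.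
\<close>

lemma kop_Lp_finite:
  assumes q: "1 < q" and \<delta>: "0 < \<delta>" "\<delta> \<le> 1" and t: "0 < t"
    and [measurable]: "g \<in> borel_measurable M" and fin: "(\<integral>\<^sup>+x. epowr (g x) q \<partial>M) < \<top>"
  shows "(\<integral>\<^sup>+x. epowr (kop \<delta> (rad t j) g x) q \<partial>M) < \<top>"
proof -
  obtain K where "(\<integral>\<^sup>+x. epowr (SUP j\<in>{j}. kop \<delta> (rad t j) g x) q \<partial>M)
      \<le> ennreal ((K * loss \<delta> * (1 + \<bar>ln \<delta>\<bar>) ^ 3) powr q) * (\<integral>\<^sup>+x. epowr (g x) q \<partial>M)"
    using kop_max_strong_type[OF q] \<delta> t by (metis assms(5) finite.emptyI finite.insertI)
  also have "\<dots> < \<top>" using fin by (simp add: ennreal_mult_less_top)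
  finally show ?thesis by simp
qed

definition sqsum :: "nat \<Rightarrow> (nat \<Rightarrow> 'a \<Rightarrow> real) \<Rightarrow> 'a \<Rightarrow> real" where
  "sqsum n v x = (\<Sum>k<n. (v k x)\<^sup>2)"

lemma sqsum_nonneg [simp]: "0 \<le> sqsum n v x"
  by (simp add: sqsum_def sum_nonneg)

lemma sqsum_pos: "sqsum n v x \<noteq> 0 \<Longrightarrow> 0 < sqsum n v x"
  by (metis sqsum_nonneg order_le_less)

lemma borel_measurable_sqsum [measurable (raw)]:
  assumes [measurable]: "\<And>k. v k \<in> borel_measurable M"
  shows "sqsum n v \<in> borel_measurable M"
  unfolding sqsum_def by measurable

definition sqnorm :: "real \<Rightarrow> nat \<Rightarrow> (nat \<Rightarrow> 'a \<Rightarrow> real) \<Rightarrow> ennreal" where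
  "sqnorm p n v = (\<integral>\<^sup>+x. ennreal (sqsum n v x powr (p / 2)) \<partial>M)"

lemma sqnorm_finite:
  assumes p: "0 < p" and [measurable]: "\<And>k. v k \<in> borel_measurable M" and pos: "\<And>k x. 0 \<le> v k x"
    and fin: "\<And>k. k < n \<Longrightarrow> (\<integral>\<^sup>+x. ennreal (v k x powr p) \<partial>M) < \<top>"
  shows "sqnorm p n v < \<top>"
proof -
  have "sqnorm p n v \<le> (\<integral>\<^sup>+x. ennreal (real n powr (p / 2)) * (\<Sum>k<n. ennreal (v k x powr p)) \<partial>M)"
    unfolding sqnorm_def sqsum_def
    using sum_sq_powr_le[OF p, of "\<lambda>k. v k _" n] pos
    by (intro nn_integral_mono) (auto simp: ennreal_mult[symmetric] sum_nonneg intro!: ennreal_leI)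
  also have "\<dots> = ennreal (real n powr (p / 2)) * (\<Sum>k<n. \<integral>\<^sup>+x. ennreal (v k x powr p) \<partial>M)"
    by (simp add: nn_integral_cmult nn_integral_sum del: sum_ennreal)
  also have "\<dots> < \<top>" using fin by (auto simp: ennreal_mult_less_top ennreal_sum_less_top)
  finally show ?thesis .
qed

lemma dominated_finite:
  assumes p: "1 < p" and \<delta>: "0 < \<delta>" "\<delta> \<le> 1" and t: "0 < t"
    and [measurable]: "g \<in> borel_measurable M" and g: "\<And>x. 0 \<le> g x" "(\<integral>\<^sup>+x. ennreal (g x powr p) \<partial>M) < \<top>"
    and v: "\<And>x. 0 \<le> v x" "AE x in M. ennreal (v x) \<le> kop \<delta> (rad t j) (\<lambda>y. ennreal (g y)) x"
  shows "(\<integral>\<^sup>+x. ennreal (v x powr p) \<partial>M) < \<top>"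
proof -
  have "(\<integral>\<^sup>+x. ennreal (v x powr p) \<partial>M) \<le> (\<integral>\<^sup>+x. epowr (kop \<delta> (rad t j) (\<lambda>y. ennreal (g y)) x) p \<partial>M)"
  proof (rule nn_integral_mono_AE)
    show "AE x in M. ennreal (v x powr p) \<le> epowr (kop \<delta> (rad t j) (\<lambda>y. ennreal (g y)) x) p"
      using v(2)
    proof eventually_elim
      case (elim x)
      have "ennreal (v x powr p) = epowr (ennreal (v x)) p" using v(1) by simp
      also have "\<dots> \<le> epowr (kop \<delta> (rad t j) (\<lambda>y. ennreal (g y)) x) p"
        using elim p by (intro epowr_mono) auto
      finally show ?case .
    qed
  qed
  also have "\<dots> < \<top>"
    using g by (intro kop_Lp_finite[OF p \<delta> t]) simp_all
  finally show ?thesis .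
qed

text \<open>
  The input of the square function estimates: functions \<open>v k\<close> that arise from \<open>g k\<close> by operators below \<open>kop\<close> at dyadic
  multiples of \<open>t\<close>. Measurability and sign are demanded for all indices,
  which keeps \<open>sqsum\<close> free of side conditions.
\<close>

definition dominated_family ::
    "real \<Rightarrow> real \<Rightarrow> real \<Rightarrow> nat \<Rightarrow> (nat \<Rightarrow> int) \<Rightarrow> (nat \<Rightarrow> 'a \<Rightarrow> real) \<Rightarrow> (nat \<Rightarrow> 'a \<Rightarrow> real) \<Rightarrow> bool" where
  "dominated_family p \<delta> t n j g v \<longleftrightarrow>
    (\<forall>k. g k \<in> borel_measurable M \<and> v k \<in> borel_measurable M) \<and> (\<forall>k x. 0 \<le> g k x \<and> 0 \<le> v k x) \<and>
    (\<forall>k<n. (\<integral>\<^sup>+x. ennreal (g k x powr p) \<partial>M) < \<top> \<and>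
      (AE x in M. ennreal (v k x) \<le> kop \<delta> (rad t (j k)) (\<lambda>y. ennreal (g k y)) x))"

lemma dominated_family_finite:
  assumes "1 < p" "0 < \<delta>" "\<delta> \<le> 1" "0 < t" and "dominated_family p \<delta> t n j g v"
  shows "sqnorm p n v < \<top>"
proof (rule sqnorm_finite)
  show "(\<integral>\<^sup>+x. ennreal (v k x powr p) \<partial>M) < \<top>" if "k < n" for k
    using dominated_finite[OF assms(1-4), of "g k" "v k" "j k"] assms(5) that unfolding dominated_family_def by auto
qed (use assms in \<open>auto simp: dominated_family_def\<close>)

text \<open>
  Let \<open>X = sqnorm p n v\<close> and \<open>h = (\<Sum>k. (v k)\<^sup>2)\<^bsup>p/2-1\<^esup>\<close>, so that \<open>X\<close> is the integral of \<open>(\<Sum>k. (v k)\<^sup>2) h\<close>. By Cauchy-Schwarz \<open>(v k)\<^sup>2\<close>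
  is at most the kernel mass times the operator applied to \<open>(g k)\<^sup>2\<close>; by symmetry the operator may act on \<open>h\<close> instead, and there it is
  dominated by the maximal operator. So \<open>X\<close> is at most the mass times the integral of \<open>(\<Sum>k. (g k)\<^sup>2) H\<close> for a function \<open>H\<close> whose norm in \<open>L\<^sup>q\<close>,
  \<open>q = (p/2)'\<close>, is controlled by a power of \<open>X\<close>, and \<open>X\<close> can be cancelled. The square root of the product of the mass
  bound (one logarithm) and the maximal bound (three) has two logarithms. For \<open>p = 2\<close> there is \<open>h \<le> 1\<close>, and
  the mass bound serves twice.
\<close>

lemma square_function_ge_2:
  assumes p: "2 \<le> p"
  obtains E where "0 < E" "\<And>\<delta> t n j g v. 0 < \<delta> \<Longrightarrow> \<delta> \<le> 1 \<Longrightarrow> 0 < t \<Longrightarrow>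
    dominated_family p \<delta> t n j g v \<Longrightarrow>
    sqnorm p n v \<le> ennreal ((E * loss \<delta> * (1 + \<bar>ln \<delta>\<bar>)\<^sup>2) powr p) * sqnorm p n g"
proof -
  obtain N where N: "0 < N" "\<And>\<delta> r x. 0 < \<delta> \<Longrightarrow> \<delta> \<le> 1 \<Longrightarrow> 0 < r \<Longrightarrow>
    kop \<delta> r (\<lambda>_. 1) x \<le> ennreal (N * loss \<delta> * (1 + \<bar>ln \<delta>\<bar>))" using ker_mass by blast
  \<comment> \<open>The conjugate exponent of \<open>p / 2\<close>, meaningful for \<open>p > 2\<close> only.\<close>
  define q where "q = p / (p - 2)"
  have "\<exists>K>0. 2 < p \<longrightarrow> (\<forall>\<delta> t F (g :: 'a \<Rightarrow> ennreal). 0 < \<delta> \<longrightarrow> \<delta> \<le> 1 \<longrightarrow> 0 < t \<longrightarrow> finite F \<longrightarrow>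
    g \<in> borel_measurable M \<longrightarrow>
    (\<integral>\<^sup>+x. epowr (SUP j\<in>F. kop \<delta> (rad t j) g x) q \<partial>M)
      \<le> ennreal ((K * loss \<delta> * (1 + \<bar>ln \<delta>\<bar>) ^ 3) powr q) * (\<integral>\<^sup>+x. epowr (g x) q \<partial>M))"
  proof (cases "2 < p")
    case True
    then have "1 < q" by (simp add: q_def)
    from kop_max_strong_type[OF this] show ?thesis by metis
  qed (auto intro: exI[of _ 1])
  then obtain K where K: "0 < K" "\<And>\<delta> t F (g :: 'a \<Rightarrow> ennreal). 2 < p \<Longrightarrow> 0 < \<delta> \<Longrightarrow> \<delta> \<le> 1 \<Longrightarrow> 0 < t \<Longrightarrow> finite F \<Longrightarrow>
    g \<in> borel_measurable M \<Longrightarrow>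
    (\<integral>\<^sup>+x. epowr (SUP j\<in>F. kop \<delta> (rad t j) g x) q \<partial>M)
      \<le> ennreal ((K * loss \<delta> * (1 + \<bar>ln \<delta>\<bar>) ^ 3) powr q) * (\<integral>\<^sup>+x. epowr (g x) q \<partial>M)"
    by blast
  define E where "E = N + sqrt (2 * N * K)"
  show ?thesis
  proof (rule that[of E])
    show "0 < E" using N(1) K(1) by (simp add: E_def add_pos_nonneg)
    fix \<delta> t :: real and n :: nat and j :: "nat \<Rightarrow> int" and g v :: "nat \<Rightarrow> 'a \<Rightarrow> real"
    assume \<delta>: "0 < \<delta>" "\<delta> \<le> 1" and t: "0 < t"
      and fam: "dominated_family p \<delta> t n j g v"
    let ?T = "\<lambda>k. kop \<delta> (rad t (j k))"
    have [measurable]: "\<And>k. g k \<in> borel_measurable M" "\<And>k. v k \<in> borel_measurable M"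
      and g: "\<And>k x. 0 \<le> g k x" and v: "\<And>k x. 0 \<le> v k x"
      and dom: "\<And>k. k < n \<Longrightarrow> AE x in M. ennreal (v k x) \<le> ?T k (\<lambda>y. ennreal (g k y)) x"
      using fam unfolding dominated_family_def by auto
    define L where "L = 1 + \<bar>ln \<delta>\<bar>"
    have L: "1 \<le> L" by (simp add: L_def)
    have loss: "0 < loss \<delta>" using \<delta>(1) by (rule loss_pos)
    define A where "A = N * loss \<delta> * L"
    have A: "0 < A" using N loss L by (simp add: A_def)
    define X where "X = sqnorm p n v"
    have p1: "1 < p" using p by simp
    have Xfin: "X < \<top>" unfolding X_def by (rule dominated_family_finite[OF p1 \<delta> t fam])
    define h where "h x = sqsum n v x powr (p / 2 - 1)" for x
    have [measurable]: "h \<in> borel_measurable M" unfolding h_def by measurable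
    have h: "0 \<le> h x" for x by (simp add: h_def)
    have sq: "AE x in M. ennreal ((v k x)\<^sup>2) \<le> ennreal A * ?T k (\<lambda>y. ennreal ((g k y)\<^sup>2)) x" if k: "k < n" for k
      using dom[OF k]
    proof eventually_elim
      case (elim x)
      have "ennreal ((v k x)\<^sup>2) = (ennreal (v k x))\<^sup>2" using v by (simp add: ennreal_power)
      also have "\<dots> \<le> (?T k (\<lambda>y. ennreal (g k y)) x)\<^sup>2" using elim by (intro power_mono) auto
      also have "\<dots> \<le> ?T k (\<lambda>_. 1) x * ?T k (\<lambda>y. (ennreal (g k y))\<^sup>2) x"
        by (rule kop_Cauchy_Schwarz) simp
      also have "\<dots> \<le> ennreal A * ?T k (\<lambda>y. (ennreal (g k y))\<^sup>2) x"
        using N(2)[OF \<delta> rad_pos[OF t]] unfolding A_def L_def by (intro mult_right_mono) auto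
      finally show ?case using g by (simp add: ennreal_power)
    qed
    have "X = (\<integral>\<^sup>+x. (\<Sum>k<n. ennreal ((v k x)\<^sup>2) * ennreal (h x)) \<partial>M)"
      unfolding X_def sqnorm_def
    proof (rule nn_integral_cong)
      fix x
      have "sqsum n v x powr (p / 2) = sqsum n v x * h x"
      proof (cases "sqsum n v x = 0")
        case False
        then have "0 < sqsum n v x" by (rule sqsum_pos)
        then show ?thesis unfolding h_def using powr_mult_base[of "sqsum n v x" "p / 2 - 1"] by simp
      qed simp
      also have "\<dots> = (\<Sum>k<n. (v k x)\<^sup>2 * h x)" by (simp add: sqsum_def sum_distrib_right)
      finally show "ennreal (sqsum n v x powr (p / 2)) = (\<Sum>k<n. ennreal ((v k x)\<^sup>2) * ennreal (h x))"
        using h by (simp add: ennreal_mult[symmetric])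
    qed
    also have "\<dots> = (\<Sum>k<n. \<integral>\<^sup>+x. ennreal ((v k x)\<^sup>2) * ennreal (h x) \<partial>M)"
      by (rule nn_integral_sum) simp
    also have "\<dots> \<le> (\<Sum>k<n. \<integral>\<^sup>+x. ennreal A * (ennreal ((g k x)\<^sup>2) * ?T k (\<lambda>y. ennreal (h y)) x) \<partial>M)"
    proof (rule sum_mono)
      fix k assume "k \<in> {..<n}"
      then have "AE x in M. ennreal ((v k x)\<^sup>2) \<le> ennreal A * ?T k (\<lambda>y. ennreal ((g k y)\<^sup>2)) x"
        using sq by simp
      then have "AE x in M. ennreal ((v k x)\<^sup>2) * ennreal (h x) \<le> ennreal A * (?T k (\<lambda>y. ennreal ((g k y)\<^sup>2)) x * ennreal (h x))"
        by eventually_elim (simp add: mult.assoc[symmetric] mult_right_mono)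
      then have "(\<integral>\<^sup>+x. ennreal ((v k x)\<^sup>2) * ennreal (h x) \<partial>M)
        \<le> (\<integral>\<^sup>+x. ennreal A * (?T k (\<lambda>y. ennreal ((g k y)\<^sup>2)) x * ennreal (h x)) \<partial>M)"
        by (rule nn_integral_mono_AE)
      also have "\<dots> = ennreal A * (\<integral>\<^sup>+x. ?T k (\<lambda>y. ennreal ((g k y)\<^sup>2)) x * ennreal (h x) \<partial>M)"
        by (rule nn_integral_cmult) simp
      also have "(\<integral>\<^sup>+x. ?T k (\<lambda>y. ennreal ((g k y)\<^sup>2)) x * ennreal (h x) \<partial>M)
        = (\<integral>\<^sup>+x. ennreal ((g k x)\<^sup>2) * ?T k (\<lambda>y. ennreal (h y)) x \<partial>M)"
        by (rule kop_symmetric) simp_all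
      also have "ennreal A * \<dots> = (\<integral>\<^sup>+x. ennreal A * (ennreal ((g k x)\<^sup>2) * ?T k (\<lambda>y. ennreal (h y)) x) \<partial>M)"
        by (rule nn_integral_cmult[symmetric]) simp
      finally show "(\<integral>\<^sup>+x. ennreal ((v k x)\<^sup>2) * ennreal (h x) \<partial>M) \<le> \<dots>" .
    qed
    also have "\<dots> = (\<integral>\<^sup>+x. (\<Sum>k<n. ennreal A * (ennreal ((g k x)\<^sup>2) * ?T k (\<lambda>y. ennreal (h y)) x)) \<partial>M)"
      by (rule nn_integral_sum[symmetric]) simp
    also have "\<dots> = ennreal A * (\<integral>\<^sup>+x. (\<Sum>k<n. ennreal ((g k x)\<^sup>2) * ?T k (\<lambda>y. ennreal (h y)) x) \<partial>M)"
      unfolding sum_distrib_left[symmetric] by (rule nn_integral_cmult) simp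
    finally have main: "X \<le> ennreal A * (\<integral>\<^sup>+x. (\<Sum>k<n. ennreal ((g k x)\<^sup>2) * ?T k (\<lambda>y. ennreal (h y)) x) \<partial>M)" .
    show "sqnorm p n v \<le> ennreal ((E * loss \<delta> * (1 + \<bar>ln \<delta>\<bar>)\<^sup>2) powr p) * sqnorm p n g"
    proof (cases "p = 2")
      case True
      have h1: "ennreal (h y) \<le> 1" for y using True by (auto simp: h_def)
      have "(\<Sum>k<n. ennreal ((g k x)\<^sup>2) * ?T k (\<lambda>y. ennreal (h y)) x) \<le> ennreal A * ennreal (sqsum n g x)" for x
      proof -
        have "?T k (\<lambda>y. ennreal (h y)) x \<le> ennreal A" for k
        proof -
          have "?T k (\<lambda>y. ennreal (h y)) x \<le> ?T k (\<lambda>_. 1) x"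
            unfolding kop_def by (intro nn_integral_mono mult_left_mono h1) simp
          also have "\<dots> \<le> ennreal A" using N(2)[OF \<delta> rad_pos[OF t]] by (simp add: A_def L_def)
          finally show ?thesis .
        qed
        then have "(\<Sum>k<n. ennreal ((g k x)\<^sup>2) * ?T k (\<lambda>y. ennreal (h y)) x) \<le> (\<Sum>k<n. ennreal ((g k x)\<^sup>2) * ennreal A)"
          by (intro sum_mono mult_left_mono) auto
        also have "\<dots> = ennreal A * ennreal (sqsum n g x)"
          unfolding sum_distrib_right[symmetric] by (simp add: sqsum_def mult.commute)
        finally show ?thesis .
      qed
      then have "(\<integral>\<^sup>+x. (\<Sum>k<n. ennreal ((g k x)\<^sup>2) * ?T k (\<lambda>y. ennreal (h y)) x) \<partial>M) \<le> (\<integral>\<^sup>+x. ennreal A * ennreal (sqsum n g x) \<partial>M)"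
        by (rule nn_integral_mono)
      also have "\<dots> = ennreal A * sqnorm p n g"
        by (subst nn_integral_cmult) (simp_all add: sqnorm_def True)
      finally have "X \<le> ennreal A * (ennreal A * sqnorm p n g)"
        using main by (meson mult_left_mono order_trans zero_le)
      also have "\<dots> = ennreal (A * A) * sqnorm p n g"
        using A by (simp add: ennreal_mult mult.assoc)
      also have "\<dots> \<le> ennreal ((E * loss \<delta> * L\<^sup>2) powr p) * sqnorm p n g"
      proof (intro mult_right_mono ennreal_leI)
        have NE: "N \<le> E" using N(1) K(1) by (simp add: E_def)
        have "L \<le> L\<^sup>2" using L by (simp add: power2_eq_square)
        then have AE: "A \<le> E * loss \<delta> * L\<^sup>2" unfolding A_def using NE N(1) loss L by (intro mult_mono) auto
        then have "A * A \<le> (E * loss \<delta> * L\<^sup>2)\<^sup>2" using A unfolding power2_eq_square by (intro mult_mono) auto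
        also have "\<dots> = (E * loss \<delta> * L\<^sup>2) powr p" using True AE A by (simp add: powr_numeral)
        finally show "A * A \<le> (E * loss \<delta> * L\<^sup>2) powr p" .
      qed simp
      finally show ?thesis unfolding X_def L_def .
    next
      case False
      then have p2: "2 < p" using p by simp
      have q: "1 < q" using p2 by (simp add: q_def)
      have qc: "p / 2 = q / (q - 1)" using p2 by (simp add: q_def field_simps)
      define B where "B = K * loss \<delta> * L ^ 3"
      have B: "0 < B" using K(1) loss L by (simp add: B_def)
      define F where "F = j ` {..<n}"
      have finF: "finite F" by (simp add: F_def)
      define H where "H x = (SUP j\<in>F. kop \<delta> (rad t j) (\<lambda>y. ennreal (h y)) x)" for x
      have [measurable]: "H \<in> borel_measurable M"
        unfolding H_def using finF by (intro borel_measurable_SUP) (auto intro: countable_finite)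
      have "(\<Sum>k<n. ennreal ((g k x)\<^sup>2) * ?T k (\<lambda>y. ennreal (h y)) x) \<le> ennreal (sqsum n g x) * H x" for x
      proof -
        have "(\<Sum>k<n. ennreal ((g k x)\<^sup>2) * ?T k (\<lambda>y. ennreal (h y)) x) \<le> (\<Sum>k<n. ennreal ((g k x)\<^sup>2) * H x)"
          unfolding H_def F_def by (intro sum_mono mult_left_mono SUP_upper) auto
        also have "\<dots> = ennreal (sqsum n g x) * H x"
          unfolding sum_distrib_right[symmetric] by (simp add: sqsum_def)
        finally show ?thesis .
      qed
      then have "(\<integral>\<^sup>+x. (\<Sum>k<n. ennreal ((g k x)\<^sup>2) * ?T k (\<lambda>y. ennreal (h y)) x) \<partial>M) \<le> (\<integral>\<^sup>+x. ennreal (sqsum n g x) * H x \<partial>M)"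
        by (rule nn_integral_mono)
      then have le: "X \<le> ennreal A * (\<integral>\<^sup>+x. ennreal (sqsum n g x) * H x \<partial>M)"
        using main by (meson mult_left_mono order_trans zero_le)
      have "(\<integral>\<^sup>+x. epowr (H x) q \<partial>M) \<le> ennreal (B powr q) * (\<integral>\<^sup>+x. epowr (ennreal (h x)) q \<partial>M)"
        unfolding H_def B_def L_def by (rule K(2)[OF p2 \<delta> t finF]) simp
      also have "(\<integral>\<^sup>+x. epowr (ennreal (h x)) q \<partial>M) = X"
        unfolding X_def sqnorm_def
      proof (rule nn_integral_cong)
        fix x
        have "(p / 2 - 1) * q = p / 2" using p2 by (simp add: q_def field_simps)
        moreover have "epowr (ennreal (h x)) q = ennreal (sqsum n v x powr ((p / 2 - 1) * q))"
          using h by (simp add: h_def powr_powr)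
        ultimately show "epowr (ennreal (h x)) q = ennreal (sqsum n v x powr (p / 2))"
          by (simp only:)
      qed
      finally have "X \<le> ennreal ((2 * A * B) powr (p / 2)) * (\<integral>\<^sup>+x. epowr (ennreal (sqsum n g x)) (p / 2) \<partial>M)"
        using nn_integral_Young_absorb[OF _ _ q qc A B le _ Xfin] by simp
      also have "(\<integral>\<^sup>+x. epowr (ennreal (sqsum n g x)) (p / 2) \<partial>M) = sqnorm p n g"
        by (simp add: sqnorm_def)
      finally have "X \<le> ennreal ((2 * A * B) powr (p / 2)) * sqnorm p n g" .
      also have "\<dots> \<le> ennreal ((E * loss \<delta> * L\<^sup>2) powr p) * sqnorm p n g"
      proof (intro mult_right_mono ennreal_leI)
        have "sqrt (2 * N * K) \<le> E" using N(1) by (simp add: E_def)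
        then have "(sqrt (2 * N * K))\<^sup>2 \<le> E\<^sup>2" using N(1) K(1) by (intro power_mono) auto
        then have NE: "2 * N * K \<le> E\<^sup>2" using N(1) K(1) by simp
        have "2 * A * B = (2 * N * K) * ((loss \<delta>)\<^sup>2 * (L\<^sup>2)\<^sup>2)"
          by (simp add: A_def B_def power2_eq_square power3_eq_cube)
        also have "\<dots> \<le> E\<^sup>2 * ((loss \<delta>)\<^sup>2 * (L\<^sup>2)\<^sup>2)" using NE by (intro mult_right_mono) auto
        also have "\<dots> = (E * loss \<delta> * L\<^sup>2)\<^sup>2" by (simp only: power_mult_distrib mult.assoc)
        finally have "(2 * A * B) powr (p / 2) \<le> ((E * loss \<delta> * L\<^sup>2)\<^sup>2) powr (p / 2)"
          using A B p by (intro powr_mono2) auto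
        also have "\<dots> = ((E * loss \<delta> * L\<^sup>2) powr 2) powr (p / 2)"
        proof -
          have "0 < E * loss \<delta> * L\<^sup>2" using N(1) K(1) loss L by (simp add: E_def add_pos_nonneg)
          then show ?thesis by (simp add: powr_numeral)
        qed
        also have "\<dots> = (E * loss \<delta> * L\<^sup>2) powr p" by (simp only: powr_powr) simp
        finally show "(2 * A * B) powr (p / 2) \<le> (E * loss \<delta> * L\<^sup>2) powr p" .
      qed simp
      finally show ?thesis unfolding X_def L_def .
    qed
  qed
qed

text \<open>
  Duality with the conjugate exponent \<open>p' > 2\<close>. The family \<open>w k = v k (\<Sum>l. (v l)\<^sup>2)\<^bsup>p/2-1\<^esup>\<close> is extremal: its pairing with \<open>v\<close> and
  its norm are both given by \<open>X = sqnorm p n v\<close>. The pairing is at most that of \<open>g k\<close> with the operators applied to \<open>w k\<close>, by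
  symmetry, and these are controlled by the case already treated.
\<close>

lemma square_function_lt_2:
  assumes p: "1 < p" "p < 2"
  obtains E where "0 < E" "\<And>\<delta> t n j g v. 0 < \<delta> \<Longrightarrow> \<delta> \<le> 1 \<Longrightarrow> 0 < t \<Longrightarrow>
    dominated_family p \<delta> t n j g v \<Longrightarrow>
    sqnorm p n v \<le> ennreal ((E * loss \<delta> * (1 + \<bar>ln \<delta>\<bar>)\<^sup>2) powr p) * sqnorm p n g"
proof -
  define p' where "p' = p / (p - 1)"
  have p': "2 \<le> p'" "1 < p'" using p by (simp_all add: p'_def field_simps)
  have pc: "p = p' / (p' - 1)" using p by (simp add: p'_def field_simps)
  obtain E where E: "0 < E" "\<And>\<delta> t n j g v. 0 < \<delta> \<Longrightarrow> \<delta> \<le> 1 \<Longrightarrow> 0 < t \<Longrightarrow>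
    dominated_family p' \<delta> t n j g v \<Longrightarrow>
    sqnorm p' n v \<le> ennreal ((E * loss \<delta> * (1 + \<bar>ln \<delta>\<bar>)\<^sup>2) powr p') * sqnorm p' n g"
    using square_function_ge_2[OF p'(1)] by blast
  show ?thesis
  proof (rule that[of "2 * E"])
    show "0 < 2 * E" using E(1) by simp
    fix \<delta> t :: real and n :: nat and j :: "nat \<Rightarrow> int" and g v :: "nat \<Rightarrow> 'a \<Rightarrow> real"
    assume \<delta>: "0 < \<delta>" "\<delta> \<le> 1" and t: "0 < t"
      and fam: "dominated_family p \<delta> t n j g v"
    let ?T = "\<lambda>k. kop \<delta> (rad t (j k))"
    have [measurable]: "\<And>k. g k \<in> borel_measurable M" "\<And>k. v k \<in> borel_measurable M"
      and g: "\<And>k x. 0 \<le> g k x" and v: "\<And>k x. 0 \<le> v k x"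
      and dom: "\<And>k. k < n \<Longrightarrow> AE x in M. ennreal (v k x) \<le> ?T k (\<lambda>y. ennreal (g k y)) x"
      using fam unfolding dominated_family_def by auto
    define B where "B = E * loss \<delta> * (1 + \<bar>ln \<delta>\<bar>)\<^sup>2"
    have B: "0 < B" using E(1) loss_pos[OF \<delta>(1)] unfolding B_def by (intro mult_pos_pos zero_less_power) auto
    define X where "X = sqnorm p n v"
    have Xfin: "X < \<top>" unfolding X_def by (rule dominated_family_finite[OF p(1) \<delta> t fam])
    define w where "w k x = v k x * sqsum n v x powr (p / 2 - 1)" for k x
    have [measurable]: "w k \<in> borel_measurable M" for k unfolding w_def by measurable
    have w: "0 \<le> w k x" for k x using v by (simp add: w_def)
    have sqw: "sqsum n w x = sqsum n v x powr (p - 1)" for x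
    proof (cases "sqsum n v x = 0")
      case True
      then show ?thesis by (simp add: w_def sqsum_def)
    next
      case False
      then have pos: "0 < sqsum n v x" by (rule sqsum_pos)
      have "sqsum n w x = sqsum n v x * (sqsum n v x powr (p / 2 - 1))\<^sup>2"
        by (simp add: sqsum_def[of n w] w_def power_mult_distrib sum_distrib_right[symmetric]) (simp add: sqsum_def)
      also have "(sqsum n v x powr (p / 2 - 1))\<^sup>2 = sqsum n v x powr (p - 2)"
        by (simp add: power2_eq_square powr_add[symmetric])
      also have "sqsum n v x * sqsum n v x powr (p - 2) = sqsum n v x powr (p - 1)"
        using powr_mult_base[of "sqsum n v x" "p - 2"] pos by simp
      finally show ?thesis .
    qed
    have pp': "(p - 1) * (p' / 2) = p / 2" using p by (simp add: p'_def field_simps)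
    have wX: "sqnorm p' n w = X"
      unfolding sqnorm_def X_def sqw by (simp only: powr_powr pp')
    have wfin: "(\<integral>\<^sup>+x. ennreal (w k x powr p') \<partial>M) < \<top>" if k: "k < n" for k
    proof -
      have "(\<integral>\<^sup>+x. ennreal (w k x powr p') \<partial>M) \<le> sqnorm p' n w"
        unfolding sqnorm_def
      proof (intro nn_integral_mono ennreal_leI)
        fix x
        have "(w k x)\<^sup>2 \<le> sqsum n w x"
          unfolding sqsum_def using k by (intro member_le_sum) auto
        then have "((w k x)\<^sup>2) powr (p' / 2) \<le> sqsum n w x powr (p' / 2)" using p' by (intro powr_mono2) auto
        moreover have "((w k x)\<^sup>2) powr (p' / 2) = (w k x powr 2) powr (p' / 2)" using w by (simp add: powr_numeral)
        ultimately show "w k x powr p' \<le> sqsum n w x powr (p' / 2)" by (simp add: powr_powr)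
      qed
      then show ?thesis using wX Xfin by simp
    qed
    \<comment> \<open>The operators applied to \<open>w k\<close> are finite almost everywhere; \<open>z k\<close> is the real-valued version.\<close>
    define z where "z k x = enn2real (?T k (\<lambda>y. ennreal (w k y)) x)" for k x
    have [measurable]: "z k \<in> borel_measurable M" for k unfolding z_def by measurable
    have z: "0 \<le> z k x" for k x by (simp add: z_def)
    have zeq: "AE x in M. ?T k (\<lambda>y. ennreal (w k y)) x = ennreal (z k x)" if k: "k < n" for k
    proof -
      have "(\<integral>\<^sup>+x. epowr (?T k (\<lambda>y. ennreal (w k y)) x) p' \<partial>M) < \<top>"
        using wfin[OF k] w by (intro kop_Lp_finite[OF p'(2) \<delta> t]) simp_all
      then have "AE x in M. epowr (?T k (\<lambda>y. ennreal (w k y)) x) p' \<noteq> \<infinity>"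
        by (intro nn_integral_PInf_AE) auto
      then show ?thesis
      proof eventually_elim
        case (elim x)
        then show ?case by (cases "?T k (\<lambda>y. ennreal (w k y)) x") (auto simp: z_def)
      qed
    qed
    have znorm: "sqnorm p' n z \<le> ennreal (B powr p') * X"
      unfolding wX[symmetric] B_def
    proof (rule E(2)[OF \<delta> t])
      have "AE x in M. ennreal (z k x) \<le> ?T k (\<lambda>y. ennreal (w k y)) x" if "k < n" for k
        using zeq[OF that] by eventually_elim simp
      then show "dominated_family p' \<delta> t n j w z" unfolding dominated_family_def using w z wfin by auto
    qed
    have "X = (\<integral>\<^sup>+x. (\<Sum>k<n. ennreal (v k x) * ennreal (w k x)) \<partial>M)"
      unfolding X_def sqnorm_def
    proof (rule nn_integral_cong)
      fix x
      have "sqsum n v x powr (p / 2) = sqsum n v x * sqsum n v x powr (p / 2 - 1)"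
      proof (cases "sqsum n v x = 0")
        case False
        then have "0 < sqsum n v x" by (rule sqsum_pos)
        then show ?thesis using powr_mult_base[of "sqsum n v x" "p / 2 - 1"] by simp
      qed simp
      also have "\<dots> = (\<Sum>k<n. v k x * w k x)"
        by (simp add: sqsum_def[of n v x] w_def sum_distrib_right power2_eq_square mult.assoc)
      finally show "ennreal (sqsum n v x powr (p / 2)) = (\<Sum>k<n. ennreal (v k x) * ennreal (w k x))"
        using v w by (simp add: ennreal_mult[symmetric])
    qed
    also have "\<dots> = (\<Sum>k<n. \<integral>\<^sup>+x. ennreal (v k x) * ennreal (w k x) \<partial>M)"
      by (rule nn_integral_sum) simp
    also have "\<dots> \<le> (\<Sum>k<n. \<integral>\<^sup>+x. ennreal (g k x) * ennreal (z k x) \<partial>M)"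
    proof (rule sum_mono)
      fix k assume "k \<in> {..<n}"
      then have k: "k < n" by simp
      have "AE x in M. ennreal (v k x) * ennreal (w k x) \<le> ?T k (\<lambda>y. ennreal (g k y)) x * ennreal (w k x)"
        using dom[OF k] by eventually_elim (rule mult_right_mono, auto)
      then have "(\<integral>\<^sup>+x. ennreal (v k x) * ennreal (w k x) \<partial>M) \<le> (\<integral>\<^sup>+x. ?T k (\<lambda>y. ennreal (g k y)) x * ennreal (w k x) \<partial>M)"
        by (rule nn_integral_mono_AE)
      also have "\<dots> = (\<integral>\<^sup>+x. ennreal (g k x) * ?T k (\<lambda>y. ennreal (w k y)) x \<partial>M)"
        by (rule kop_symmetric) simp_all
      also have "\<dots> = (\<integral>\<^sup>+x. ennreal (g k x) * ennreal (z k x) \<partial>M)"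
        using zeq[OF k] by (intro nn_integral_cong_AE) (auto elim!: eventually_mono)
      finally show "(\<integral>\<^sup>+x. ennreal (v k x) * ennreal (w k x) \<partial>M) \<le> \<dots>" .
    qed
    also have "\<dots> = (\<integral>\<^sup>+x. (\<Sum>k<n. ennreal (g k x) * ennreal (z k x)) \<partial>M)"
      by (rule nn_integral_sum[symmetric]) simp
    also have "\<dots> \<le> (\<integral>\<^sup>+x. ennreal (sqrt (sqsum n g x)) * ennreal (sqrt (sqsum n z x)) \<partial>M)"
    proof (rule nn_integral_mono)
      fix x
      have "(\<Sum>k<n. g k x * z k x)\<^sup>2 \<le> sqsum n g x * sqsum n z x"
        unfolding sqsum_def by (rule Cauchy_Schwarz_ineq_sum)
      then have "(\<Sum>k<n. g k x * z k x) \<le> sqrt (sqsum n g x) * sqrt (sqsum n z x)"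
        unfolding real_sqrt_mult[symmetric] by (rule real_le_rsqrt)
      then have "ennreal (\<Sum>k<n. g k x * z k x) \<le> ennreal (sqrt (sqsum n g x) * sqrt (sqsum n z x))" by (rule ennreal_leI)
      then show "(\<Sum>k<n. ennreal (g k x) * ennreal (z k x)) \<le> ennreal (sqrt (sqsum n g x)) * ennreal (sqrt (sqsum n z x))"
        using g z by (simp add: ennreal_mult[symmetric])
    qed
    finally have main: "X \<le> ennreal 1 * (\<integral>\<^sup>+x. ennreal (sqrt (sqsum n g x)) * ennreal (sqrt (sqsum n z x)) \<partial>M)" by simp
    have root: "epowr (ennreal (sqrt (sqsum n u x))) s = ennreal (sqsum n u x powr (s / 2))" for u s x
      by (simp add: powr_half_sqrt[symmetric] powr_powr)
    have "X \<le> ennreal ((2 * 1 * B) powr p) * (\<integral>\<^sup>+x. epowr (ennreal (sqrt (sqsum n g x))) p \<partial>M)"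
      using nn_integral_Young_absorb[OF _ _ p'(2) pc _ B main _ Xfin] znorm
      unfolding root sqnorm_def by simp
    also have "\<dots> = ennreal ((2 * E * loss \<delta> * (1 + \<bar>ln \<delta>\<bar>)\<^sup>2) powr p) * sqnorm p n g"
      unfolding root by (simp add: sqnorm_def B_def mult.assoc)
    finally show "sqnorm p n v \<le> ennreal ((2 * E * loss \<delta> * (1 + \<bar>ln \<delta>\<bar>)\<^sup>2) powr p) * sqnorm p n g"
      unfolding X_def .
  qed
qed

lemma square_function_bound:
  assumes p: "1 < p"
  obtains E where "0 < E" "\<And>\<delta> t n j g v. 0 < \<delta> \<Longrightarrow> \<delta> \<le> 1 \<Longrightarrow> 0 < t \<Longrightarrow>
    dominated_family p \<delta> t n j g v \<Longrightarrow>
    sqnorm p n v \<le> ennreal ((E * loss \<delta> * (1 + \<bar>ln \<delta>\<bar>)\<^sup>2) powr p) * sqnorm p n g"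
proof (cases "p < 2")
  case True
  show ?thesis using square_function_lt_2[OF p True] that by blast
next
  case False
  then have "2 \<le> p" by simp
  show ?thesis using square_function_ge_2[OF \<open>2 \<le> p\<close>] that by blast
qed

end

section \<open>Rademacher averages\<close>

lemma finite_set_rademacher: "finite (set_pmf (rademacher n))"
  unfolding rademacher_def by (rule finite_subset[OF set_Pi_pmf_subset']) (auto intro!: finite_PiE_dflt)

lemma integrable_rademacher [simp]: "integrable (measure_pmf (rademacher n)) (F :: _ \<Rightarrow> real)"
  by (rule integrable_measure_pmf_finite) (rule finite_set_rademacher)

lemma rademacher_expectation_sum:
  "measure_pmf.expectation (rademacher n) (F :: _ \<Rightarrow> real) = (\<Sum>\<epsilon>\<in>set_pmf (rademacher n). pmf (rademacher n) \<epsilon> * F \<epsilon>)"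
  by (subst integral_measure_pmf[OF finite_set_rademacher]) auto

lemma rademacher_expectation_0: "measure_pmf.expectation (rademacher 0) F = F (\<lambda>_. 0)"
  for F :: "_ \<Rightarrow> real"
  by (simp add: rademacher_def)

text \<open>
  Conditioning on the last sign; this turns statements on Rademacher sums into inductions.
\<close>

lemma rademacher_expectation_Suc:
  fixes F :: "(nat \<Rightarrow> real) \<Rightarrow> real"
  shows "measure_pmf.expectation (rademacher (Suc n)) F =
    (measure_pmf.expectation (rademacher n) (\<lambda>\<epsilon>. F (\<epsilon>(n := 1)))
     + measure_pmf.expectation (rademacher n) (\<lambda>\<epsilon>. F (\<epsilon>(n := - 1)))) / 2"
proof -
  have "rademacher (Suc n) = pmf_of_set {- 1, 1} \<bind> (\<lambda>y. map_pmf (\<lambda>\<epsilon>. \<epsilon>(n := y)) (rademacher n))"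
    unfolding rademacher_def lessThan_Suc
    by (subst Pi_pmf_insert') (auto simp: map_pmf_def)
  then have "measure_pmf.expectation (rademacher (Suc n)) F =
    (\<Sum>y\<in>{- 1, 1}. measure_pmf.expectation (map_pmf (\<lambda>\<epsilon>. \<epsilon>(n := y)) (rademacher n)) F /\<^sub>R real (card {- 1 :: real, 1}))"
    by (simp only:) (rule pmf_expectation_bind_pmf_of_set, auto simp: finite_set_rademacher)
  then show ?thesis by (simp add: field_simps)
qed

definition rsum :: "nat \<Rightarrow> (nat \<Rightarrow> 'b::real_vector) \<Rightarrow> (nat \<Rightarrow> real) \<Rightarrow> 'b" where
  "rsum n a \<epsilon> = (\<Sum>k<n. \<epsilon> k *\<^sub>R a k)"

lemma rsum_0 [simp]: "rsum 0 a \<epsilon> = 0"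
  by (simp add: rsum_def)

lemma rsum_Suc_upd [simp]: "rsum (Suc n) a (\<epsilon>(n := y)) = rsum n a \<epsilon> + y *\<^sub>R a n"
  unfolding rsum_def by (simp add: sum.lessThan_Suc)

text \<open>
  The parallelogram identity, once for every sign. The offset \<open>b\<close> serves the induction.
\<close>

lemma rademacher_second_moment:
  fixes a :: "nat \<Rightarrow> 'b::real_inner"
  shows "measure_pmf.expectation (rademacher n) (\<lambda>\<epsilon>. (norm (b + rsum n a \<epsilon>))\<^sup>2) = (norm b)\<^sup>2 + (\<Sum>k<n. (norm (a k))\<^sup>2)"
proof (induction n arbitrary: b)
  case (Suc n)
  have "measure_pmf.expectation (rademacher (Suc n)) (\<lambda>\<epsilon>. (norm (b + rsum (Suc n) a \<epsilon>))\<^sup>2)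
    = (measure_pmf.expectation (rademacher n) (\<lambda>\<epsilon>. (norm ((b + a n) + rsum n a \<epsilon>))\<^sup>2)
      + measure_pmf.expectation (rademacher n) (\<lambda>\<epsilon>. (norm ((b - a n) + rsum n a \<epsilon>))\<^sup>2)) / 2"
    by (simp add: rademacher_expectation_Suc algebra_simps)
  also have "\<dots> = ((norm (b + a n))\<^sup>2 + (norm (b - a n))\<^sup>2) / 2 + (\<Sum>k<n. (norm (a k))\<^sup>2)"
    unfolding Suc.IH by (simp add: field_simps)
  also have "(norm (b + a n))\<^sup>2 + (norm (b - a n))\<^sup>2 = 2 * (norm b)\<^sup>2 + 2 * (norm (a n))\<^sup>2"
    by (simp add: power2_norm_eq_inner inner_simps inner_commute)
  finally show ?case by simp
qed (simp add: rademacher_expectation_0)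

text \<open>
  Hoeffding's lemma for a symmetric sign.
\<close>

lemma cosh_le_exp_half_square: "(exp x + exp (- x)) / 2 \<le> exp (x\<^sup>2 / 2)" for x :: real
proof -
  have pos: "(exp y + exp (- y)) / 2 \<le> exp (y\<^sup>2 / 2)" if y: "0 \<le> y" for y :: real
  proof -
    have "- (2 * y) * (1/2) + ln (1 + 1/2 * (exp (2 * y) - 1)) \<le> (2 * y)\<^sup>2 / 8"
      using Hoeffdings_lemma_aux[of "2 * y" "1/2"] y by simp
    then have "ln (1 + 1/2 * (exp (2 * y) - 1)) \<le> y + y\<^sup>2 / 2" by (simp add: power2_eq_square)
    moreover have "0 < 1 + 1/2 * (exp (2 * y) - 1)" by (simp add: field_simps add_pos_pos)
    ultimately have "1 + 1/2 * (exp (2 * y) - 1) \<le> exp (y + y\<^sup>2 / 2)" by (metis exp_le_cancel_iff exp_ln)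
    then have "exp (- y) * (1 + 1/2 * (exp (2 * y) - 1)) \<le> exp (- y) * exp (y + y\<^sup>2 / 2)" by (intro mult_left_mono) auto
    also have "\<dots> = exp (y\<^sup>2 / 2)" by (simp add: exp_add[symmetric])
    also have "exp (- y) * (1 + 1/2 * (exp (2 * y) - 1)) = (exp y + exp (- y)) / 2"
      by (simp add: algebra_simps exp_add[symmetric] exp_minus_inverse mult_exp_exp)
    finally show ?thesis .
  qed
  show ?thesis using pos[of "\<bar>x\<bar>"] by (cases "0 \<le> x") (auto simp: add.commute)
qed

lemma rademacher_exp_le:
  fixes a :: "nat \<Rightarrow> real"
  shows "measure_pmf.expectation (rademacher n) (\<lambda>\<epsilon>. exp (rsum n a \<epsilon>)) \<le> exp ((\<Sum>k<n. (a k)\<^sup>2) / 2)"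
proof (induction n)
  case (Suc n)
  let ?E = "measure_pmf.expectation (rademacher n) (\<lambda>\<epsilon>. exp (rsum n a \<epsilon>))"
  have "measure_pmf.expectation (rademacher (Suc n)) (\<lambda>\<epsilon>. exp (rsum (Suc n) a \<epsilon>)) = ?E * ((exp (a n) + exp (- a n)) / 2)"
    by (simp add: rademacher_expectation_Suc exp_add exp_diff exp_minus field_simps)
  also have "\<dots> \<le> exp ((\<Sum>k<n. (a k)\<^sup>2) / 2) * exp ((a n)\<^sup>2 / 2)"
    by (intro mult_mono Suc.IH cosh_le_exp_half_square) (auto intro!: add_nonneg_nonneg)
  finally show ?case by (simp add: exp_add[symmetric] add_divide_distrib)
qed (simp add: rademacher_expectation_0)

lemma powr_le_fact_exp:
  fixes s p :: real
  assumes s: "0 \<le> s" and p: "0 < p"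
  shows "s powr p \<le> fact (nat \<lceil>p\<rceil>) * exp s"
proof (cases "s \<le> 1")
  case True
  then have "s powr p \<le> 1 powr p" using s p by (intro powr_mono2) auto
  also have "\<dots> \<le> 1 * exp s" using s by simp
  also have "\<dots> \<le> fact (nat \<lceil>p\<rceil>) * exp s" by (intro mult_right_mono) auto
  finally show ?thesis .
next
  case False
  let ?m = "nat \<lceil>p\<rceil>"
  have "s powr p \<le> s powr real ?m" using False by (intro powr_mono) linarith+
  also have "\<dots> = s ^ ?m" using False by (intro powr_realpow) auto
  also have "\<dots> = fact ?m * (s ^ ?m /\<^sub>R fact ?m)" by simp
  also have "s ^ ?m /\<^sub>R fact ?m \<le> exp s"
  proof -
    have "sum (\<lambda>k. s ^ k /\<^sub>R fact k) {?m} \<le> (\<Sum>k. s ^ k /\<^sub>R fact k)"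
      by (rule sum_le_suminf[OF summable_exp_generic]) (use s in auto)
    then show ?thesis by (simp add: exp_def)
  qed
  finally show ?thesis by (simp add: mult_left_mono)
qed

text \<open>
  Normalised to \<open>\<Sum>k. (a k)\<^sup>2 = 1\<close>, a Rademacher sum is sub-Gaussian, and exponential moments bound all others.
\<close>

lemma Khintchine_upper_real:
  fixes a :: "nat \<Rightarrow> real"
  assumes p: "0 < p"
  shows "measure_pmf.expectation (rademacher n) (\<lambda>\<epsilon>. \<bar>rsum n a \<epsilon>\<bar> powr p)
    \<le> (fact (nat \<lceil>p\<rceil>) * (2 * exp (1/2))) * (\<Sum>k<n. (a k)\<^sup>2) powr (p / 2)"
proof (cases "(\<Sum>k<n. (a k)\<^sup>2) = 0")
  case True
  then have "a k = 0" if "k < n" for k using that by (simp add: sum_nonneg_eq_0_iff)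
  then have "rsum n a \<epsilon> = 0" for \<epsilon> by (simp add: rsum_def)
  then show ?thesis using True p by simp
next
  case False
  define S where "S = (\<Sum>k<n. (a k)\<^sup>2)"
  have S: "0 < S" using False unfolding S_def by (simp add: sum_nonneg less_le)
  define u where "u = sqrt S"
  have u: "0 < u" "u\<^sup>2 = S" using S by (simp_all add: u_def)
  define b where "b k = a k / u" for k
  have ab: "rsum n a \<epsilon> = u * rsum n b \<epsilon>" for \<epsilon>
    unfolding rsum_def b_def sum_distrib_left using u by (intro sum.cong) auto
  have sb: "(\<Sum>k<n. (b k)\<^sup>2) = 1"
    using S u by (simp add: b_def power_divide sum_divide_distrib[symmetric] S_def[symmetric])
  let ?c = "fact (nat \<lceil>p\<rceil>) :: real"
  have pt: "\<bar>s\<bar> powr p \<le> ?c * (exp s + exp (- s))" for s :: real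
  proof -
    have "\<bar>s\<bar> powr p \<le> ?c * exp \<bar>s\<bar>" using p by (intro powr_le_fact_exp) auto
    also have "\<dots> \<le> ?c * (exp s + exp (- s))" by (intro mult_left_mono) (auto simp: abs_if)
    finally show ?thesis .
  qed
  have neg: "rsum n (\<lambda>k. - b k) \<epsilon> = - rsum n b \<epsilon>" for \<epsilon> by (simp add: rsum_def sum_negf)
  have "measure_pmf.expectation (rademacher n) (\<lambda>\<epsilon>. \<bar>rsum n b \<epsilon>\<bar> powr p)
    \<le> measure_pmf.expectation (rademacher n) (\<lambda>\<epsilon>. ?c * (exp (rsum n b \<epsilon>) + exp (rsum n (\<lambda>k. - b k) \<epsilon>)))"
    unfolding neg by (intro integral_mono pt) simp_all
  also have "\<dots> = ?c * (measure_pmf.expectation (rademacher n) (\<lambda>\<epsilon>. exp (rsum n b \<epsilon>)) + measure_pmf.expectation (rademacher n) (\<lambda>\<epsilon>. exp (rsum n (\<lambda>k. - b k) \<epsilon>)))"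
    by simp
  also have "\<dots> \<le> ?c * (exp (1/2) + exp (1/2))"
    using rademacher_exp_le[of n b] rademacher_exp_le[of n "\<lambda>k. - b k"] sb
    by (intro mult_left_mono add_mono) simp_all
  finally have E: "measure_pmf.expectation (rademacher n) (\<lambda>\<epsilon>. \<bar>rsum n b \<epsilon>\<bar> powr p) \<le> ?c * (2 * exp (1/2))" by simp
  have "measure_pmf.expectation (rademacher n) (\<lambda>\<epsilon>. \<bar>rsum n a \<epsilon>\<bar> powr p) = u powr p * measure_pmf.expectation (rademacher n) (\<lambda>\<epsilon>. \<bar>rsum n b \<epsilon>\<bar> powr p)"
    unfolding ab using u by (simp add: abs_mult powr_mult)
  also have "\<dots> \<le> u powr p * (?c * (2 * exp (1/2)))" using E by (intro mult_left_mono) auto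
  also have "u powr p = S powr (p / 2)" using S by (simp add: u_def powr_half_sqrt[symmetric] powr_powr)
  finally show ?thesis by (simp add: S_def mult_ac)
qed

lemma add_powr_le: "0 \<le> a \<Longrightarrow> 0 \<le> b \<Longrightarrow> 0 < p \<Longrightarrow> (a + b) powr p \<le> 2 powr p * (a powr p + b powr p)" for a b p :: real
proof -
  assume ab: "0 \<le> a" "0 \<le> b" and p: "0 < p"
  have "(a + b) powr p \<le> (2 * max a b) powr p" using ab p by (intro powr_mono2) auto
  also have "\<dots> = 2 powr p * max a b powr p" using ab by (simp add: powr_mult)
  also have "max a b powr p \<le> a powr p + b powr p" by (simp add: max_def)
  finally show ?thesis by simp
qed

lemma Khintchine_upper:
  assumes p: "0 < p"
  obtains C where "0 < C" "\<And>n (a :: nat \<Rightarrow> complex).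
    measure_pmf.expectation (rademacher n) (\<lambda>\<epsilon>. norm (rsum n a \<epsilon>) powr p) \<le> C * (\<Sum>k<n. (norm (a k))\<^sup>2) powr (p / 2)"
proof -
  let ?c = "fact (nat \<lceil>p\<rceil>) * (2 * exp (1/2)) :: real"
  show ?thesis
  proof (rule that[of "2 powr p * (2 * ?c)"])
    show "0 < 2 powr p * (2 * ?c)" by simp
    fix n and a :: "nat \<Rightarrow> complex"
    let ?S = "(\<Sum>k<n. (norm (a k))\<^sup>2) powr (p / 2)"
    have re: "Re (rsum n a \<epsilon>) = rsum n (\<lambda>k. Re (a k)) \<epsilon>" "Im (rsum n a \<epsilon>) = rsum n (\<lambda>k. Im (a k)) \<epsilon>" for \<epsilon>
      by (simp_all add: rsum_def)
    have "norm (rsum n a \<epsilon>) powr p \<le> 2 powr p * (\<bar>rsum n (\<lambda>k. Re (a k)) \<epsilon>\<bar> powr p + \<bar>rsum n (\<lambda>k. Im (a k)) \<epsilon>\<bar> powr p)" for \<epsilon>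
    proof -
      have "norm (rsum n a \<epsilon>) powr p \<le> (\<bar>Re (rsum n a \<epsilon>)\<bar> + \<bar>Im (rsum n a \<epsilon>)\<bar>) powr p"
        using p by (intro powr_mono2 cmod_le) auto
      also have "\<dots> \<le> 2 powr p * (\<bar>Re (rsum n a \<epsilon>)\<bar> powr p + \<bar>Im (rsum n a \<epsilon>)\<bar> powr p)"
        using p by (intro add_powr_le) auto
      finally show ?thesis by (simp only: re)
    qed
    then have "measure_pmf.expectation (rademacher n) (\<lambda>\<epsilon>. norm (rsum n a \<epsilon>) powr p)
      \<le> measure_pmf.expectation (rademacher n) (\<lambda>\<epsilon>. 2 powr p * (\<bar>rsum n (\<lambda>k. Re (a k)) \<epsilon>\<bar> powr p + \<bar>rsum n (\<lambda>k. Im (a k)) \<epsilon>\<bar> powr p))"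
      by (intro integral_mono) simp_all
    also have "\<dots> = 2 powr p * (measure_pmf.expectation (rademacher n) (\<lambda>\<epsilon>. \<bar>rsum n (\<lambda>k. Re (a k)) \<epsilon>\<bar> powr p)
      + measure_pmf.expectation (rademacher n) (\<lambda>\<epsilon>. \<bar>rsum n (\<lambda>k. Im (a k)) \<epsilon>\<bar> powr p))"
      by simp
    also have "\<dots> \<le> 2 powr p * (?c * ?S + ?c * ?S)"
    proof (rule mult_left_mono[OF add_mono])
      have S: "(\<Sum>k<n. (Re (a k))\<^sup>2) powr (p / 2) \<le> ?S" "(\<Sum>k<n. (Im (a k))\<^sup>2) powr (p / 2) \<le> ?S"
        using p by (auto intro!: powr_mono2 sum_mono sum_nonneg simp: cmod_power2)
      show "measure_pmf.expectation (rademacher n) (\<lambda>\<epsilon>. \<bar>rsum n (\<lambda>k. Re (a k)) \<epsilon>\<bar> powr p) \<le> ?c * ?S"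
        by (rule order_trans[OF Khintchine_upper_real[OF p] mult_left_mono[OF S(1)]]) simp
      show "measure_pmf.expectation (rademacher n) (\<lambda>\<epsilon>. \<bar>rsum n (\<lambda>k. Im (a k)) \<epsilon>\<bar> powr p) \<le> ?c * ?S"
        by (rule order_trans[OF Khintchine_upper_real[OF p] mult_left_mono[OF S(2)]]) simp
    qed simp
    finally show "measure_pmf.expectation (rademacher n) (\<lambda>\<epsilon>. norm (rsum n a \<epsilon>) powr p) \<le> 2 powr p * (2 * ?c) * ?S" by simp
  qed
qed

text \<open>
  The second moment is known exactly. It is bounded by the \<open>p\<close>-th and the fourth moment through
  \<open>s\<^sup>2 \<le> R\<^bsup>2-p\<^esup> s\<^sup>p + s\<^sup>4 / R\<^sup>2\<close>, and \<open>R\<close> is so large that the fourth moment takes up only half of it.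
\<close>

lemma Khintchine_lower:
  assumes p: "0 < p" "p < 2"
  obtains C where "0 < C" "\<And>n (a :: nat \<Rightarrow> complex).
    (\<Sum>k<n. (norm (a k))\<^sup>2) powr (p / 2) \<le> C * measure_pmf.expectation (rademacher n) (\<lambda>\<epsilon>. norm (rsum n a \<epsilon>) powr p)"
proof -
  obtain B where B: "0 < B" "\<And>n (a :: nat \<Rightarrow> complex).
    measure_pmf.expectation (rademacher n) (\<lambda>\<epsilon>. norm (rsum n a \<epsilon>) powr 4) \<le> B * (\<Sum>k<n. (norm (a k))\<^sup>2) powr (4 / 2)"
    using Khintchine_upper[of 4] by auto
  let ?C = "2 * (2 * B) powr ((2 - p) / 2)"
  show ?thesis
  proof (rule that[of ?C])
    show "0 < ?C" using B by simp
    fix n and a :: "nat \<Rightarrow> complex"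
    let ?X = "\<lambda>\<epsilon>. norm (rsum n a \<epsilon>)"
    let ?E = "\<lambda>F. measure_pmf.expectation (rademacher n) F"
    define S where "S = (\<Sum>k<n. (norm (a k))\<^sup>2)"
    show "S powr (p / 2) \<le> ?C * ?E (\<lambda>\<epsilon>. ?X \<epsilon> powr p)"
    proof (cases "S = 0")
      case True
      then show ?thesis using B by simp
    next
      case False
      then have S: "0 < S" unfolding S_def by (simp add: sum_nonneg less_le)
      define R where "R = sqrt (2 * B * S)"
      have R: "0 < R" "R\<^sup>2 = 2 * B * S" using B S by (simp_all add: R_def)
      have pt: "s\<^sup>2 \<le> R powr (2 - p) * s powr p + s powr 4 / R\<^sup>2" if s: "0 \<le> s" for s :: real
      proof (cases "s \<le> R")
        case True
        have "s\<^sup>2 = s powr (2 - p) * s powr p"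
          using s by (cases "s = 0") (auto simp: powr_add[symmetric] powr_numeral)
        also have "\<dots> \<le> R powr (2 - p) * s powr p" using s True p by (intro mult_right_mono powr_mono2) auto
        finally show ?thesis by (simp add: add_increasing2)
      next
        case False
        have "s\<^sup>2 * R\<^sup>2 \<le> s\<^sup>2 * s\<^sup>2" using False R by (intro mult_left_mono power_mono) auto
        also have "s\<^sup>2 * s\<^sup>2 = s powr 4" using s False R by (simp add: powr_numeral power2_eq_square power4_eq_xxxx)
        finally have "s\<^sup>2 \<le> s powr 4 / R\<^sup>2" using zero_less_power[OF R(1), of 2] by (simp only: pos_le_divide_eq)
        then show ?thesis by (simp add: add_increasing)
      qed
      have "S = ?E (\<lambda>\<epsilon>. (?X \<epsilon>)\<^sup>2)"
        using rademacher_second_moment[of n 0 a] by (simp add: S_def)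
      also have "\<dots> \<le> ?E (\<lambda>\<epsilon>. R powr (2 - p) * ?X \<epsilon> powr p + ?X \<epsilon> powr 4 / R\<^sup>2)"
        by (intro integral_mono pt) simp_all
      also have "\<dots> = R powr (2 - p) * ?E (\<lambda>\<epsilon>. ?X \<epsilon> powr p) + ?E (\<lambda>\<epsilon>. ?X \<epsilon> powr 4) / R\<^sup>2"
        by simp
      also have "?E (\<lambda>\<epsilon>. ?X \<epsilon> powr 4) / R\<^sup>2 \<le> B * S\<^sup>2 / R\<^sup>2"
        using B(2)[of n a] S by (intro divide_right_mono) (auto simp: S_def powr_numeral)
      also have "B * S\<^sup>2 / R\<^sup>2 = S / 2" using B S unfolding R by (simp add: power2_eq_square)
      finally have half: "S / 2 \<le> R powr (2 - p) * ?E (\<lambda>\<epsilon>. ?X \<epsilon> powr p)" by simp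
      have "R powr (2 - p) = (2 * B) powr ((2 - p) / 2) * S powr ((2 - p) / 2)"
        using B S by (simp add: R_def powr_half_sqrt[symmetric] powr_powr powr_mult)
      with half have "S \<le> S powr ((2 - p) / 2) * (?C * ?E (\<lambda>\<epsilon>. ?X \<epsilon> powr p))" by (simp add: mult_ac)
      moreover have "S = S powr ((2 - p) / 2) * S powr (p / 2)"
        using S by (simp add: powr_add[symmetric] add_divide_distrib[symmetric])
      ultimately have "S powr ((2 - p) / 2) * S powr (p / 2) \<le> S powr ((2 - p) / 2) * (?C * ?E (\<lambda>\<epsilon>. ?X \<epsilon> powr p))"
        by linarith
      then show ?thesis using S by (subst (asm) mult_le_cancel_left_pos) auto
    qed
  qed
qed

section \<open>Randomised norms and square functions\<close>

text \<open>
  A substitute for the tangent of \<open>h\<^sup>s\<close>: it holds with an additive \<open>a\<close> and constant one, and yields Jensen's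
  inequality up to a factor \<open>2\<close>.
\<close>

lemma linear_le_powr:
  fixes a h s :: real
  assumes a: "0 < a" and h: "0 \<le> h" and s: "1 \<le> s"
  shows "h \<le> a + a powr (1 - s) * h powr s"
proof (cases "h \<le> a")
  case False
  then have h0: "0 < h" using a by simp
  have "h = h powr (1 - s) * h powr s" using h0 by (simp add: powr_add[symmetric])
  also have "\<dots> \<le> a powr (1 - s) * h powr s" using False a s by (intro mult_right_mono powr_mono2') auto
  finally show ?thesis using a by simp
qed (simp add: add_increasing2)

text \<open>
  Jensen's inequality for the weights \<open>w i * c i\<close> and the values \<open>h i / c i\<close>, up to the factor \<open>2\<close>: sum
  \<open>linear_le_powr\<close> with \<open>a\<close> half of the mean.
\<close>

lemma weighted_power_mean:
  fixes w c h :: "'i \<Rightarrow> real"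
  assumes s: "1 \<le> s" and S: "finite S" and w: "\<And>i. i \<in> S \<Longrightarrow> 0 \<le> w i" and c: "\<And>i. i \<in> S \<Longrightarrow> 0 < c i"
    and h: "\<And>i. i \<in> S \<Longrightarrow> 0 \<le> h i" and C: "0 < C" "(\<Sum>i\<in>S. w i * c i) = C"
  shows "((\<Sum>i\<in>S. w i * h i) / 2) powr s \<le> C powr (s - 1) * (\<Sum>i\<in>S. w i * (c i powr (1 - s) * h i powr s))"
proof -
  define X where "X = (\<Sum>i\<in>S. w i * h i)"
  show ?thesis
  proof (cases "X = 0")
    case True
    then show ?thesis using C w c unfolding X_def by (auto intro!: mult_nonneg_nonneg sum_nonneg)
  next
    case False
    then have X: "0 < X" unfolding X_def using w h by (simp add: less_le sum_nonneg)
    define a where "a = X / (2 * C)"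
    have a: "0 < a" using X C by (simp add: a_def)
    have "X \<le> (\<Sum>i\<in>S. w i * (a * c i + (a * c i) powr (1 - s) * h i powr s))"
      unfolding X_def using a c w h s by (intro sum_mono mult_left_mono linear_le_powr) auto
    also have "\<dots> = a * C + a powr (1 - s) * (\<Sum>i\<in>S. w i * (c i powr (1 - s) * h i powr s))"
    proof -
      have "w i * (a * c i + (a * c i) powr (1 - s) * h i powr s) = a * (w i * c i) + a powr (1 - s) * (w i * (c i powr (1 - s) * h i powr s))"
        if "i \<in> S" for i using c[OF that] a by (simp add: powr_mult algebra_simps)
      then show ?thesis by (simp add: sum.distrib sum_distrib_left[symmetric] C(2))
    qed
    also have "a * C = X / 2" using C by (simp add: a_def)
    finally have "X / 2 \<le> a powr (1 - s) * (\<Sum>i\<in>S. w i * (c i powr (1 - s) * h i powr s))" by simp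
    then have "a powr (s - 1) * (X / 2) \<le> a powr (s - 1) * (a powr (1 - s) * (\<Sum>i\<in>S. w i * (c i powr (1 - s) * h i powr s)))"
      by (intro mult_left_mono) auto
    also have "\<dots> = (\<Sum>i\<in>S. w i * (c i powr (1 - s) * h i powr s))"
      using a by (simp add: mult.assoc[symmetric] powr_add[symmetric])
    finally have "C powr (s - 1) * (a powr (s - 1) * (X / 2)) \<le> C powr (s - 1) * (\<Sum>i\<in>S. w i * (c i powr (1 - s) * h i powr s))"
      by (intro mult_left_mono) auto
    also have "C powr (s - 1) * (a powr (s - 1) * (X / 2)) = (C * a) powr (s - 1) * (X / 2)"
      using C a by (simp add: powr_mult)
    also have "\<dots> = (X / 2) powr s"
      using X C powr_mult_base[of "X / 2" "s - 1"] by (simp add: a_def mult.commute)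
    finally show ?thesis unfolding X_def .
  qed
qed

lemma rademacher_power_mean:
  fixes h :: "(nat \<Rightarrow> real) \<Rightarrow> real" and s :: real
  assumes s: "1 \<le> s" and h: "\<And>\<epsilon>. 0 \<le> h \<epsilon>"
  shows "measure_pmf.expectation (rademacher n) h \<le> 2 * (measure_pmf.expectation (rademacher n) (\<lambda>\<epsilon>. h \<epsilon> powr s)) powr (1 / s)"
proof -
  let ?S = "set_pmf (rademacher n)" and ?E = "\<lambda>F. measure_pmf.expectation (rademacher n) F"
  have one: "(\<Sum>\<epsilon>\<in>?S. pmf (rademacher n) \<epsilon> * 1) = 1"
    using sum_pmf_eq_1[OF finite_set_rademacher order_refl] by simp
  have "(?E h / 2) powr s \<le> 1 powr (s - 1) * (\<Sum>\<epsilon>\<in>?S. pmf (rademacher n) \<epsilon> * (1 powr (1 - s) * h \<epsilon> powr s))"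
    unfolding rademacher_expectation_sum
    by (rule weighted_power_mean[OF s finite_set_rademacher _ _ _ _ one]) (use h in auto)
  also have "\<dots> = ?E (\<lambda>\<epsilon>. h \<epsilon> powr s)" by (simp add: rademacher_expectation_sum)
  finally have "((?E h / 2) powr s) powr (1 / s) \<le> ?E (\<lambda>\<epsilon>. h \<epsilon> powr s) powr (1 / s)"
    using s by (intro powr_mono2) auto
  moreover have "((?E h / 2) powr s) powr (1 / s) = ?E h / 2"
    using s h by (simp add: powr_powr Bochner_Integration.integral_nonneg)
  ultimately show ?thesis by simp
qed

lemma Lp_sum:
  assumes p: "0 < p" and f: "\<And>k. k < n \<Longrightarrow> f k \<in> Lp p M"
  shows "(\<lambda>x. rsum n (\<lambda>k. f k x) \<epsilon>) \<in> Lp p M"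
proof -
  have [measurable]: "f k \<in> borel_measurable M" if "k < n" for k using f[OF that] by (simp add: Lp_def)
  have meas: "(\<lambda>x. rsum n (\<lambda>k. f k x) \<epsilon>) \<in> borel_measurable M"
    unfolding rsum_def by (intro borel_measurable_sum) simp
  have "integrable M (\<lambda>x. norm (rsum n (\<lambda>k. f k x) \<epsilon>) powr p)"
    using f meas
  proof (induction n)
    case (Suc n)
    have split: "rsum (Suc n) (\<lambda>k. f k x) \<epsilon> = rsum n (\<lambda>k. f k x) \<epsilon> + \<epsilon> n *\<^sub>R f n x" for x
      by (simp add: rsum_def)
    have [measurable]: "f k \<in> borel_measurable M" if "k < Suc n" for k using Suc.prems(1)[OF that] by (simp add: Lp_def)
    have [measurable]: "(\<lambda>x. rsum n (\<lambda>k. f k x) \<epsilon>) \<in> borel_measurable M"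
      unfolding rsum_def by (intro borel_measurable_sum) simp
    show ?case
    proof (rule Bochner_Integration.integrable_bound)
      show "integrable M (\<lambda>x. 2 powr p * (norm (rsum n (\<lambda>k. f k x) \<epsilon>) powr p + \<bar>\<epsilon> n\<bar> powr p * norm (f n x) powr p))"
        using Suc.IH Suc.prems(1)
        by (intro integrable_mult_right Bochner_Integration.integrable_add) (auto simp: Lp_def)
      show "(\<lambda>x. norm (rsum (Suc n) (\<lambda>k. f k x) \<epsilon>) powr p) \<in> borel_measurable M"
        using Suc.prems(2) by measurable
      have "norm (rsum (Suc n) (\<lambda>k. f k x) \<epsilon>) powr p
        \<le> 2 powr p * (norm (rsum n (\<lambda>k. f k x) \<epsilon>) powr p + \<bar>\<epsilon> n\<bar> powr p * norm (f n x) powr p)" for x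
      proof -
        have "norm (rsum (Suc n) (\<lambda>k. f k x) \<epsilon>) powr p \<le> (norm (rsum n (\<lambda>k. f k x) \<epsilon>) + \<bar>\<epsilon> n\<bar> * norm (f n x)) powr p"
          unfolding split using p norm_triangle_ineq[of "rsum n (\<lambda>k. f k x) \<epsilon>" "\<epsilon> n *\<^sub>R f n x"]
          by (intro powr_mono2) auto
        also have "\<dots> \<le> 2 powr p * (norm (rsum n (\<lambda>k. f k x) \<epsilon>) powr p + (\<bar>\<epsilon> n\<bar> * norm (f n x)) powr p)"
          using p by (intro add_powr_le) auto
        finally show ?thesis by (simp add: powr_mult)
      qed
      then show "AE x in M. norm (norm (rsum (Suc n) (\<lambda>k. f k x) \<epsilon>) powr p)
        \<le> norm (2 powr p * (norm (rsum n (\<lambda>k. f k x) \<epsilon>) powr p + \<bar>\<epsilon> n\<bar> powr p * norm (f n x) powr p))"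
        by (intro AE_I2) (simp add: abs_of_nonneg)
    qed
  qed simp
  then show ?thesis using meas by (simp add: Lp_def)
qed

text \<open>
  The triangle inequality in \<open>L\<^sup>s\<close>, up to a factor \<open>2\<close>, for weighted finite sums.
\<close>

lemma Minkowski_sum_le:
  fixes w H :: "'i \<Rightarrow> real" and g :: "'i \<Rightarrow> 'a \<Rightarrow> real"
  assumes s: "1 \<le> s" and S: "finite S" and w: "\<And>i. i \<in> S \<Longrightarrow> 0 \<le> w i"
    and [measurable]: "\<And>i. g i \<in> borel_measurable M" and g: "\<And>i x. 0 \<le> g i x" and H0: "\<And>i. 0 \<le> H i"
    and H: "\<And>i. (\<integral>\<^sup>+x. ennreal (g i x powr s) \<partial>M) = ennreal (H i)"
  shows "(\<integral>\<^sup>+x. ennreal ((\<Sum>i\<in>S. w i * g i x) powr s) \<partial>M) \<le> ennreal ((2 * (\<Sum>i\<in>S. w i * H i powr (1 / s))) powr s)"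
proof -
  define c where "c i = H i powr (1 / s)" for i
  have Hc: "H i = c i powr s" for i using s H0 by (simp add: c_def powr_powr)
  define S' where "S' = {i\<in>S. 0 < w i \<and> 0 < H i}"
  have finS': "finite S'" and c: "0 < c i" if "i \<in> S'" for i using S that by (simp_all add: S'_def c_def)
  define C where "C = (\<Sum>i\<in>S'. w i * c i)"
  have CS: "C = (\<Sum>i\<in>S. w i * H i powr (1 / s))"
    unfolding C_def c_def by (rule sum.mono_neutral_left[OF S]) (use w H0 in \<open>auto simp: S'_def less_le\<close>)
  \<comment> \<open>Indices with \<open>w i = 0\<close> or \<open>H i = 0\<close> drop out of both sides; for the others the weights of the
    power mean inequality are chosen so that the integrals of the terms are proportional to \<open>w i * c i\<close>.\<close>
  have vanish: "AE x in M. \<forall>i\<in>S - S'. w i * g i x = 0"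
  proof (rule AE_finite_allI)
    fix i assume i: "i \<in> S - S'"
    show "AE x in M. w i * g i x = 0"
    proof (cases "w i = 0")
      case False
      then have "H i = 0" using i w[of i] H0[of i] by (auto simp: S'_def less_le)
      then have "AE x in M. ennreal (g i x powr s) = 0"
        using H[of i] by (subst nn_integral_0_iff_AE[symmetric]) auto
      then show ?thesis by eventually_elim (auto simp: ennreal_eq_0_iff)
    qed simp
  qed (simp add: S)
  show ?thesis
  proof (cases "S' = {}")
    case True
    have "AE x in M. ennreal ((\<Sum>i\<in>S. w i * g i x) powr s) = 0"
      using vanish
    proof eventually_elim
      case (elim x)
      have "(\<Sum>i\<in>S. w i * g i x) = 0" by (rule sum.neutral) (use elim True in auto)
      then show ?case using s by simp
    qed
    then have "(\<integral>\<^sup>+x. ennreal ((\<Sum>i\<in>S. w i * g i x) powr s) \<partial>M) = (\<integral>\<^sup>+x. 0 \<partial>M)" by (rule nn_integral_cong_AE)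
    then show ?thesis by simp
  next
    case False
    have C: "0 < C" unfolding C_def
      using False S c by (intro sum_pos mult_pos_pos) (auto simp: S'_def)
    let ?b = "\<lambda>i. C powr (s - 1) * w i * c i powr (1 - s)"
    have pull: "(\<Sum>i\<in>S'. ennreal (?b i) * ennreal (y i)) = ennreal (\<Sum>i\<in>S'. ?b i * y i)" if y: "\<And>i. 0 \<le> y i" for y
    proof -
      have b: "0 \<le> ?b i" if "i \<in> S'" for i using that w by (auto simp: S'_def)
      then have "(\<Sum>i\<in>S'. ennreal (?b i) * ennreal (y i)) = (\<Sum>i\<in>S'. ennreal (?b i * y i))"
        by (intro sum.cong refl) (rule ennreal_mult'[symmetric])
      also have "\<dots> = ennreal (\<Sum>i\<in>S'. ?b i * y i)"
        by (rule sum_ennreal) (rule mult_nonneg_nonneg[OF b y])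
      finally show ?thesis .
    qed
    have "AE x in M. ennreal ((\<Sum>i\<in>S. w i * g i x) powr s) \<le> ennreal (2 powr s) * (\<Sum>i\<in>S'. ennreal (?b i) * ennreal (g i x powr s))"
      using vanish
    proof eventually_elim
      case (elim x)
      let ?X = "\<Sum>i\<in>S'. w i * g i x"
      have X: "(\<Sum>i\<in>S. w i * g i x) = ?X"
        by (rule sum.mono_neutral_right[OF S]) (use elim in \<open>auto simp: S'_def\<close>)
      have X0: "0 \<le> ?X" using w g by (intro sum_nonneg mult_nonneg_nonneg) (auto simp: S'_def)
      have "?X powr s = 2 powr s * (?X / 2) powr s" using X0 by (simp add: powr_divide)
      also have "(?X / 2) powr s \<le> C powr (s - 1) * (\<Sum>i\<in>S'. w i * (c i powr (1 - s) * g i x powr s))"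
        using weighted_power_mean[OF s _ _ c _ C C_def[symmetric], of "\<lambda>i. g i x"] S w g by (simp add: S'_def)
      finally have "?X powr s \<le> 2 powr s * (\<Sum>i\<in>S'. ?b i * g i x powr s)"
        by (simp add: sum_distrib_left mult.assoc)
      then show ?case
        unfolding X pull[OF powr_ge_zero] by (simp only: ennreal_mult'[OF powr_ge_zero, symmetric] ennreal_leI)
    qed
    then have "(\<integral>\<^sup>+x. ennreal ((\<Sum>i\<in>S. w i * g i x) powr s) \<partial>M) \<le> (\<integral>\<^sup>+x. ennreal (2 powr s) * (\<Sum>i\<in>S'. ennreal (?b i) * ennreal (g i x powr s)) \<partial>M)"
      by (rule nn_integral_mono_AE)
    also have "\<dots> = ennreal (2 powr s) * (\<Sum>i\<in>S'. ennreal (?b i) * ennreal (H i))"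
      by (simp add: nn_integral_sum nn_integral_cmult H del: sum_ennreal)
    also have "\<dots> = ennreal (2 powr s * (\<Sum>i\<in>S'. ?b i * H i))"
      unfolding pull[OF H0] by (simp only: ennreal_mult'[OF powr_ge_zero])
    also have "(\<Sum>i\<in>S'. ?b i * H i) = (\<Sum>i\<in>S'. C powr (s - 1) * (w i * c i))"
    proof (rule sum.cong[OF refl])
      fix i assume "i \<in> S'"
      then have "0 < c i" by (rule c)
      then have "c i powr (1 - s) * H i = c i" by (simp add: Hc powr_add[symmetric])
      then show "?b i * H i = C powr (s - 1) * (w i * c i)" by (simp add: mult.assoc)
    qed
    also have "\<dots> = C powr s"
      unfolding sum_distrib_left[symmetric] C_def[symmetric]
      using C powr_mult_base[of C "s - 1"] by (simp add: mult.commute)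
    also have "2 powr s * C powr s = (2 * C) powr s" using C by (simp add: powr_mult)
    finally show ?thesis unfolding CS .
  qed
qed

text \<open>
  The companion of the previous inequality: the \<open>\<ell>\<^sup>s\<close> norm of the integrals is at most the integral of
  the \<open>\<ell>\<^sup>s\<close> norms, up to a factor \<open>2\<close>.
\<close>

lemma Minkowski_integral_le:
  fixes w H :: "'i \<Rightarrow> real" and g :: "'i \<Rightarrow> 'a \<Rightarrow> real"
  assumes s: "1 \<le> s" and S: "finite S" and w: "\<And>i. i \<in> S \<Longrightarrow> 0 < w i"
    and [measurable]: "\<And>i. g i \<in> borel_measurable M" and g: "\<And>i x. 0 \<le> g i x" and H0: "\<And>i. 0 \<le> H i"
    and H: "\<And>i. (\<integral>\<^sup>+x. ennreal (g i x) \<partial>M) = ennreal (H i)" and q: "0 \<le> q"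
    and Q: "(\<integral>\<^sup>+x. ennreal ((\<Sum>i\<in>S. w i * g i x powr s) powr (1 / s)) \<partial>M) = ennreal q"
  shows "(\<Sum>i\<in>S. w i * H i powr s) \<le> (2 * q) powr s"
proof -
  define Y where "Y x = (\<Sum>i\<in>S. w i * g i x powr s) powr (1 / s)" for x
  have [measurable]: "Y \<in> borel_measurable M" unfolding Y_def by measurable
  have Y0: "0 \<le> Y x" for x by (simp add: Y_def)
  have Ys: "Y x powr s = (\<Sum>i\<in>S. w i * g i x powr s)" for x
    using s w by (simp add: Y_def powr_powr sum_nonneg less_imp_le)
  have QY: "(\<integral>\<^sup>+x. ennreal (Y x) \<partial>M) = ennreal q" using Q by (simp add: Y_def)
  have zero: "g i x = 0" if "i \<in> S" "Y x = 0" for i x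
  proof -
    have "(\<Sum>i\<in>S. w i * g i x powr s) = 0" using Ys[of x] that(2) by simp
    then have "w i * g i x powr s = 0"
      using that(1) w by (subst (asm) sum_nonneg_eq_0_iff[OF S]) (auto simp: less_imp_le)
    then show ?thesis using w[OF that(1)] by simp
  qed
  \<comment> \<open>Jensen's inequality for the measure with density \<open>Y\<close>, applied to \<open>g i / Y\<close>.\<close>
  define Z where "Z i = (\<integral>\<^sup>+x. ennreal (g i x powr s * Y x powr (1 - s)) \<partial>M)" for i
  have sumZ: "(\<Sum>i\<in>S. ennreal (w i) * Z i) = ennreal q"
  proof -
    have "(\<Sum>i\<in>S. ennreal (w i) * Z i) = (\<integral>\<^sup>+x. (\<Sum>i\<in>S. ennreal (w i) * ennreal (g i x powr s * Y x powr (1 - s))) \<partial>M)"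
      unfolding Z_def by (simp add: nn_integral_sum nn_integral_cmult del: sum_ennreal)
    also have "\<dots> = (\<integral>\<^sup>+x. ennreal (Y x) \<partial>M)"
    proof (rule nn_integral_cong)
      fix x
      have "(\<Sum>i\<in>S. w i * (g i x powr s * Y x powr (1 - s))) = Y x powr s * Y x powr (1 - s)"
        unfolding Ys sum_distrib_right by (simp add: mult.assoc)
      also have "\<dots> = Y x" using Y0[of x] by (cases "Y x = 0") (simp_all add: powr_add[symmetric])
      finally show "(\<Sum>i\<in>S. ennreal (w i) * ennreal (g i x powr s * Y x powr (1 - s))) = ennreal (Y x)"
        using w by (simp add: ennreal_mult[symmetric] less_imp_le)
    qed
    finally show ?thesis using QY by simp
  qed
  have pw: "ennreal ((H i / 2) powr s) \<le> ennreal (q powr (s - 1)) * Z i" if i: "i \<in> S" for i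
  proof (cases "H i = 0")
    case False
    then have Hpos: "0 < H i" using H0[of i] by simp
    have qpos: "0 < q"
    proof (rule ccontr)
      assume "\<not> 0 < q"
      then have "(\<integral>\<^sup>+x. ennreal (Y x) \<partial>M) = 0" using q QY by simp
      then have "AE x in M. ennreal (Y x) = 0" by (subst (asm) nn_integral_0_iff_AE) auto
      then have "AE x in M. ennreal (g i x) = 0"
        by eventually_elim (use Y0 zero[OF i] in \<open>auto simp: ennreal_eq_0_iff order.antisym\<close>)
      then have "(\<integral>\<^sup>+x. ennreal (g i x) \<partial>M) = 0" by (subst nn_integral_0_iff_AE) auto
      then show False using H[of i] Hpos by (simp add: ennreal_eq_0_iff)
    qed
    \<comment> \<open>With this choice the first term below integrates to \<open>H i / 2\<close> and can be absorbed.\<close>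
    define a where "a = H i / (2 * q)"
    have a: "0 < a" using Hpos qpos by (simp add: a_def)
    have "g i x \<le> a * Y x + a powr (1 - s) * (g i x powr s * Y x powr (1 - s))" for x
    proof (cases "Y x = 0")
      case True
      then show ?thesis using zero[OF i] by simp
    next
      case False
      then have "0 < Y x" using Y0[of x] by simp
      then have "g i x \<le> a * Y x + (a * Y x) powr (1 - s) * g i x powr s"
        using a g s by (intro linear_le_powr) auto
      then show ?thesis using a Y0 by (simp add: powr_mult mult_ac)
    qed
    then have "(\<integral>\<^sup>+x. ennreal (g i x) \<partial>M) \<le> (\<integral>\<^sup>+x. ennreal a * ennreal (Y x) + ennreal (a powr (1 - s)) * ennreal (g i x powr s * Y x powr (1 - s)) \<partial>M)"
      using a Y0 by (intro nn_integral_mono) (simp add: ennreal_mult[symmetric] ennreal_plus[symmetric] ennreal_leI del: ennreal_plus)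
    also have "\<dots> = ennreal a * ennreal q + ennreal (a powr (1 - s)) * Z i"
      unfolding Z_def QY[symmetric] by (subst nn_integral_add) (simp_all add: nn_integral_cmult)
    also have "ennreal a * ennreal q = ennreal (H i / 2)"
      using qpos a by (simp add: a_def ennreal_mult[symmetric])
    finally have le: "ennreal (H i) \<le> ennreal (H i / 2) + ennreal (a powr (1 - s)) * Z i" unfolding H .
    show ?thesis
    proof (cases "Z i")
      case (real z)
      then have "ennreal (H i) \<le> ennreal (H i / 2 + a powr (1 - s) * z)"
        using le Hpos by (simp add: ennreal_mult[symmetric] ennreal_plus[symmetric] del: ennreal_plus)
      then have "H i / 2 \<le> a powr (1 - s) * z" using Hpos real by (subst (asm) ennreal_le_iff) auto
      then have "(q * a) powr (s - 1) * (H i / 2) \<le> (q * a) powr (s - 1) * (a powr (1 - s) * z)" by (intro mult_left_mono) auto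
      also have "\<dots> = q powr (s - 1) * z" using a qpos by (simp add: powr_mult mult.assoc[symmetric] powr_add[symmetric])
      also have "q * a = H i / 2" using qpos by (simp add: a_def)
      also have "(H i / 2) powr (s - 1) * (H i / 2) = (H i / 2) powr s"
        using Hpos powr_mult_base[of "H i / 2" "s - 1"] by (simp add: mult.commute)
      finally show ?thesis using real by (simp add: ennreal_mult[symmetric] ennreal_leI)
    next
      case top
      then show ?thesis using qpos by (simp add: ennreal_mult_top)
    qed
  qed simp
  have "ennreal (\<Sum>i\<in>S. w i * (H i / 2) powr s) = (\<Sum>i\<in>S. ennreal (w i) * ennreal ((H i / 2) powr s))"
    using w by (simp add: ennreal_mult[symmetric] less_imp_le)
  also have "\<dots> \<le> (\<Sum>i\<in>S. ennreal (w i) * (ennreal (q powr (s - 1)) * Z i))"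
    by (intro sum_mono mult_left_mono pw) auto
  also have "\<dots> = ennreal (q powr (s - 1)) * (\<Sum>i\<in>S. ennreal (w i) * Z i)"
    unfolding sum_distrib_left by (intro sum.cong) (simp_all add: mult.left_commute)
  also have "\<dots> = ennreal (q powr (s - 1) * q)" unfolding sumZ using q by (simp add: ennreal_mult)
  also have "q powr (s - 1) * q = q powr s"
    using q powr_mult_base[of q "s - 1"] by (cases "q = 0") (simp_all add: mult.commute)
  finally have "(\<Sum>i\<in>S. w i * (H i / 2) powr s) \<le> q powr s" by (subst (asm) ennreal_le_iff) auto
  moreover have "(\<Sum>i\<in>S. w i * (H i / 2) powr s) = (\<Sum>i\<in>S. w i * H i powr s) / 2 powr s"
    using H0 by (simp add: powr_divide sum_divide_distrib)
  ultimately show ?thesis using q by (simp add: powr_mult field_simps)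
qed

text \<open>
  The square function is the second mean over the signs, taken pointwise; the Rademacher norm takes the \<open>L\<^sup>p\<close> norm before
  the second mean. Exchanging the two is possible in one direction by a Minkowski inequality. In the other direction
  the \<open>p\<close>-th mean, which commutes with the \<open>L\<^sup>p\<close> norm, is put in between, by Khintchine's inequality and a comparison of power
  means. Which direction is which depends on whether \<open>p\<close> exceeds \<open>2\<close>.
\<close>

lemma rademacher_norm_equiv_square_function:
  fixes M :: "'a measure"
  assumes p: "1 < p"
  obtains C where "0 < C" "\<And>n (f :: nat \<Rightarrow> 'a \<Rightarrow> complex) q. (\<And>k. k < n \<Longrightarrow> f k \<in> Lp p M) \<Longrightarrow> 0 \<le> q \<Longrightarrow>
    (\<integral>\<^sup>+x. ennreal ((\<Sum>k<n. (norm (f k x))\<^sup>2) powr (p / 2)) \<partial>M) = ennreal q \<Longrightarrow>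
    (rademacher_norm p M n f)\<^sup>2 \<le> C * q powr (2 / p) \<and> q \<le> C * ((rademacher_norm p M n f)\<^sup>2) powr (p / 2)"
proof -
  obtain K where K: "0 < K" "\<And>n (a :: nat \<Rightarrow> complex).
    measure_pmf.expectation (rademacher n) (\<lambda>\<epsilon>. norm (rsum n a \<epsilon>) powr p) \<le> K * (\<Sum>k<n. (norm (a k))\<^sup>2) powr (p / 2)"
    using Khintchine_upper[of p] p by auto
  have "\<exists>K'>0. p < 2 \<longrightarrow> (\<forall>n (a :: nat \<Rightarrow> complex). (\<Sum>k<n. (norm (a k))\<^sup>2) powr (p / 2)
    \<le> K' * measure_pmf.expectation (rademacher n) (\<lambda>\<epsilon>. norm (rsum n a \<epsilon>) powr p))"
  proof (cases "p < 2")
    case True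
    then show ?thesis using Khintchine_lower[of p] p by (metis less_trans zero_less_one)
  qed (auto intro: exI[of _ 1])
  then obtain K' where K': "0 < K'" "\<And>n (a :: nat \<Rightarrow> complex). p < 2 \<Longrightarrow> (\<Sum>k<n. (norm (a k))\<^sup>2) powr (p / 2)
    \<le> K' * measure_pmf.expectation (rademacher n) (\<lambda>\<epsilon>. norm (rsum n a \<epsilon>) powr p)" by blast
  define C where "C = 2 * K powr (2 / p) + 2 * K' + 2 powr (p / 2) + 2 powr (2 / p)"
  have C: "2 * K powr (2 / p) \<le> C" "2 powr (p / 2) \<le> C" "2 * K' \<le> C" "2 powr (2 / p) \<le> C"
    using K' by (simp_all add: C_def)
  show ?thesis
  proof (rule that[of C])
    show "0 < C" using K' by (simp add: C_def add_nonneg_pos)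
    fix n and f :: "nat \<Rightarrow> 'a \<Rightarrow> complex" and q :: real
    assume f: "\<And>k. k < n \<Longrightarrow> f k \<in> Lp p M" and q: "0 \<le> q"
      and Q: "(\<integral>\<^sup>+x. ennreal ((\<Sum>k<n. (norm (f k x))\<^sup>2) powr (p / 2)) \<partial>M) = ennreal q"
    let ?S = "set_pmf (rademacher n)" and ?w = "pmf (rademacher n)"
    let ?E = "\<lambda>F. measure_pmf.expectation (rademacher n) F"
    note fin = finite_set_rademacher[of n] and Esum = rademacher_expectation_sum
    have w: "0 < ?w \<epsilon>" if "\<epsilon> \<in> ?S" for \<epsilon> using that by (rule pmf_positive)
    define F where "F \<epsilon> x = rsum n (\<lambda>k. f k x) \<epsilon>" for \<epsilon> x
    define \<sigma> where "\<sigma> x = (\<Sum>k<n. (norm (f k x))\<^sup>2)" for x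
    define H where "H \<epsilon> = (\<integral>x. norm (F \<epsilon> x) powr p \<partial>M)" for \<epsilon>
    define R where "R = ?E (\<lambda>\<epsilon>. H \<epsilon> powr (2 / p))"
    have FLp: "F \<epsilon> \<in> Lp p M" for \<epsilon> unfolding F_def using p f by (intro Lp_sum) auto
    then have [measurable]: "F \<epsilon> \<in> borel_measurable M" for \<epsilon> by (simp add: Lp_def)
    have second: "(\<Sum>\<epsilon>\<in>?S. ?w \<epsilon> * (norm (F \<epsilon> x))\<^sup>2) = \<sigma> x" for x
      using rademacher_second_moment[of n 0 "\<lambda>k. f k x"] by (simp add: F_def \<sigma>_def Esum)
    have [measurable]: "\<sigma> \<in> borel_measurable M" unfolding second[symmetric] by measurable
    have H0: "0 \<le> H \<epsilon>" for \<epsilon> by (simp add: H_def)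
    have H: "(\<integral>\<^sup>+x. ennreal (norm (F \<epsilon> x) powr p) \<partial>M) = ennreal (H \<epsilon>)" for \<epsilon>
      unfolding H_def using FLp[of \<epsilon>] by (intro nn_integral_eq_integral) (auto simp: Lp_def)
    have Q': "(\<integral>\<^sup>+x. ennreal (\<sigma> x powr (p / 2)) \<partial>M) = ennreal q" using Q by (simp add: \<sigma>_def)
    have EH0: "0 \<le> ?E H" unfolding Esum using H0 by (intro sum_nonneg mult_nonneg_nonneg) auto
    have R0: "0 \<le> R" unfolding R_def Esum by (intro sum_nonneg mult_nonneg_nonneg) auto
    have EH: "(\<integral>\<^sup>+x. ennreal c * ennreal (?E (\<lambda>\<epsilon>. norm (F \<epsilon> x) powr p)) \<partial>M) = ennreal (c * ?E H)" if "0 \<le> c" for c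
    proof -
      have "ennreal c * ennreal (?E (\<lambda>\<epsilon>. norm (F \<epsilon> x) powr p)) = ennreal c * (\<Sum>\<epsilon>\<in>?S. ennreal (?w \<epsilon>) * ennreal (norm (F \<epsilon> x) powr p))" for x
        unfolding Esum by (simp add: ennreal_mult[symmetric])
      then have "(\<integral>\<^sup>+x. ennreal c * ennreal (?E (\<lambda>\<epsilon>. norm (F \<epsilon> x) powr p)) \<partial>M) = ennreal c * (\<Sum>\<epsilon>\<in>?S. ennreal (?w \<epsilon>) * ennreal (H \<epsilon>))"
        by (simp add: nn_integral_sum nn_integral_cmult H del: sum_ennreal)
      also have "\<dots> = ennreal (c * ?E H)"
        unfolding Esum using that H0 by (simp add: ennreal_mult[symmetric] sum_nonneg)
      finally show ?thesis .
    qed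
    have rn: "(rademacher_norm p M n f)\<^sup>2 = R"
    proof -
      have "(Lp_norm p M (\<lambda>y. \<Sum>k<n. complex_of_real (\<epsilon> k) * f k y))\<^sup>2 = H \<epsilon> powr (2 / p)" for \<epsilon>
      proof -
        have "(\<lambda>y. \<Sum>k<n. complex_of_real (\<epsilon> k) * f k y) = F \<epsilon>"
          by (intro ext) (simp add: F_def rsum_def scaleR_conv_of_real)
        then show ?thesis
          using H0[of \<epsilon>] by (simp add: Lp_norm_def H_def[symmetric] power2_eq_square powr_add[symmetric])
      qed
      then show ?thesis using R0 by (simp add: rademacher_norm_def R_def)
    qed
    have sq: "(y\<^sup>2) powr (p / 2) = y powr p" "(y powr p) powr (2 / p) = y\<^sup>2" if "0 \<le> y" for y :: real
    proof -
      have "(y\<^sup>2) powr (p / 2) = (y powr 2) powr (p / 2)" using that by (simp add: powr_numeral)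
      then show "(y\<^sup>2) powr (p / 2) = y powr p" by (simp only: powr_powr) simp
      show "(y powr p) powr (2 / p) = y\<^sup>2" using that p by (simp add: powr_powr powr_numeral)
    qed
    have root: "(H \<epsilon> powr (2 / p)) powr (p / 2) = H \<epsilon>" for \<epsilon> using H0 p by (simp add: powr_powr)
    have half: "1 / (p / 2) = 2 / p" "1 / (2 / p) = p / 2" by simp_all
    show "(rademacher_norm p M n f)\<^sup>2 \<le> C * q powr (2 / p) \<and> q \<le> C * ((rademacher_norm p M n f)\<^sup>2) powr (p / 2)"
      unfolding rn
    proof (cases "p < 2")
      case False
      then have s: "1 \<le> p / 2" by simp
      have "ennreal (1 * ?E H) \<le> (\<integral>\<^sup>+x. ennreal K * ennreal (\<sigma> x powr (p / 2)) \<partial>M)"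
        unfolding EH[OF zero_le_one, symmetric] F_def \<sigma>_def using K
        by (intro nn_integral_mono) (simp add: ennreal_mult[symmetric] ennreal_leI)
      also have "\<dots> = ennreal (K * q)" using K(1) q by (simp add: nn_integral_cmult Q' ennreal_mult)
      finally have EHq: "?E H \<le> K * q" using K(1) q by (subst (asm) ennreal_le_iff) auto
      have "R \<le> 2 * (?E (\<lambda>\<epsilon>. (H \<epsilon> powr (2 / p)) powr (p / 2))) powr (1 / (p / 2))"
        unfolding R_def by (intro rademacher_power_mean s) simp
      also have "\<dots> \<le> 2 * (K * q) powr (2 / p)"
        unfolding root half using EHq EH0 p by (intro mult_left_mono powr_mono2) auto
      also have "\<dots> = (2 * K powr (2 / p)) * q powr (2 / p)" using K(1) q by (simp add: powr_mult)
      also have "\<dots> \<le> C * q powr (2 / p)" using C by (intro mult_right_mono) auto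
      finally have upper: "R \<le> C * q powr (2 / p)" .
      have "ennreal q \<le> ennreal ((2 * (\<Sum>\<epsilon>\<in>?S. ?w \<epsilon> * H \<epsilon> powr (1 / (p / 2)))) powr (p / 2))"
        unfolding Q'[symmetric] second[symmetric]
        by (rule Minkowski_sum_le[OF s fin _ _ _ H0]) (use sq(1) H in auto)
      also have "(\<Sum>\<epsilon>\<in>?S. ?w \<epsilon> * H \<epsilon> powr (1 / (p / 2))) = R" by (simp add: R_def Esum)
      finally have "q \<le> (2 * R) powr (p / 2)" by (subst (asm) ennreal_le_iff) auto
      also have "\<dots> = 2 powr (p / 2) * R powr (p / 2)" using R0 by (simp add: powr_mult)
      also have "\<dots> \<le> C * R powr (p / 2)" using C by (intro mult_right_mono) auto
      finally show "R \<le> C * q powr (2 / p) \<and> q \<le> C * R powr (p / 2)" using upper by simp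
    next
      case True
      then have s: "1 \<le> 2 / p" using p by simp
      have "ennreal q \<le> (\<integral>\<^sup>+x. ennreal K' * ennreal (?E (\<lambda>\<epsilon>. norm (F \<epsilon> x) powr p)) \<partial>M)"
        unfolding Q'[symmetric] F_def \<sigma>_def using K'(1) K'(2)[OF True]
        by (intro nn_integral_mono) (simp add: ennreal_mult'[symmetric] ennreal_leI)
      then have qE: "q \<le> K' * ?E H" using K'(1) EH0 EH by (subst ennreal_le_iff[symmetric]) auto
      have "?E H \<le> 2 * ?E (\<lambda>\<epsilon>. H \<epsilon> powr (2 / p)) powr (1 / (2 / p))"
        by (intro rademacher_power_mean s H0)
      then have "K' * ?E H \<le> K' * (2 * R powr (p / 2))"
        unfolding half R_def using K'(1) by (intro mult_left_mono) auto
      with qE have "q \<le> (2 * K') * R powr (p / 2)" by simp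
      also have "\<dots> \<le> C * R powr (p / 2)" using C by (intro mult_right_mono) auto
      finally have lower: "q \<le> C * R powr (p / 2)" .
      have "R \<le> (2 * q) powr (2 / p)"
        unfolding R_def Esum
      proof (rule Minkowski_integral_le[OF s fin w _ _ H0 H q])
        show "(\<integral>\<^sup>+x. ennreal ((\<Sum>\<epsilon>\<in>?S. ?w \<epsilon> * (norm (F \<epsilon> x) powr p) powr (2 / p)) powr (1 / (2 / p))) \<partial>M) = ennreal q"
          using Q' by (simp only: sq(2)[OF norm_ge_zero] second half)
      qed auto
      also have "\<dots> = 2 powr (2 / p) * q powr (2 / p)" using q by (simp add: powr_mult)
      also have "\<dots> \<le> C * q powr (2 / p)" using C by (intro mult_right_mono) auto
      finally show "R \<le> C * q powr (2 / p) \<and> q \<le> C * R powr (p / 2)" using lower by simp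
    qed
  qed
qed

section \<open>Integral operators dominated by the kernel\<close>

context thin_annulus_space
begin

text \<open>
  The operator \<open>S\<close> is not assumed to be given by a kernel: extensions of an operator from \<open>L\<^sup>2\<close> to \<open>L\<^sup>p\<close> are determined
  only up to null sets that depend on the function.
\<close>

definition dominated :: "real \<Rightarrow> real \<Rightarrow> real \<Rightarrow> real \<Rightarrow> 'a operator \<Rightarrow> bool" where
  "dominated p b \<delta> r S \<longleftrightarrow> (\<forall>f\<in>Lp p M. S f \<in> Lp p M \<and>
     (AE x in M. ennreal (norm (S f x)) \<le> ennreal b * kop \<delta> r (\<lambda>y. ennreal (norm (f y))) x))"

lemma Lp_nn_integral_finite: "f \<in> Lp p M \<Longrightarrow> (\<integral>\<^sup>+x. ennreal (norm (f x) powr p) \<partial>M) < \<top>"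
  unfolding Lp_def by (auto simp: integrable_iff_bounded)

lemma Lp_measurable: "f \<in> Lp p M \<Longrightarrow> f \<in> borel_measurable M"
  by (simp add: Lp_def)

text \<open>
  The square function estimate between two applications of the equivalence of randomised norms and square functions.
  It is essential that the scales \<open>j\<close> may differ from operator to operator and that the constant does not see how many there are.
\<close>

lemma R_bound_dominated:
  assumes p: "1 < p"
  obtains E where "0 < E" "\<And>b \<delta> t \<tau>. 0 < b \<Longrightarrow> 0 < \<delta> \<Longrightarrow> \<delta> \<le> 1 \<Longrightarrow> 0 < t \<Longrightarrow>
    (\<And>S. S \<in> \<tau> \<Longrightarrow> \<exists>j. dominated p b \<delta> (rad t j) S) \<Longrightarrow>
    R_bound p M \<tau> \<le> ennreal (E * b * loss \<delta> * (1 + \<bar>ln \<delta>\<bar>)\<^sup>2)"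
proof -
  obtain E where E: "0 < E" "\<And>\<delta> t n j g v. 0 < \<delta> \<Longrightarrow> \<delta> \<le> 1 \<Longrightarrow> 0 < t \<Longrightarrow>
    dominated_family p \<delta> t n j g v \<Longrightarrow>
    sqnorm p n v \<le> ennreal ((E * loss \<delta> * (1 + \<bar>ln \<delta>\<bar>)\<^sup>2) powr p) * sqnorm p n g"
    using square_function_bound[OF p] by blast
  obtain C where C: "0 < C" "\<And>n (f :: nat \<Rightarrow> 'a \<Rightarrow> complex) q. (\<And>k. k < n \<Longrightarrow> f k \<in> Lp p M) \<Longrightarrow> 0 \<le> q \<Longrightarrow>
    (\<integral>\<^sup>+x. ennreal ((\<Sum>k<n. (norm (f k x))\<^sup>2) powr (p / 2)) \<partial>M) = ennreal q \<Longrightarrow>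
    (rademacher_norm p M n f)\<^sup>2 \<le> C * q powr (2 / p) \<and> q \<le> C * ((rademacher_norm p M n f)\<^sup>2) powr (p / 2)"
    using rademacher_norm_equiv_square_function[OF p, of M] by blast
  define A where "A = sqrt (C * C powr (2 / p))"
  have A: "0 < A" "A\<^sup>2 = C * C powr (2 / p)" using C(1) by (simp_all add: A_def)
  show ?thesis
  proof (rule that[of "A * E"])
    show "0 < A * E" using A E by simp
    fix b \<delta> t :: real and \<tau> :: "'a operator set"
    assume b: "0 < b" and \<delta>: "0 < \<delta>" "\<delta> \<le> 1" and t: "0 < t"
      and dom: "\<And>S. S \<in> \<tau> \<Longrightarrow> \<exists>j. dominated p b \<delta> (rad t j) S"
    define e where "e = E * loss \<delta> * (1 + \<bar>ln \<delta>\<bar>)\<^sup>2"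
    have e: "0 < e" using E(1) loss_pos[OF \<delta>(1)] unfolding e_def by (intro mult_pos_pos zero_less_power) auto
    define c where "c = A * E * b * loss \<delta> * (1 + \<bar>ln \<delta>\<bar>)\<^sup>2"
    have c: "c = A * (b * e)" by (simp add: c_def e_def)
    have cpos: "0 < c" using A b e by (simp add: c)
    have "rademacher_norm p M n (\<lambda>k. S k (f k)) \<le> c * rademacher_norm p M n f"
      if Sf: "\<forall>k<n. S k \<in> \<tau> \<and> f k \<in> Lp p M" for n S and f :: "nat \<Rightarrow> 'a \<Rightarrow> complex"
    proof -
      have f: "f k \<in> Lp p M" if "k < n" for k using Sf that by blast
      have "\<forall>k. \<exists>j. k < n \<longrightarrow> dominated p b \<delta> (rad t j) (S k)" using Sf dom by blast
      then obtain j where j: "\<And>k. k < n \<Longrightarrow> dominated p b \<delta> (rad t (j k)) (S k)" by metis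
      define u where "u k = S k (f k)" for k
      have u: "u k \<in> Lp p M" "AE x in M. ennreal (norm (u k x)) \<le> ennreal b * kop \<delta> (rad t (j k)) (\<lambda>y. ennreal (norm (f k y))) x" if "k < n" for k
        using j[OF that] f[OF that] unfolding dominated_def u_def by blast+
      define g where "g k x = (if k < n then norm (f k x) else 0)" for k x
      \<comment> \<open>Division by \<open>b\<close> normalises the domination; indices beyond \<open>n\<close> are filled up with zero.\<close>
      define v where "v k x = (if k < n then norm (u k x) / b else 0)" for k x
      have g_meas: "g k \<in> borel_measurable M" for k
        using Lp_measurable[OF f, of k] unfolding g_def by (cases "k < n") auto
      have v_meas: "v k \<in> borel_measurable M" for k
        using Lp_measurable[OF u(1), of k] unfolding v_def by (cases "k < n") auto
      have g0: "0 \<le> g k x" and v0: "0 \<le> v k x" for k x using b by (auto simp: g_def v_def)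
      have gfin: "(\<integral>\<^sup>+x. ennreal (g k x powr p) \<partial>M) < \<top>" if "k < n" for k
        using Lp_nn_integral_finite[OF f[OF that]] that by (simp add: g_def)
      have v_le: "AE x in M. ennreal (v k x) \<le> kop \<delta> (rad t (j k)) (\<lambda>y. ennreal (g k y)) x" if k: "k < n" for k
        using u(2)[OF k]
      proof eventually_elim
        case (elim x)
        have "ennreal (v k x) = ennreal (1 / b) * ennreal (norm (u k x))"
          using k b by (simp add: v_def ennreal_mult[symmetric])
        also have "\<dots> \<le> ennreal (1 / b) * (ennreal b * kop \<delta> (rad t (j k)) (\<lambda>y. ennreal (norm (f k y))) x)"
          using elim by (intro mult_left_mono) auto
        also have "\<dots> = kop \<delta> (rad t (j k)) (\<lambda>y. ennreal (norm (f k y))) x"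
          using b by (simp add: mult.assoc[symmetric] ennreal_mult[symmetric])
        also have "\<dots> = kop \<delta> (rad t (j k)) (\<lambda>y. ennreal (g k y)) x"
          using k by (simp add: g_def)
        finally show ?case .
      qed
      have vg: "sqnorm p n v \<le> ennreal (e powr p) * sqnorm p n g"
        unfolding e_def
      proof (rule E(2)[OF \<delta> t])
        show "dominated_family p \<delta> t n j g v"
          unfolding dominated_family_def using g_meas g0 gfin v_meas v0 v_le by blast
      qed
      have "sqnorm p n g < \<top>" using p by (intro sqnorm_finite g_meas g0 gfin) auto
      then obtain q where q: "0 \<le> q" "sqnorm p n g = ennreal q" by (cases "sqnorm p n g") auto
      have fq: "(\<integral>\<^sup>+x. ennreal ((\<Sum>k<n. (norm (f k x))\<^sup>2) powr (p / 2)) \<partial>M) = ennreal q"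
        using q(2) by (simp add: sqnorm_def sqsum_def g_def)
      have "sqnorm p n v < \<top>" using vg q by (simp add: ennreal_mult_less_top le_less_trans)
      then obtain q' where q': "0 \<le> q'" "sqnorm p n v = ennreal q'" by (cases "sqnorm p n v") auto
      have "ennreal q' \<le> ennreal (e powr p * q)" using vg q q' by (simp add: ennreal_mult)
      then have qq: "q' \<le> e powr p * q" using q by (subst (asm) ennreal_le_iff) auto
      have uq: "(\<integral>\<^sup>+x. ennreal ((\<Sum>k<n. (norm (u k x))\<^sup>2) powr (p / 2)) \<partial>M) = ennreal (b powr p * q')"
      proof -
        have "(\<Sum>k<n. (norm (u k x))\<^sup>2) powr (p / 2) = b powr p * sqsum n v x powr (p / 2)" for x
        proof -
          have "(\<Sum>k<n. (norm (u k x))\<^sup>2) = b\<^sup>2 * sqsum n v x"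
            using b by (simp add: sqsum_def v_def sum_distrib_left power_divide)
          moreover have "(b\<^sup>2) powr (p / 2) = b powr p"
          proof -
            have "(b\<^sup>2) powr (p / 2) = (b powr 2) powr (p / 2)" using b by (simp add: powr_numeral)
            then show ?thesis by (simp only: powr_powr) simp
          qed
          ultimately show ?thesis by (simp add: powr_mult)
        qed
        then have "(\<integral>\<^sup>+x. ennreal ((\<Sum>k<n. (norm (u k x))\<^sup>2) powr (p / 2)) \<partial>M) = (\<integral>\<^sup>+x. ennreal (b powr p) * ennreal (sqsum n v x powr (p / 2)) \<partial>M)"
          by (simp add: ennreal_mult)
        also have "\<dots> = ennreal (b powr p) * sqnorm p n v"
          unfolding sqnorm_def using v_meas by (intro nn_integral_cmult) simp
        finally show ?thesis using q' by (simp add: ennreal_mult)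
      qed
      let ?rf = "rademacher_norm p M n f" and ?ru = "rademacher_norm p M n u"
      have rf0: "0 \<le> ?rf" and ru0: "0 \<le> ?ru" by (simp_all add: rademacher_norm_def Bochner_Integration.integral_nonneg)
      have 1: "?ru\<^sup>2 \<le> C * (b powr p * q') powr (2 / p)"
        using C(2)[OF u(1) _ uq] q' by simp
      have 2: "q \<le> C * (?rf\<^sup>2) powr (p / 2)" using C(2)[OF f q(1) fq] by simp
      have pow: "(y powr p) powr (2 / p) = y\<^sup>2" if "0 < y" for y :: real
        using that p by (simp add: powr_powr powr_numeral)
      have "?ru\<^sup>2 \<le> C * (b powr p * (e powr p * (C * (?rf\<^sup>2) powr (p / 2)))) powr (2 / p)"
      proof (rule order_trans[OF 1], intro mult_left_mono powr_mono2)
        show "q' \<le> e powr p * (C * (?rf\<^sup>2) powr (p / 2))"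
          by (rule order_trans[OF qq mult_left_mono[OF 2]]) simp
      qed (use q' C(1) p in auto)
      also have "\<dots> = C * ((b powr p) powr (2 / p) * ((e powr p) powr (2 / p) * (C powr (2 / p) * ((?rf\<^sup>2) powr (p / 2)) powr (2 / p))))"
        using C(1) by (simp add: powr_mult)
      also have "((?rf\<^sup>2) powr (p / 2)) powr (2 / p) = ?rf\<^sup>2" using p by (simp add: powr_powr)
      also have "C * ((b powr p) powr (2 / p) * ((e powr p) powr (2 / p) * (C powr (2 / p) * ?rf\<^sup>2))) = (c * ?rf)\<^sup>2"
        unfolding pow[OF b] pow[OF e] c power_mult_distrib A(2) by (simp only: mult_ac)
      finally have "?ru \<le> c * ?rf"
        using cpos rf0 by (intro power2_le_imp_le[of ?ru "c * ?rf"]) auto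
      moreover have "u = (\<lambda>k. S k (f k))" by (rule ext) (simp add: u_def)
      ultimately show ?thesis by simp
    qed
    then have "R_bound p M \<tau> \<le> ennreal c"
      unfolding R_bound_def using cpos by (intro Inf_lower) blast
    then show "R_bound p M \<tau> \<le> ennreal (A * E * b * loss \<delta> * (1 + \<bar>ln \<delta>\<bar>)\<^sup>2)" by (simp add: c_def)
  qed
qed

lemma dominated_norm_bound:
  assumes p: "1 < p" and b: "0 < b" and \<delta>: "0 < \<delta>" "\<delta> \<le> 1" and t: "0 < t"
  obtains C where "0 \<le> C" "\<And>S f. dominated p b \<delta> (rad t j) S \<Longrightarrow> f \<in> Lp p M \<Longrightarrow>
    (\<integral>x. norm (S f x) powr p \<partial>M) \<le> C * (\<integral>x. norm (f x) powr p \<partial>M)"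
proof -
  obtain K where K: "\<And>t F (g :: 'a \<Rightarrow> ennreal). 0 < t \<Longrightarrow> finite F \<Longrightarrow> g \<in> borel_measurable M \<Longrightarrow>
    (\<integral>\<^sup>+x. epowr (SUP j\<in>F. kop \<delta> (rad t j) g x) p \<partial>M)
      \<le> ennreal ((K * loss \<delta> * (1 + \<bar>ln \<delta>\<bar>) ^ 3) powr p) * (\<integral>\<^sup>+x. epowr (g x) p \<partial>M)"
    using kop_max_strong_type[OF p] \<delta> by metis
  let ?C = "b powr p * (K * loss \<delta> * (1 + \<bar>ln \<delta>\<bar>) ^ 3) powr p"
  show ?thesis
  proof (rule that[of ?C])
    fix S :: "'a operator" and f :: "'a \<Rightarrow> complex" assume S: "dominated p b \<delta> (rad t j) S" and f: "f \<in> Lp p M"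
    have [measurable]: "f \<in> borel_measurable M" using f by (rule Lp_measurable)
    have Sf: "S f \<in> Lp p M" "AE x in M. ennreal (norm (S f x)) \<le> ennreal b * kop \<delta> (rad t j) (\<lambda>y. ennreal (norm (f y))) x"
      using S f unfolding dominated_def by blast+
    have int: "(\<integral>\<^sup>+x. ennreal (norm (h x) powr p) \<partial>M) = ennreal (\<integral>x. norm (h x) powr p \<partial>M)" if "h \<in> Lp p M" for h
      using that by (intro nn_integral_eq_integral) (auto simp: Lp_def)
    have "(\<integral>\<^sup>+x. ennreal (norm (S f x) powr p) \<partial>M) \<le> (\<integral>\<^sup>+x. ennreal (b powr p) * epowr (kop \<delta> (rad t j) (\<lambda>y. ennreal (norm (f y))) x) p \<partial>M)"
    proof (rule nn_integral_mono_AE)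
      show "AE x in M. ennreal (norm (S f x) powr p) \<le> ennreal (b powr p) * epowr (kop \<delta> (rad t j) (\<lambda>y. ennreal (norm (f y))) x) p"
        using Sf(2)
      proof eventually_elim
        case (elim x)
        have "ennreal (norm (S f x) powr p) = epowr (ennreal (norm (S f x))) p" by simp
        also have "\<dots> \<le> epowr (ennreal b * kop \<delta> (rad t j) (\<lambda>y. ennreal (norm (f y))) x) p"
          using elim p by (intro epowr_mono) auto
        also have "\<dots> = ennreal (b powr p) * epowr (kop \<delta> (rad t j) (\<lambda>y. ennreal (norm (f y))) x) p"
          using b p by (intro epowr_mult) auto
        finally show ?case .
      qed
    qed
    also have "\<dots> = ennreal (b powr p) * (\<integral>\<^sup>+x. epowr (SUP j\<in>{j}. kop \<delta> (rad t j) (\<lambda>y. ennreal (norm (f y))) x) p \<partial>M)"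
      by (simp add: nn_integral_cmult)
    also have "\<dots> \<le> ennreal (b powr p) * (ennreal ((K * loss \<delta> * (1 + \<bar>ln \<delta>\<bar>) ^ 3) powr p) * (\<integral>\<^sup>+x. epowr (ennreal (norm (f x))) p \<partial>M))"
      by (intro mult_left_mono K t) simp_all
    also have "\<dots> = ennreal (?C * (\<integral>x. norm (f x) powr p \<partial>M))"
      by (simp add: int[OF f] ennreal_mult mult.assoc)
    finally have "ennreal (\<integral>x. norm (S f x) powr p \<partial>M) \<le> ennreal (?C * (\<integral>x. norm (f x) powr p \<partial>M))"
      unfolding int[OF Sf(1)] .
    then show "(\<integral>x. norm (S f x) powr p \<partial>M) \<le> ?C * (\<integral>x. norm (f x) powr p \<partial>M)"
      by (subst (asm) ennreal_le_iff) (auto intro!: mult_nonneg_nonneg Bochner_Integration.integral_nonneg)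
  qed simp
qed

definition kernel_op :: "('a \<Rightarrow> 'a \<Rightarrow> complex) \<Rightarrow> 'a operator" where
  "kernel_op k f x = (\<integral>y. k x y * f y \<partial>M)"

context
  fixes p b \<delta> t :: real and j :: int and k :: "'a \<Rightarrow> 'a \<Rightarrow> complex"
  assumes p: "1 < p" and b: "0 < b" and \<delta>: "0 < \<delta>" "\<delta> \<le> 1" and t: "0 < t"
    and k_meas: "(\<lambda>(x, y). k x y) \<in> borel_measurable (M \<Otimes>\<^sub>M M)"
    and k_le: "\<And>x y. norm (k x y) \<le> b * ker \<delta> (rad t j) x y"
begin

lemma k_meas_section: "k x \<in> borel_measurable M"
  using measurable_compose[OF measurable_Pair1'[of x M M] k_meas] by simp

lemma kernel_mass_le:
  assumes f: "f \<in> borel_measurable M"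
  shows "(\<integral>\<^sup>+y. ennreal (norm (k x y * f y)) \<partial>M) \<le> ennreal b * kop \<delta> (rad t j) (\<lambda>y. ennreal (norm (f y))) x"
proof -
  have "(\<integral>\<^sup>+y. ennreal (norm (k x y * f y)) \<partial>M) \<le> (\<integral>\<^sup>+y. ennreal b * (ennreal (ker \<delta> (rad t j) x y) * ennreal (norm (f y))) \<partial>M)"
  proof (rule nn_integral_mono)
    fix y
    have "norm (k x y * f y) \<le> b * ker \<delta> (rad t j) x y * norm (f y)"
      using k_le by (simp add: norm_mult mult_right_mono)
    then have "ennreal (norm (k x y * f y)) \<le> ennreal (b * ker \<delta> (rad t j) x y * norm (f y))" by (rule ennreal_leI)
    then show "ennreal (norm (k x y * f y)) \<le> ennreal b * (ennreal (ker \<delta> (rad t j) x y) * ennreal (norm (f y)))"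
      using b ker_nonneg by (simp add: ennreal_mult mult.assoc)
  qed
  also have "\<dots> = ennreal b * kop \<delta> (rad t j) (\<lambda>y. ennreal (norm (f y))) x"
    unfolding kop_def using f by (intro nn_integral_cmult) simp
  finally show ?thesis .
qed

lemma kernel_integrable_AE:
  assumes f: "f \<in> Lp p M"
  shows "AE x in M. integrable M (\<lambda>y. k x y * f y)"
proof -
  have [measurable]: "f \<in> borel_measurable M" using f by (rule Lp_measurable)
  have "(\<integral>\<^sup>+x. epowr (kop \<delta> (rad t j) (\<lambda>y. ennreal (norm (f y))) x) p \<partial>M) < \<top>"
    using Lp_nn_integral_finite[OF f] by (intro kop_Lp_finite[OF p \<delta> t]) simp_all
  then have "AE x in M. epowr (kop \<delta> (rad t j) (\<lambda>y. ennreal (norm (f y))) x) p \<noteq> \<infinity>"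
    by (intro nn_integral_PInf_AE) auto
  then show ?thesis
  proof eventually_elim
    case (elim x)
    then have "kop \<delta> (rad t j) (\<lambda>y. ennreal (norm (f y))) x < \<top>"
      by (cases "kop \<delta> (rad t j) (\<lambda>y. ennreal (norm (f y))) x") auto
    then have "(\<integral>\<^sup>+y. ennreal (norm (k x y * f y)) \<partial>M) < \<top>"
      using kernel_mass_le[of f x] by (simp add: ennreal_mult_less_top le_less_trans)
    moreover have "(\<lambda>y. k x y * f y) \<in> borel_measurable M"
      using k_meas_section by (intro borel_measurable_times) auto
    ultimately show ?case by (simp add: integrable_iff_bounded)
  qed
qed

lemma kernel_op_dominated: "dominated p b \<delta> (rad t j) (kernel_op k)"
  unfolding dominated_def
proof (intro ballI conjI)
  fix f assume f: "f \<in> Lp p M"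
  have [measurable]: "f \<in> borel_measurable M" using f by (rule Lp_measurable)
  have [measurable]: "(\<lambda>z. k (fst z) (snd z)) \<in> borel_measurable (M \<Otimes>\<^sub>M M)"
    using k_meas by (simp add: case_prod_beta')
  have [measurable]: "kernel_op k f \<in> borel_measurable M"
    unfolding kernel_op_def
    by (rule borel_measurable_lebesgue_integral) (simp add: case_prod_beta')
  have le: "ennreal (norm (kernel_op k f x)) \<le> ennreal b * kop \<delta> (rad t j) (\<lambda>y. ennreal (norm (f y))) x" for x
  proof (cases "integrable M (\<lambda>y. k x y * f y)")
    case True
    have "ennreal (norm (kernel_op k f x)) \<le> (\<integral>\<^sup>+y. ennreal (norm (k x y * f y)) \<partial>M)"
      unfolding kernel_op_def by (rule integral_norm_bound_ennreal[OF True])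
    also have "\<dots> \<le> ennreal b * kop \<delta> (rad t j) (\<lambda>y. ennreal (norm (f y))) x" by (rule kernel_mass_le) simp
    finally show ?thesis .
  next
    case False
    then show ?thesis by (simp add: kernel_op_def not_integrable_integral_eq)
  qed
  then show "AE x in M. ennreal (norm (kernel_op k f x)) \<le> ennreal b * kop \<delta> (rad t j) (\<lambda>y. ennreal (norm (f y))) x" by simp
  have "(\<integral>\<^sup>+x. ennreal (norm (kernel_op k f x) powr p) \<partial>M) \<le> (\<integral>\<^sup>+x. epowr (ennreal b * kop \<delta> (rad t j) (\<lambda>y. ennreal (norm (f y))) x) p \<partial>M)"
  proof (rule nn_integral_mono)
    fix x
    have "ennreal (norm (kernel_op k f x) powr p) = epowr (ennreal (norm (kernel_op k f x))) p" by simp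
    also have "\<dots> \<le> epowr (ennreal b * kop \<delta> (rad t j) (\<lambda>y. ennreal (norm (f y))) x) p"
      using le p by (intro epowr_mono) auto
    finally show "ennreal (norm (kernel_op k f x) powr p) \<le> epowr (ennreal b * kop \<delta> (rad t j) (\<lambda>y. ennreal (norm (f y))) x) p" .
  qed
  also have "\<dots> = ennreal (b powr p) * (\<integral>\<^sup>+x. epowr (kop \<delta> (rad t j) (\<lambda>y. ennreal (norm (f y))) x) p \<partial>M)"
    using b p by (subst epowr_mult) (auto intro!: nn_integral_cmult)
  also have "\<dots> < \<top>"
  proof -
    have "(\<integral>\<^sup>+x. epowr (kop \<delta> (rad t j) (\<lambda>y. ennreal (norm (f y))) x) p \<partial>M) < \<top>"
      using Lp_nn_integral_finite[OF f] by (intro kop_Lp_finite[OF p \<delta> t]) simp_all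
    then show ?thesis by (simp add: ennreal_mult_less_top)
  qed
  finally show "kernel_op k f \<in> Lp p M" by (simp add: Lp_def integrable_iff_bounded)
qed

lemma kernel_op_add:
  assumes f: "f \<in> Lp p M" and g: "g \<in> Lp p M"
  shows "AE x in M. kernel_op k (\<lambda>y. f y + g y) x = kernel_op k f x + kernel_op k g x"
  using kernel_integrable_AE[OF f] kernel_integrable_AE[OF g]
  by eventually_elim (simp add: kernel_op_def distrib_left)

lemma kernel_op_bounded: "Lp_bounded p M (kernel_op k)"
  unfolding Lp_bounded_def
proof (intro conjI ballI allI)
  show "kernel_op k f \<in> Lp p M" if "f \<in> Lp p M" for f
    using kernel_op_dominated that by (simp add: dominated_def)
  show "AE x in M. kernel_op k (\<lambda>y. f y + g y) x = kernel_op k f x + kernel_op k g x" if "f \<in> Lp p M" "g \<in> Lp p M" for f g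
    using that by (rule kernel_op_add)
  show "AE x in M. kernel_op k (\<lambda>y. c * f y) x = c * kernel_op k f x" if "f \<in> Lp p M" for c f
  proof (rule AE_I2)
    fix x
    have "kernel_op k (\<lambda>y. c * f y) x = (\<integral>y. c * (k x y * f y) \<partial>M)" by (simp add: kernel_op_def mult.left_commute)
    then show "kernel_op k (\<lambda>y. c * f y) x = c * kernel_op k f x" by (simp add: kernel_op_def)
  qed
  obtain C where C: "0 \<le> C" "\<And>S f. dominated p b \<delta> (rad t j) S \<Longrightarrow> f \<in> Lp p M \<Longrightarrow>
    (\<integral>x. norm (S f x) powr p \<partial>M) \<le> C * (\<integral>x. norm (f x) powr p \<partial>M)"
    using dominated_norm_bound[OF p b \<delta> t] by blast
  show "\<exists>C. \<forall>f\<in>Lp p M. Lp_norm p M (kernel_op k f) \<le> C * Lp_norm p M f"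
  proof (intro exI ballI)
    fix f assume f: "f \<in> Lp p M"
    have "Lp_norm p M (kernel_op k f) \<le> (C * (\<integral>x. norm (f x) powr p \<partial>M)) powr (1 / p)"
      unfolding Lp_norm_def using C(2)[OF kernel_op_dominated f] p
      by (intro powr_mono2) (auto intro: Bochner_Integration.integral_nonneg)
    also have "\<dots> = C powr (1 / p) * Lp_norm p M f"
      unfolding Lp_norm_def using C(1) by (simp add: powr_mult)
    finally show "Lp_norm p M (kernel_op k f) \<le> C powr (1 / p) * Lp_norm p M f" .
  qed
qed

text \<open>
  Cutting off in space and in height lands in \<open>L\<^sup>2\<close>, because balls have finite measure.
\<close>

lemma Lp_dense_truncation:
  assumes f: "f \<in> Lp p M"
  obtains F where "\<And>n. F n \<in> Lp p M" "\<And>n. F n \<in> Lp 2 M" "\<And>n. (\<lambda>y. f y - F n y) \<in> Lp p M"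
    "(\<lambda>n. \<integral>x. norm (f x - F n x) powr p \<partial>M) \<longlonglongrightarrow> 0"
proof -
  have [measurable]: "f \<in> borel_measurable M" using f by (rule Lp_measurable)
  fix x0 :: 'a
  define A where "A n = {y\<in>space M. norm (f y) \<le> real n \<and> dist x0 y < real n}" for n :: nat
  have [measurable]: "A n \<in> sets M" for n
    unfolding A_def by (rule sets.sets_Collect_conj) measurable
  define F where "F n y = f y * indicator (A n) y" for n y
  have [measurable]: "F n \<in> borel_measurable M" for n unfolding F_def by measurable
  have F_le: "norm (F n y) \<le> norm (f y)" "norm (f y - F n y) \<le> norm (f y)" for n y
    by (auto simp: F_def indicator_def)
  have Fp: "norm (F n y) powr p \<le> norm (f y) powr p" "norm (f y - F n y) powr p \<le> norm (f y) powr p" for n y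
    using F_le p by (auto intro: powr_mono2)
  have fint: "integrable M (\<lambda>y. norm (f y) powr p)" using f by (simp add: Lp_def)
  have "F n \<in> Lp p M" for n
    unfolding Lp_def using Fp by (auto intro!: Bochner_Integration.integrable_bound[OF fint])
  moreover have "F n \<in> Lp 2 M" for n
  proof -
    have "integrable M (\<lambda>y. (real n)\<^sup>2 * indicator (ball x0 (real n)) y)"
      using ball_finite by (intro integrable_mult_right integrable_real_indicator) auto
    then have "integrable M (\<lambda>y. norm (F n y) powr 2)"
      by (rule Bochner_Integration.integrable_bound)
         (auto simp: F_def A_def indicator_def powr_numeral intro!: AE_I2 power_mono)
    then show ?thesis by (simp add: Lp_def)
  qed
  moreover have "(\<lambda>y. f y - F n y) \<in> Lp p M" for n
    unfolding Lp_def using Fp by (auto intro!: Bochner_Integration.integrable_bound[OF fint])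
  moreover have "(\<lambda>n. \<integral>x. norm (f x - F n x) powr p \<partial>M) \<longlonglongrightarrow> (\<integral>x. 0 \<partial>M)"
  proof (rule integral_dominated_convergence[where w="\<lambda>y. norm (f y) powr p"])
    show "AE x in M. (\<lambda>n. norm (f x - F n x) powr p) \<longlonglongrightarrow> 0"
    proof (rule AE_I2)
      fix x
      obtain N where N: "max (norm (f x)) (dist x0 x + 1) \<le> real N" using real_arch_simple by blast
      have "eventually (\<lambda>n. norm (f x - F n x) powr p = 0) sequentially"
        using eventually_ge_at_top[of N]
      proof eventually_elim
        case (elim n)
        then have "real N \<le> real n" by simp
        then have "x \<in> A n" using N by (auto simp: A_def)
        then show ?case by (simp add: F_def)
      qed
      then show "(\<lambda>n. norm (f x - F n x) powr p) \<longlonglongrightarrow> 0" by (rule tendsto_eventually)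
    qed
  qed (use fint Fp in auto)
  ultimately show ?thesis by (intro that[of F]) simp_all
qed

text \<open>
  Both sides are bounded on \<open>L\<^sup>p\<close> and agree on the dense subspace \<open>L\<^sup>p \<inter> L\<^sup>2\<close>.
\<close>

lemma extension_eq_kernel_op:
  assumes kernel: "has_integral_kernel M T k" and S: "S \<in> Lp_extensions p M T" and f: "f \<in> Lp p M"
  shows "AE x in M. S f x = kernel_op k f x"
proof -
  have T_eq: "AE x in M. T g x = kernel_op k g x" if "g \<in> Lp 2 M" for g
    using kernel that unfolding has_integral_kernel_def kernel_op_def by (auto elim: eventually_mono)
  have Sb: "Lp_bounded p M S" and S_ext: "\<And>g. g \<in> Lp p M \<Longrightarrow> g \<in> Lp 2 M \<Longrightarrow> AE x in M. S g x = T g x"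
    using S by (auto simp: Lp_extensions_def)
  obtain C0 where C0: "\<And>g. g \<in> Lp p M \<Longrightarrow> Lp_norm p M (S g) \<le> C0 * Lp_norm p M g"
    using Sb unfolding Lp_bounded_def by blast
  have S_Lp: "S g \<in> Lp p M" if "g \<in> Lp p M" for g using Sb that unfolding Lp_bounded_def by blast
  have k_Lp: "kernel_op k g \<in> Lp p M" if "g \<in> Lp p M" for g using kernel_op_bounded that unfolding Lp_bounded_def by blast
  have I0: "0 \<le> (\<integral>x. norm (h x) powr p \<partial>M)" for h :: "'a \<Rightarrow> complex" by (rule Bochner_Integration.integral_nonneg) simp
  have root: "Lp_norm p M h powr p = (\<integral>x. norm (h x) powr p \<partial>M)" for h
    using I0[of h] p by (simp add: Lp_norm_def powr_powr)
  have S_int: "(\<integral>x. norm (S g x) powr p \<partial>M) \<le> \<bar>C0\<bar> powr p * (\<integral>x. norm (g x) powr p \<partial>M)" if g: "g \<in> Lp p M" for g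
  proof -
    have n0: "0 \<le> Lp_norm p M h" for h by (simp add: Lp_norm_def)
    have "Lp_norm p M (S g) \<le> \<bar>C0\<bar> * Lp_norm p M g"
      using C0[OF g] n0[of g] by (meson abs_ge_self mult_right_mono order_trans)
    then have "Lp_norm p M (S g) powr p \<le> (\<bar>C0\<bar> * Lp_norm p M g) powr p"
      using n0 p by (intro powr_mono2) auto
    then show ?thesis using n0 by (simp add: powr_mult root)
  qed
  obtain C1 where C1: "0 \<le> C1" "\<And>S f. dominated p b \<delta> (rad t j) S \<Longrightarrow> f \<in> Lp p M \<Longrightarrow>
    (\<integral>x. norm (S f x) powr p \<partial>M) \<le> C1 * (\<integral>x. norm (f x) powr p \<partial>M)"
    using dominated_norm_bound[OF p b \<delta> t] by blast
  obtain F where F: "\<And>n. F n \<in> Lp p M" "\<And>n. F n \<in> Lp 2 M" "\<And>n. (\<lambda>y. f y - F n y) \<in> Lp p M"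
    "(\<lambda>n. \<integral>x. norm (f x - F n x) powr p \<partial>M) \<longlonglongrightarrow> 0"
    using Lp_dense_truncation[OF f] by blast
  define D where "D x = S f x - kernel_op k f x" for x
  have [measurable]: "S f \<in> borel_measurable M" "kernel_op k f \<in> borel_measurable M"
    using S_Lp[OF f] k_Lp[OF f] by (auto simp: Lp_def)
  \<comment> \<open>The truncation \<open>F n\<close> cancels, so that only the remainder \<open>f - F n\<close> is seen by the two operators.\<close>
  have bound: "(\<integral>\<^sup>+x. ennreal (norm (D x) powr p) \<partial>M) \<le> ennreal (2 powr p * (\<bar>C0\<bar> powr p + C1) * (\<integral>x. norm (f x - F n x) powr p \<partial>M))" for n
  proof -
    define g where "g y = f y - F n y" for y
    have g: "g \<in> Lp p M" unfolding g_def by (rule F(3))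
    have fg: "(\<lambda>y. F n y + g y) = f" by (simp add: g_def)
    have S1: "AE x in M. S f x = S (F n) x + S g x"
      using Sb F(1) g unfolding Lp_bounded_def by (metis fg)
    have k1: "AE x in M. kernel_op k f x = kernel_op k (F n) x + kernel_op k g x"
      using kernel_op_add[OF F(1) g, of n] unfolding fg .
    have "AE x in M. ennreal (norm (D x) powr p) \<le> ennreal (2 powr p) * (ennreal (norm (S g x) powr p) + ennreal (norm (kernel_op k g x) powr p))"
      using S1 k1 S_ext[OF F(1,2), of n] T_eq[OF F(2), of n]
    proof eventually_elim
      case (elim x)
      have "D x = S g x - kernel_op k g x" using elim by (simp add: D_def)
      then have "norm (D x) \<le> norm (S g x) + norm (kernel_op k g x)" by (simp add: norm_triangle_ineq4)
      then have "norm (D x) powr p \<le> (norm (S g x) + norm (kernel_op k g x)) powr p" using p by (intro powr_mono2) auto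
      also have "\<dots> \<le> 2 powr p * (norm (S g x) powr p + norm (kernel_op k g x) powr p)"
        using p by (intro add_powr_le) auto
      finally have "ennreal (norm (D x) powr p) \<le> ennreal (2 powr p * (norm (S g x) powr p + norm (kernel_op k g x) powr p))"
        by (rule ennreal_leI)
      then show ?case by (simp add: ennreal_mult)
    qed
    then have "(\<integral>\<^sup>+x. ennreal (norm (D x) powr p) \<partial>M) \<le> (\<integral>\<^sup>+x. ennreal (2 powr p) * (ennreal (norm (S g x) powr p) + ennreal (norm (kernel_op k g x) powr p)) \<partial>M)"
      by (rule nn_integral_mono_AE)
    also have "\<dots> = ennreal (2 powr p) * ((\<integral>\<^sup>+x. ennreal (norm (S g x) powr p) \<partial>M) + (\<integral>\<^sup>+x. ennreal (norm (kernel_op k g x) powr p) \<partial>M))"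
      using Lp_measurable[OF S_Lp[OF g]] Lp_measurable[OF k_Lp[OF g]] by (simp add: nn_integral_cmult nn_integral_add)
    also have "\<dots> = ennreal (2 powr p) * (ennreal (\<integral>x. norm (S g x) powr p \<partial>M) + ennreal (\<integral>x. norm (kernel_op k g x) powr p \<partial>M))"
      using S_Lp[OF g] k_Lp[OF g] by (simp add: Lp_def nn_integral_eq_integral)
    also have "\<dots> = ennreal (2 powr p * ((\<integral>x. norm (S g x) powr p \<partial>M) + (\<integral>x. norm (kernel_op k g x) powr p \<partial>M)))"
      using I0 by (simp add: ennreal_mult)
    also have "\<dots> \<le> ennreal (2 powr p * (\<bar>C0\<bar> powr p * (\<integral>x. norm (g x) powr p \<partial>M) + C1 * (\<integral>x. norm (g x) powr p \<partial>M)))"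
      using S_int[OF g] C1(2)[OF kernel_op_dominated g] by (intro ennreal_leI mult_left_mono add_mono) auto
    also have "2 powr p * (\<bar>C0\<bar> powr p * (\<integral>x. norm (g x) powr p \<partial>M) + C1 * (\<integral>x. norm (g x) powr p \<partial>M))
      = 2 powr p * (\<bar>C0\<bar> powr p + C1) * (\<integral>x. norm (f x - F n x) powr p \<partial>M)"
      by (simp add: g_def algebra_simps)
    finally show ?thesis .
  qed
  have "(\<lambda>n. ennreal (2 powr p * (\<bar>C0\<bar> powr p + C1) * (\<integral>x. norm (f x - F n x) powr p \<partial>M))) \<longlonglongrightarrow> ennreal (2 powr p * (\<bar>C0\<bar> powr p + C1) * 0)"
    by (intro tendsto_ennrealI tendsto_mult tendsto_const F(4))
  then have "(\<integral>\<^sup>+x. ennreal (norm (D x) powr p) \<partial>M) \<le> ennreal (2 powr p * (\<bar>C0\<bar> powr p + C1) * 0)"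
    by (rule LIMSEQ_le_const) (use bound in auto)
  then have "(\<integral>\<^sup>+x. ennreal (norm (D x) powr p) \<partial>M) = 0" by simp
  moreover have [measurable]: "D \<in> borel_measurable M" unfolding D_def by measurable
  ultimately have "AE x in M. ennreal (norm (D x) powr p) = 0" by (subst (asm) nn_integral_0_iff_AE) auto
  then show ?thesis by eventually_elim (auto simp: D_def ennreal_eq_0_iff)
qed

lemma extensions_dominated:
  assumes kernel: "has_integral_kernel M T k"
  shows "kernel_op k \<in> Lp_extensions p M T"
    and "\<And>S. S \<in> Lp_extensions p M T \<Longrightarrow> dominated p b \<delta> (rad t j) S"
proof -
  show "kernel_op k \<in> Lp_extensions p M T"
    using kernel kernel_op_bounded unfolding has_integral_kernel_def Lp_extensions_def kernel_op_def
    by (auto elim: eventually_mono)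
  fix S assume S: "S \<in> Lp_extensions p M T"
  show "dominated p b \<delta> (rad t j) S"
    unfolding dominated_def
  proof (intro ballI conjI)
    fix f assume f: "f \<in> Lp p M"
    show "S f \<in> Lp p M" using S f by (auto simp: Lp_extensions_def Lp_bounded_def)
    have "AE x in M. ennreal (norm (kernel_op k f x)) \<le> ennreal b * kop \<delta> (rad t j) (\<lambda>y. ennreal (norm (f y))) x"
      using kernel_op_dominated f by (auto simp: dominated_def)
    then show "AE x in M. ennreal (norm (S f x)) \<le> ennreal b * kop \<delta> (rad t j) (\<lambda>y. ennreal (norm (f y))) x"
      using extension_eq_kernel_op[OF kernel S f] by eventually_elim simp
  qed
qed

end

end

section \<open>Consequences of the volume conditions\<close>

text \<open>
  Mean value theorem. The two summands of the constant belong to \<open>d \<ge> 1\<close> and \<open>d < 1\<close>; the estimate has to cover both,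
  because it is used to show that \<open>d \<ge> 1\<close>.
\<close>

lemma powr_diff_le:
  fixes d r R :: real
  assumes d: "0 < d" and r: "0 < r" "R / 2 < r" "r < R"
  shows "R powr d - r powr d \<le> d * (1 + 2 powr (1 - d)) * (R - r) * R powr (d - 1)"
proof -
  have "\<exists>z. r < z \<and> z < R \<and> R powr d - r powr d = (R - r) * (d * z powr (d - 1))"
  proof (rule MVT2)
    fix x assume "r \<le> x" "x \<le> R"
    then show "DERIV (\<lambda>x. x powr d) x :> d * x powr (d - 1)"
      using r by (intro has_real_derivative_powr) auto
  qed (use r in auto)
  then obtain z where z: "r < z" "z < R" and eq: "R powr d - r powr d = (R - r) * (d * z powr (d - 1))" by blast
  have R: "0 < R" using r by simp
  have "z powr (d - 1) \<le> R powr (d - 1) + (R / 2) powr (d - 1)"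
  proof (cases "1 \<le> d")
    case True
    then have "z powr (d - 1) \<le> R powr (d - 1)" using z r by (intro powr_mono2) auto
    then show ?thesis by (simp add: add_increasing2)
  next
    case False
    then have "z powr (d - 1) \<le> (R / 2) powr (d - 1)" using z r R by (intro powr_mono2') auto
    then show ?thesis by (simp add: add_increasing)
  qed
  also have "(R / 2) powr (d - 1) = 2 powr (1 - d) * R powr (d - 1)"
  proof -
    have "(R / 2) powr (d - 1) = R powr (d - 1) * (1 / 2 powr (d - 1))" using R by (simp add: powr_divide)
    also have "1 / 2 powr (d - 1) = (2::real) powr (- (d - 1))" by (rule powr_minus_divide[symmetric])
    finally show ?thesis by (simp add: mult.commute)
  qed
  finally have "z powr (d - 1) \<le> (1 + 2 powr (1 - d)) * R powr (d - 1)" by (simp add: algebra_simps)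
  then have "(R - r) * (d * z powr (d - 1)) \<le> (R - r) * (d * ((1 + 2 powr (1 - d)) * R powr (d - 1)))"
    using d r by (intro mult_left_mono) auto
  then show ?thesis unfolding eq by (simp only: mult_ac)
qed

text \<open>
  The common part of the bounded and the unbounded case. In a bounded space the factor \<open>min (R\<^bsup>d-1\<^esup>) 1\<close> is weakened to \<open>R\<^bsup>d-1\<^esup>\<close>, and the
  lower bound for balls stops at radius one.
\<close>

lemma volume_conditions_measure:
  fixes M :: "'a::metric_space measure"
  assumes d: "0 < d" and hom: "homogeneous_type M" and V1: "volume_V1 d M" and V2: "volume_V2 d M"
  obtains c V D where "0 < c" "0 < V" "1 \<le> D"
    "\<And>x r. emeasure M (ball x r) < \<infinity>"
    "\<And>x r. 0 < r \<Longrightarrow> c * min (r powr d) 1 \<le> measure M (ball x r)"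
    "\<And>x r. ediam (UNIV :: 'a set) = \<infinity> \<Longrightarrow> 0 < r \<Longrightarrow> c * r powr d \<le> measure M (ball x r)"
    "\<And>x r. 0 < r \<Longrightarrow> measure M (ball x r) \<le> V * r powr d"
    "\<And>x r. 0 < r \<Longrightarrow> measure M (ball x (2 * r)) \<le> D * measure M (ball x r)"
    "\<And>x r R. 0 < R \<Longrightarrow> R / 2 < r \<Longrightarrow> r < R \<Longrightarrow> measure M (annulus x r R) \<le> V * (R - r) * R powr (d - 1)"
proof -
  define v where "v r = (if ediam (UNIV :: 'a set) = \<infinity> then r powr d else min (r powr d) 1)" for r
  obtain c C where cC: "0 < c" "0 < C"
    and bounds: "\<And>x r. 0 < r \<Longrightarrow> ennreal (c * v r) \<le> emeasure M (ball x r)"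
      "\<And>x r. 0 < r \<Longrightarrow> emeasure M (ball x r) \<le> ennreal (C * v r)"
    using V1 unfolding volume_V1_def Let_def v_def by metis
  have v0: "0 \<le> v r" for r by (simp add: v_def)
  have finite_ball: "emeasure M (ball x r) < \<infinity>" for x r
  proof (cases "0 < r")
    case True
    then show ?thesis using bounds(2)[OF True, of x] by (simp add: le_less_trans)
  next
    case False
    then have "ball x r = {}" by (intro ball_empty) simp
    then show ?thesis by (simp only: emeasure_empty) simp
  qed
  have em: "emeasure M (ball x r) = ennreal (measure M (ball x r))" for x r
    using finite_ball[of x r] by (intro emeasure_eq_ennreal_measure) auto
  have low: "c * v r \<le> measure M (ball x r)" if "0 < r" for x r
    using bounds(1)[OF that, of x] unfolding em by (subst (asm) ennreal_le_iff) auto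
  have up: "measure M (ball x r) \<le> C * v r" if "0 < r" for x r
    using bounds(2)[OF that, of x] cC v0[of r] unfolding em by (subst (asm) ennreal_le_iff) auto
  obtain D where D: "0 < D" "\<And>x r. 0 < r \<Longrightarrow> emeasure M (ball x (2 * r)) \<le> ennreal D * emeasure M (ball x r)"
    using hom unfolding homogeneous_type_def by blast
  have doubling: "measure M (ball x (2 * r)) \<le> max D 1 * measure M (ball x r)" if "0 < r" for x r
  proof -
    have "ennreal (measure M (ball x (2 * r))) \<le> ennreal (D * measure M (ball x r))"
      using D(2)[OF that, of x] D(1) unfolding em by (simp add: ennreal_mult)
    then have "measure M (ball x (2 * r)) \<le> D * measure M (ball x r)"
      using D(1) by (subst (asm) ennreal_le_iff) auto
    also have "\<dots> \<le> max D 1 * measure M (ball x r)" by (intro mult_right_mono) auto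
    finally show ?thesis .
  qed
  obtain C2 where C2: "0 < C2" "if ediam (UNIV :: 'a set) = \<infinity>
      then \<forall>x r R. 0 < r \<and> r < R \<longrightarrow> emeasure M (annulus x r R) \<le> ennreal (C2 * (R powr d - r powr d))
      else \<forall>x r R. 0 < R / 2 \<and> R / 2 < r \<and> r < R \<longrightarrow>
             emeasure M (annulus x r R) \<le> ennreal (C2 * (R - r) * min (R powr (d - 1)) 1)"
    using V2 unfolding volume_V2_def by blast
  define V where "V = C + C2 + C2 * (d * (1 + 2 powr (1 - d)))"
  have "0 < C2 * (d * (1 + 2 powr (1 - d)))" using C2(1) d by (intro mult_pos_pos add_pos_nonneg) auto
  then have Vpos: "0 < V" and VC: "C \<le> V" "C2 \<le> V" "C2 * (d * (1 + 2 powr (1 - d))) \<le> V"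
    using cC(2) C2(1) unfolding V_def by linarith+
  show ?thesis
  proof (rule that[OF cC(1) Vpos _ finite_ball])
    show "1 \<le> max D 1" by simp
    fix x :: 'a and r :: real
    show "c * min (r powr d) 1 \<le> measure M (ball x r)" if "0 < r"
    proof -
      have "c * min (r powr d) 1 \<le> c * v r" using cC by (intro mult_left_mono) (auto simp: v_def)
      then show ?thesis using low[OF that, of x] by linarith
    qed
    show "c * r powr d \<le> measure M (ball x r)" if "ediam (UNIV :: 'a set) = \<infinity>" "0 < r"
      using low[OF that(2), of x] that(1) by (simp add: v_def)
    show "measure M (ball x r) \<le> V * r powr d" if "0 < r"
    proof -
      have "C * v r \<le> V * r powr d" using VC(1) cC Vpos v0[of r] by (intro mult_mono) (auto simp: v_def)
      then show ?thesis using up[OF that, of x] by linarith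
    qed
    show "measure M (ball x (2 * r)) \<le> max D 1 * measure M (ball x r)" if "0 < r"
      using doubling[OF that] .
    fix R :: real assume R: "0 < R" "R / 2 < r" "r < R"
    have r: "0 < r" using R by simp
    define u where "u = V * (R - r) * R powr (d - 1)"
    have u: "0 \<le> u" using Vpos R by (simp add: u_def)
    have "emeasure M (annulus x r R) \<le> ennreal u"
    proof (cases "ediam (UNIV :: 'a set) = \<infinity>")
      case True
      have "C2 * (R powr d - r powr d) \<le> C2 * (d * (1 + 2 powr (1 - d)) * (R - r) * R powr (d - 1))"
        using C2(1) powr_diff_le[OF d r R(2,3)] by (intro mult_left_mono) auto
      also have "\<dots> = (C2 * (d * (1 + 2 powr (1 - d)))) * ((R - r) * R powr (d - 1))" by (simp only: mult_ac)
      also have "\<dots> \<le> V * ((R - r) * R powr (d - 1))" using VC R by (intro mult_right_mono) auto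
      finally have "ennreal (C2 * (R powr d - r powr d)) \<le> ennreal u" by (intro ennreal_leI) (simp add: u_def mult.assoc)
      moreover have "emeasure M (annulus x r R) \<le> ennreal (C2 * (R powr d - r powr d))" using C2(2) True r R by simp
      ultimately show ?thesis by (rule order_trans[rotated])
    next
      case False
      have "C2 * (R - r) * min (R powr (d - 1)) 1 \<le> u"
        unfolding u_def using VC R C2(1) Vpos by (intro mult_mono) auto
      then have "ennreal (C2 * (R - r) * min (R powr (d - 1)) 1) \<le> ennreal u" by (rule ennreal_leI)
      moreover have "emeasure M (annulus x r R) \<le> ennreal (C2 * (R - r) * min (R powr (d - 1)) 1)" using C2(2) False R by simp
      ultimately show ?thesis by (rule order_trans[rotated])
    qed
    then show "measure M (annulus x r R) \<le> V * (R - r) * R powr (d - 1)"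
      unfolding measure_def u_def[symmetric] using u by (rule enn2real_leI[rotated])
  qed
qed

text \<open>
  Thin annuli of thickness \<open>2 e\<close> contain balls of radius \<open>e\<close>, hence \<open>e\<^sup>d = O(e)\<close> for small \<open>e\<close>, which forces \<open>d \<ge> 1\<close>. Such balls exist as
  soon as there are two points; a single point has all balls equal, and their volume cannot tend to zero.
\<close>

lemma dimension_ge_1:
  fixes M :: "'a::metric_space measure"
  assumes sets: "sets M = sets borel" and d: "0 < d" and c: "0 < c" and V: "0 < V"
    and fin: "\<And>x r. emeasure M (ball x r) < \<infinity>"
    and low: "\<And>x r. 0 < r \<Longrightarrow> c * min (r powr d) 1 \<le> measure M (ball x r)"
    and up: "\<And>x r. 0 < r \<Longrightarrow> measure M (ball x r) \<le> V * r powr d"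
    and ann: "\<And>x r R. 0 < R \<Longrightarrow> R / 2 < r \<Longrightarrow> r < R \<Longrightarrow> measure M (annulus x r R) \<le> V * (R - r) * R powr (d - 1)"
  shows "1 \<le> d"
proof (rule ccontr)
  assume "\<not> 1 \<le> d"
  then have d1: "d < 1" by simp
  have small: "\<exists>e>0. e < b \<and> a * e powr s < c" if "0 < a" "0 < s" "0 < b" for a s b :: real
  proof -
    define e where "e = min (b / 2) ((c / (2 * a)) powr (1 / s))"
    have e: "0 < e" "e < b" using that c by (auto simp: e_def)
    have "e powr s \<le> ((c / (2 * a)) powr (1 / s)) powr s" using that e by (intro powr_mono2) (auto simp: e_def)
    also have "\<dots> = c / (2 * a)" using that c by (simp add: powr_powr)
    finally have "a * e powr s \<le> c / 2" using that by (simp add: field_simps)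
    then show ?thesis using e c by (intro exI[of _ e]) auto
  qed
  show False
  proof (cases "\<exists>x y :: 'a. x \<noteq> y")
    case False
    fix x :: 'a
    have one: "ball x r = ball x 1" if "0 < r" for r
    proof -
      have "z \<in> ball x r \<longleftrightarrow> z \<in> ball x 1" for z
      proof -
        have "z = x" using False by blast
        then show ?thesis using that by simp
      qed
      then show ?thesis by blast
    qed
    obtain e where e: "0 < e" "V * e powr d < c" using small[OF V d zero_less_one] by blast
    have "c \<le> measure M (ball x 1)" using low[of 1 x] by simp
    also have "\<dots> \<le> V * e powr d" using up[OF e(1), of x] one[OF e(1)] by simp
    finally show False using e by simp
  next
    case True
    then obtain x y :: 'a where "x \<noteq> y" by blast
    define \<rho> where "\<rho> = dist x y"
    have \<rho>: "0 < \<rho>" using \<open>x \<noteq> y\<close> by (simp add: \<rho>_def)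
    have "0 < 2 * V * \<rho> powr (d - 1)" "0 < 1 - d" "0 < min (\<rho> / 4) 1" using V \<rho> d1 by auto
    from small[OF this] obtain e where e: "0 < e" "e < \<rho> / 4" "e < 1" "2 * V * \<rho> powr (d - 1) * e powr (1 - d) < c"
      by auto
    have sub: "ball y e \<subseteq> annulus x (\<rho> - e) (\<rho> + e)"
    proof
      fix z assume "z \<in> ball y e"
      then have "dist y z < e" by simp
      moreover have "dist x z \<le> \<rho> + dist y z" "\<rho> \<le> dist x z + dist y z"
        using dist_triangle[of x z y] dist_triangle2[of x y z] by (simp_all add: \<rho>_def dist_commute)
      ultimately show "z \<in> annulus x (\<rho> - e) (\<rho> + e)" by (simp add: annulus_def)
    qed
    have "c * e powr d = c * min (e powr d) 1"
      using e d powr_le1[of d e] by simp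
    also have "\<dots> \<le> measure M (ball y e)" using low[OF e(1)] .
    also have "\<dots> \<le> measure M (annulus x (\<rho> - e) (\<rho> + e))"
    proof (rule measure_mono_fmeasurable[OF sub])
      have "emeasure M (annulus x (\<rho> - e) (\<rho> + e)) \<le> emeasure M (ball x (\<rho> + e))"
        by (intro emeasure_mono) (auto simp: annulus_def sets)
      also have "\<dots> < \<infinity>" by (rule fin)
      finally show "annulus x (\<rho> - e) (\<rho> + e) \<in> fmeasurable M"
        by (simp add: fmeasurable_def annulus_def sets)
    qed (simp add: sets)
    also have "\<dots> \<le> V * ((\<rho> + e) - (\<rho> - e)) * (\<rho> + e) powr (d - 1)" using e \<rho> by (intro ann) auto
    also have "\<dots> \<le> V * (2 * e) * \<rho> powr (d - 1)"
      using V e \<rho> d1 by (intro mult_mono powr_mono2') auto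
    also have "\<dots> = (2 * V * \<rho> powr (d - 1) * e powr (1 - d)) * e powr d"
      using e(1) by (simp add: powr_add[symmetric])
    finally have "c * e powr d \<le> (2 * V * \<rho> powr (d - 1) * e powr (1 - d)) * e powr d" .
    then have "c \<le> 2 * V * \<rho> powr (d - 1) * e powr (1 - d)" using e(1) by (subst (asm) mult_le_cancel_right) auto
    then show False using e by simp
  qed
qed

text \<open>
  Only finitely many disjoint balls of one radius fit into a ball of finite measure, so maximal families of disjoint
  balls are countable, and their centres form nets.
\<close>

lemma separable_of_ball_lower_bound:
  fixes M :: "'a::metric_space measure"
  assumes sets: "sets M = sets borel"
    and fin: "\<And>x r. emeasure M (ball x r) < \<infinity>"
    and low: "\<And>r. 0 < r \<Longrightarrow> \<exists>m>0. \<forall>x. m \<le> measure M (ball x r)"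
  shows "\<exists>S::'a set. countable S \<and> (\<forall>x. \<forall>e>0. \<exists>y\<in>S. dist x y < e)"
proof -
  have net: "\<exists>P::'a set. countable P \<and> (\<forall>x. \<exists>p\<in>P. dist x p < 2 * e)" if e: "0 < e" for e
  proof -
    obtain P :: "'a set" where disj: "disjoint_family_on (\<lambda>x. ball x e) P"
      and cover: "\<And>x. \<exists>p\<in>P. ball x e \<inter> ball p e \<noteq> {}"
      using Vitali_selection[of UNIV "\<lambda>x. ball x e" "\<lambda>_. 0" 0] e by (metis UNIV_I centre_in_ball empty_iff order_refl)
    obtain m where m: "0 < m" "\<And>x. m \<le> measure M (ball x e)" using low[OF e] by blast
    fix x0 :: 'a
    have "finite (P \<inter> ball x0 (real N))" for N :: nat
    proof (rule finite_if_finite_subsets_card_bdd[THEN conjunct1])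
      fix Q assume Q: "Q \<subseteq> P \<inter> ball x0 (real N)" "finite Q"
      have fm: "ball x r \<in> fmeasurable M" for x r using fin by (simp add: fmeasurable_def sets)
      have dQ: "disjoint_family_on (\<lambda>x. ball x e) Q" using disj Q by (auto simp: disjoint_family_on_def)
      have "real (card Q) * m \<le> (\<Sum>p\<in>Q. measure M (ball p e))"
        using m(2) sum_bounded_below[of Q m "\<lambda>p. measure M (ball p e)"] by simp
      also have "\<dots> = measure M (\<Union>p\<in>Q. ball p e)"
        using Q(2) fin by (intro measure_finite_Union[symmetric] dQ) (auto simp: sets less_top[symmetric])
      also have "\<dots> \<le> measure M (ball x0 (real N + e))"
      proof (rule measure_mono_fmeasurable)
        show "(\<Union>p\<in>Q. ball p e) \<subseteq> ball x0 (real N + e)"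
        proof (rule UN_least, rule subsetI)
          fix p z assume "p \<in> Q" "z \<in> ball p e"
          then have "dist x0 p < real N" "dist p z < e" using Q by auto
          then show "z \<in> ball x0 (real N + e)" using dist_triangle[of x0 z p] by simp
        qed
      qed (auto simp: sets fm intro!: borel_open open_UN)
      finally have "real (card Q) \<le> measure M (ball x0 (real N + e)) / m" using m(1) by (simp add: field_simps)
      then show "card Q \<le> nat \<lceil>measure M (ball x0 (real N + e)) / m\<rceil>" by linarith
    qed
    then have "countable (\<Union>N::nat. P \<inter> ball x0 (real N))" by (intro countable_UN) (auto intro: countable_finite)
    moreover have "(\<Union>N::nat. P \<inter> ball x0 (real N)) = P" using reals_Archimedean2 by auto
    ultimately have "countable P" by simp
    moreover have "\<exists>p\<in>P. dist x p < 2 * e" for x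
    proof -
      obtain p z where "p \<in> P" "dist x z < e" "dist p z < e" using cover[of x] by auto
      then show ?thesis using dist_triangle2[of x p z] by (intro bexI[of _ p]) auto
    qed
    ultimately show ?thesis by blast
  qed
  have "\<forall>n::nat. \<exists>P::'a set. countable P \<and> (\<forall>x. \<exists>p\<in>P. dist x p < 2 * inverse (real (Suc n)))"
    using net by simp
  then obtain P :: "nat \<Rightarrow> 'a set" where P: "\<And>n. countable (P n)" "\<And>n x. \<exists>p\<in>P n. dist x p < 2 * inverse (real (Suc n))"
    by metis
  have "\<exists>y\<in>(\<Union>n. P n). dist x y < e" if "0 < e" for x e
  proof -
    obtain n where n: "inverse (real (Suc n)) < e / 2" using reals_Archimedean[of "e / 2"] \<open>0 < e\<close> by auto
    obtain p where "p \<in> P n" "dist x p < 2 * inverse (real (Suc n))" using P(2) by blast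
    then show ?thesis using n by (intro bexI[of _ p]) auto
  qed
  then show ?thesis using P(1) by (intro exI[of _ "\<Union>n. P n"]) auto
qed

section \<open>Rays in the right half-plane\<close>

text \<open>
  \<open>\<bar>1 + s\<^sup>2 e\<^bsup>-2i\<theta>\<^esup>\<bar>\<^sup>2 = 1 + 2 s\<^sup>2 cos 2\<theta> + s\<^sup>4 = (1 - s\<^sup>2)\<^sup>2 + 4 s\<^sup>2 cos\<^sup>2 \<theta>\<close>.
\<close>

lemma ray_kernel_factor:
  fixes \<theta> r \<rho> d :: real
  assumes r: "0 < r"
  shows "1 / norm (1 + complex_of_real (\<rho>\<^sup>2) / (cis \<theta> * complex_of_real r)\<^sup>2) powr ((d + 1) / 2) = profile d (cos \<theta>) (\<rho> / r)"
proof -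
  define s where "s = \<rho> / r"
  have "complex_of_real (\<rho>\<^sup>2) / (cis \<theta> * complex_of_real r)\<^sup>2 = complex_of_real (s\<^sup>2) * cis (- (2 * \<theta>))"
  proof -
    have "(cis \<theta>)\<^sup>2 = cis (2 * \<theta>)" by (simp add: power2_eq_square cis_mult)
    then have "complex_of_real (\<rho>\<^sup>2) / (cis \<theta> * complex_of_real r)\<^sup>2 = complex_of_real (s\<^sup>2) / cis (2 * \<theta>)"
      by (simp add: power_mult_distrib s_def power_divide field_simps)
    also have "\<dots> = complex_of_real (s\<^sup>2) * cis (- (2 * \<theta>))" by (simp add: divide_inverse cis_inverse)
    finally show ?thesis .
  qed
  then have "(norm (1 + complex_of_real (\<rho>\<^sup>2) / (cis \<theta> * complex_of_real r)\<^sup>2))\<^sup>2 = (1 + s\<^sup>2 * cos (2 * \<theta>))\<^sup>2 + (s\<^sup>2 * sin (2 * \<theta>))\<^sup>2"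
    by (simp add: cmod_power2)
  also have "\<dots> = 1 + 2 * s\<^sup>2 * cos (2 * \<theta>) + (s\<^sup>2)\<^sup>2 * ((cos (2 * \<theta>))\<^sup>2 + (sin (2 * \<theta>))\<^sup>2)"
  proof -
    have "(1 + u * a)\<^sup>2 + (u * b)\<^sup>2 = 1 + 2 * u * a + u\<^sup>2 * (a\<^sup>2 + b\<^sup>2)" for u a b :: real
      by (simp add: power2_eq_square algebra_simps)
    then show ?thesis .
  qed
  also have "\<dots> = (1 - s\<^sup>2)\<^sup>2 + 4 * s\<^sup>2 * (cos \<theta>)\<^sup>2"
  proof -
    have "(cos (2 * \<theta>))\<^sup>2 + (sin (2 * \<theta>))\<^sup>2 = 1" by simp
    moreover have "cos (2 * \<theta>) = 2 * (cos \<theta>)\<^sup>2 - 1" by (rule cos_double_cos)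
    moreover have "1 + 2 * u * (2 * v - 1) + u\<^sup>2 * 1 = (1 - u)\<^sup>2 + 4 * u * v" for u v :: real
      by (simp add: power2_eq_square algebra_simps)
    ultimately show ?thesis by (simp only:)
  qed
  finally have sq: "(norm (1 + complex_of_real (\<rho>\<^sup>2) / (cis \<theta> * complex_of_real r)\<^sup>2))\<^sup>2 = (1 - s\<^sup>2)\<^sup>2 + 4 * s\<^sup>2 * (cos \<theta>)\<^sup>2" .
  have root: "1 / n powr ((d + 1) / 2) = (n\<^sup>2) powr (- (d + 1) / 4)" if "0 \<le> n" for n :: real
  proof -
    have "(n\<^sup>2) powr (- (d + 1) / 4) = (n powr 2) powr (- (d + 1) / 4)" using that by (cases "n = 0") (simp_all add: powr_numeral)
    also have "\<dots> = n powr (2 * (- (d + 1) / 4))" by (rule powr_powr)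
    also have "2 * (- (d + 1) / 4) = - ((d + 1) / 2)" by (simp add: field_simps)
    also have "n powr (- ((d + 1) / 2)) = 1 / n powr ((d + 1) / 2)" by (rule powr_minus_divide)
    finally show ?thesis by simp
  qed
  show ?thesis unfolding root[OF norm_ge_zero] sq profile_def s_def ..
qed

lemma profile_comparable_near_0:
  assumes d: "0 < d" and \<delta>: "0 < \<delta>" "\<delta> \<le> 1" and s: "0 \<le> s" "s \<le> 1/2" and s': "0 \<le> s'" "s' \<le> 1/2"
  shows "profile d \<delta> s \<le> 2 powr (2 * (d + 1)) * profile d \<delta> s'"
proof -
  have sq: "u\<^sup>2 \<le> 1/4" if "0 \<le> u" "u \<le> 1/2" for u :: real
    using power_mono[of u "1/2" 2] that by (simp add: power2_eq_square)
  have "(1/2)\<^sup>2 \<le> (1 - s\<^sup>2)\<^sup>2" using sq[OF s] by (intro power_mono) auto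
  moreover have "(1/2::real) ^ 4 \<le> (1/2)\<^sup>2" by (simp add: power2_eq_square power4_eq_xxxx)
  moreover have "0 \<le> 4 * s\<^sup>2 * \<delta>\<^sup>2" by simp
  ultimately have "(1/2) ^ 4 \<le> (1 - s\<^sup>2)\<^sup>2 + 4 * s\<^sup>2 * \<delta>\<^sup>2" by linarith
  from powr_neg_quarter_le[OF d _ this]
  have 1: "profile d \<delta> s \<le> (1/2) powr (- (d + 1))" by (simp add: profile_def)
  have half: "(1/2::real) = 2 powr (- 1)" by (simp add: powr_minus_divide)
  have "(1/2::real) powr (- (d + 1)) = 2 powr (d + 1)" unfolding half powr_powr by (simp add: add.commute)
  with 1 have upper: "profile d \<delta> s \<le> 2 powr (d + 1)" by simp
  have b: "(1 - s'\<^sup>2)\<^sup>2 + 4 * s'\<^sup>2 * \<delta>\<^sup>2 \<le> 16"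
  proof -
    have "(1 - s'\<^sup>2)\<^sup>2 \<le> 1\<^sup>2" using sq[OF s'] by (intro power_mono) auto
    moreover have "\<delta>\<^sup>2 \<le> 1" using \<delta> by (simp add: power_le_one)
    then have "4 * s'\<^sup>2 * \<delta>\<^sup>2 \<le> (4 * (1/4)) * 1" using sq[OF s'] by (intro mult_mono) auto
    ultimately show ?thesis by simp
  qed
  have b0: "0 < (1 - s'\<^sup>2)\<^sup>2 + 4 * s'\<^sup>2 * \<delta>\<^sup>2"
  proof -
    have "0 < (1 - s'\<^sup>2)\<^sup>2" using sq[OF s'] by (intro zero_less_power) auto
    then show ?thesis by (simp add: add_pos_nonneg)
  qed
  have "2 powr (- (d + 1)) = (16::real) powr (- (d + 1) / 4)"
  proof -
    have "(16::real) = 2 powr 4" by (simp add: powr_numeral)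
    then have "(16::real) powr (- (d + 1) / 4) = 2 powr (4 * (- (d + 1) / 4))" by (simp only: powr_powr)
    moreover have "4 * (- (d + 1) / 4) = - (d + 1)" by (simp add: field_simps)
    ultimately show ?thesis by (simp only:)
  qed
  also have "\<dots> \<le> profile d \<delta> s'" unfolding profile_def using b b0 d by (intro powr_mono2') auto
  finally have "2 powr (2 * (d + 1)) * 2 powr (- (d + 1)) \<le> 2 powr (2 * (d + 1)) * profile d \<delta> s'"
    by (intro mult_left_mono) auto
  moreover have "2 powr (2 * (d + 1)) * 2 powr (- (d + 1)) = (2::real) powr (d + 1)"
  proof -
    have "2 * (d + 1) + - (d + 1) = d + 1" by simp
    then show ?thesis by (simp only: powr_add[symmetric])
  qed
  ultimately show ?thesis using upper by (metis order_trans)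
qed

lemma dyadic_above:
  assumes "0 < t" "0 < R"
  obtains j :: int where "R \<le> rad t j" "rad t j \<le> 2 * R"
proof -
  define j where "j = \<lceil>log 2 (R / t)\<rceil>"
  have e: "2 powr real_of_int j = 2 powi j" by (rule powr_real_of_int') auto
  have "R / t = 2 powr (log 2 (R / t))" using assms by simp
  also have "\<dots> \<le> 2 powr real_of_int j" by (intro powr_mono) (auto simp: j_def)
  finally have 1: "R \<le> rad t j" using assms unfolding e rad_def by (simp add: field_simps)
  have "real_of_int j \<le> log 2 (R / t) + 1" unfolding j_def by linarith
  then have "2 powr real_of_int j \<le> 2 powr (log 2 (R / t) + 1)" by (intro powr_mono) auto
  also have "\<dots> = R / t * 2" using assms by (simp add: powr_add)
  finally have 2: "rad t j \<le> 2 * R" using assms unfolding e rad_def by (simp add: field_simps)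
  show ?thesis using that 1 2 by blast
qed

context thin_annulus_space
begin

text \<open>
  In an unbounded space the volume of a ball is comparable to \<open>r\<^sup>d\<close>, and \<open>j' = j\<close> will do. In a bounded space this fails for radii beyond
  the diameter, where balls have volume of order one while \<open>r\<^sup>d\<close> grows. There, however, all distances are less than half the radius, the profile is
  comparable to a constant, and the kernel at a large radius is comparable to the one at a fixed radius of the order of the diameter.
  Therefore \<open>j'\<close> depends on \<open>j\<close>, and several operators may share one scale.
\<close>

lemma volume_kernel_dominated:
  assumes c: "0 < c" and low: "\<And>x r. 0 < r \<Longrightarrow> c * min (r powr d) 1 \<le> measure M (ball x r)"
    and low_inf: "\<And>x r. ediam (UNIV :: 'a set) = \<infinity> \<Longrightarrow> 0 < r \<Longrightarrow> c * r powr d \<le> measure M (ball x r)"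
  obtains B where "0 < B" "\<And>\<delta> t j. 0 < \<delta> \<Longrightarrow> \<delta> \<le> 1 \<Longrightarrow> 0 < t \<Longrightarrow> \<exists>j'. \<forall>x y.
    1 / measure M (ball x (rad t j)) * profile d \<delta> (dist x y / rad t j) \<le> B * ker \<delta> (rad t j') x y"
proof (cases "ediam (UNIV :: 'a set) = \<infinity>")
  case True
  show ?thesis
  proof (rule that[of "1 / c"])
    show "0 < 1 / c" using c by simp
    fix \<delta> t :: real and j :: int assume "0 < t"
    then have r: "0 < rad t j" by (rule rad_pos)
    have "1 / measure M (ball x (rad t j)) * profile d \<delta> (dist x y / rad t j) \<le> 1 / c * ker \<delta> (rad t j) x y" for x y
    proof -
      have "1 / measure M (ball x (rad t j)) \<le> 1 / (c * rad t j powr d)"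
        using low_inf[OF True r, of x] c r by (intro divide_left_mono) (auto intro!: mult_pos_pos ball_pos)
      then have "1 / measure M (ball x (rad t j)) * profile d \<delta> (dist x y / rad t j) \<le> 1 / (c * rad t j powr d) * profile d \<delta> (dist x y / rad t j)"
        by (intro mult_right_mono) (auto simp: profile_def)
      then show ?thesis by (simp add: ker_def)
    qed
    then show "\<exists>j'. \<forall>x y. 1 / measure M (ball x (rad t j)) * profile d \<delta> (dist x y / rad t j) \<le> 1 / c * ker \<delta> (rad t j') x y" by blast
  qed
next
  case False
  then obtain m where m: "0 \<le> m" "ediam (UNIV :: 'a set) = ennreal m" by (cases "ediam (UNIV :: 'a set)") auto
  have diam: "dist x y \<le> m" for x y :: 'a
  proof -
    have "ennreal (dist x y) \<le> ediam (UNIV :: 'a set)"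
      unfolding ediam_def by (rule SUP_upper2[of x], simp, rule SUP_upper2[of y]) auto
    then show ?thesis using m by (simp add: ennreal_le_iff)
  qed
  \<comment> \<open>From this radius on all distances are at most half the radius.\<close>
  define R where "R = 2 * m + 1"
  have R: "1 \<le> R" using m by (simp add: R_def)
  define B where "B = 2 powr (2 * (d + 1)) * (2 * R) powr d / c"
  have B: "0 < B" "R powr d / c \<le> B"
  proof -
    have pos: "0 < 2 powr (2 * (d + 1)) * (2 * R) powr d" using R by simp
    then show "0 < B" using c by (simp add: B_def)
    have "1 * R powr d \<le> 2 powr (2 * (d + 1)) * (2 * R) powr d"
      using R d by (intro mult_mono powr_mono2 ge_one_powr_ge_zero) auto
    then show "R powr d / c \<le> B" using c unfolding B_def by (intro divide_right_mono) auto
  qed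
  show ?thesis
  proof (rule that[OF B(1)])
    fix \<delta> t :: real and j :: int assume \<delta>: "0 < \<delta>" "\<delta> \<le> 1" and t: "0 < t"
    define r where "r = rad t j"
    have r: "0 < r" unfolding r_def using t by (rule rad_pos)
    have p0: "0 \<le> profile d \<delta> s" for s by (simp add: profile_def)
    show "\<exists>j'. \<forall>x y. 1 / measure M (ball x (rad t j)) * profile d \<delta> (dist x y / rad t j) \<le> B * ker \<delta> (rad t j') x y"
      unfolding r_def[symmetric]
    proof (cases "r \<le> R")
      case True
      have "1 / measure M (ball x r) * profile d \<delta> (dist x y / r) \<le> B * ker \<delta> r x y" for x y
      proof -
        have "r powr d \<le> R powr d" using True r d by (intro powr_mono2) auto
        then have "r powr d / R powr d \<le> 1" using R by (simp add: divide_le_eq)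
        moreover have "1 \<le> R powr d" using R d by (intro ge_one_powr_ge_zero) auto
        then have "r powr d / R powr d \<le> r powr d / 1" by (intro divide_left_mono) auto
        ultimately have "r powr d / R powr d \<le> min (r powr d) 1" by simp
        then have "c * (r powr d / R powr d) \<le> measure M (ball x r)"
          using low[OF r, of x] c by (meson mult_left_mono less_imp_le order_trans)
        then have "1 / measure M (ball x r) \<le> 1 / (c * (r powr d / R powr d))"
          using c r R by (intro divide_left_mono mult_pos_pos divide_pos_pos) (auto intro: ball_pos)
        also have "\<dots> = (R powr d / c) * (1 / r powr d)" by simp
        also have "\<dots> \<le> B * (1 / r powr d)" using B by (intro mult_right_mono) auto
        finally have "1 / measure M (ball x r) * profile d \<delta> (dist x y / r) \<le> B * (1 / r powr d) * profile d \<delta> (dist x y / r)"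
          using p0 by (intro mult_right_mono) auto
        then show ?thesis by (simp add: ker_def)
      qed
      then show "\<exists>j'. \<forall>x y. 1 / measure M (ball x r) * profile d \<delta> (dist x y / r) \<le> B * ker \<delta> (rad t j') x y"
        unfolding r_def by blast
    next
      case False
      then have rR: "R < r" by simp
      obtain j' where j': "R \<le> rad t j'" "rad t j' \<le> 2 * R" using dyadic_above[OF t, of R] R by auto
      let ?r = "rad t j'"
      have r': "0 < ?r" using t by (rule rad_pos)
      have "1 / measure M (ball x r) * profile d \<delta> (dist x y / r) \<le> B * ker \<delta> ?r x y" for x y
      proof -
        have "1 \<le> r powr d" using rR R d by (intro ge_one_powr_ge_zero) auto
        then have "c \<le> measure M (ball x r)" using low[OF r, of x] by simp
        then have vol: "1 / measure M (ball x r) \<le> 1 / c" using c by (intro divide_left_mono) auto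
        have near: "dist x y / s \<le> 1/2" if "R \<le> s" for s
          using diam[of x y] that R by (simp add: R_def pos_divide_le_eq)
        have prof: "profile d \<delta> (dist x y / r) \<le> 2 powr (2 * (d + 1)) * profile d \<delta> (dist x y / ?r)"
          using d \<delta> r r' rR j' by (intro profile_comparable_near_0 near) auto
        have "1 / measure M (ball x r) * profile d \<delta> (dist x y / r) \<le> 1 / c * (2 powr (2 * (d + 1)) * profile d \<delta> (dist x y / ?r))"
          using vol prof p0 c by (intro mult_mono) auto
        also have "\<dots> \<le> 1 / c * (2 powr (2 * (d + 1)) * ((2 * R) powr d * ker \<delta> ?r x y))"
        proof -
          have "?r powr d \<le> (2 * R) powr d" using j' r' d by (intro powr_mono2) auto
          then have "?r powr d * ker \<delta> ?r x y \<le> (2 * R) powr d * ker \<delta> ?r x y" using ker_nonneg by (intro mult_right_mono) auto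
          moreover have "?r powr d * ker \<delta> ?r x y = profile d \<delta> (dist x y / ?r)" using r' by (simp add: ker_def)
          ultimately show ?thesis using c by (intro mult_left_mono) auto
        qed
        also have "\<dots> = B * ker \<delta> ?r x y" by (simp add: B_def)
        finally show ?thesis .
      qed
      then show "\<exists>j'. \<forall>x y. 1 / measure M (ball x r) * profile d \<delta> (dist x y / r) \<le> B * ker \<delta> (rad t j') x y" by blast
    qed
  qed
qed

end

theorem theorem3p2:
  fixes M :: "'a::metric_space measure"
    and d \<beta> C C' :: real
    and A :: "(('a \<Rightarrow> complex) \<times> ('a \<Rightarrow> complex)) set"
    and T :: "complex \<Rightarrow> 'a operator"
    and k :: "complex \<Rightarrow> 'a \<Rightarrow> 'a \<Rightarrow> complex"
  assumes "d > 0"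
    and "homogeneous_type M"
    and "volume_V1 d M"
    and "volume_V2 d M"
    and "\<And>p. 1 < p \<Longrightarrow> C0_semigroup p M (\<lambda>t. T (complex_of_real t))"
    and "A = neg_generator 2 M (\<lambda>t. T (complex_of_real t))"
    and "analytic_semigroup 2 M T"
    and "\<And>z. Re z > 0 \<Longrightarrow> has_integral_kernel M (T z) (k z)"
    and "C \<ge> 0" and "\<beta> \<ge> 0"
    and "\<And>z x y. Re z > 0 \<Longrightarrow>
           norm (k z x y) \<le> C * cos (Arg z) powr (- \<beta>) * (1 / measure M (ball x (norm z))) *
             (1 / norm (1 + complex_of_real ((dist x y)\<^sup>2) / z\<^sup>2) powr ((d + 1) / 2))"
    and "\<And>z. Re z > 0 \<Longrightarrow>
           Lp_opnorm 2 M (T z) \<le>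
             C' * cos (Arg z) powr (- (d - 1) / 2 - \<beta>) * (1 + \<bar>ln (cos (Arg z))\<bar>)\<^sup>2"
  shows "\<forall>p>1. \<exists>C''::real. \<forall>\<theta>\<in>{-pi/2<..<pi/2}. \<forall>t>0.
           (\<forall>j::int. Lp_extensions p M (T (cis \<theta> * complex_of_real (2 powi j * t))) \<noteq> {}) \<and>
           R_bound p M (\<Union>j::int. Lp_extensions p M (T (cis \<theta> * complex_of_real (2 powi j * t))))
             \<le> ennreal (C'' * cos \<theta> powr (- (d - 1) / 2 - \<beta>) * (1 + \<bar>ln (cos \<theta>)\<bar>)\<^sup>2)"
proof (intro allI impI)
  fix p :: real assume p: "1 < p"
  note kernel = assms(8) and k_bound = assms(11)
  have sets: "sets M = sets borel" using assms(2) by (simp add: homogeneous_type_def)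
  obtain c V D where c: "0 < c" and V: "0 < V" and D: "1 \<le> D"
    and fin: "\<And>x r. emeasure M (ball x r) < \<infinity>"
    and low: "\<And>x r. 0 < r \<Longrightarrow> c * min (r powr d) 1 \<le> measure M (ball x r)"
    and low_inf: "\<And>x r. ediam (UNIV :: 'a set) = \<infinity> \<Longrightarrow> 0 < r \<Longrightarrow> c * r powr d \<le> measure M (ball x r)"
    and up: "\<And>x r. 0 < r \<Longrightarrow> measure M (ball x r) \<le> V * r powr d"
    and doubling: "\<And>x r. 0 < r \<Longrightarrow> measure M (ball x (2 * r)) \<le> D * measure M (ball x r)"
    and ann: "\<And>x r R. 0 < R \<Longrightarrow> R / 2 < r \<Longrightarrow> r < R \<Longrightarrow> measure M (annulus x r R) \<le> V * (R - r) * R powr (d - 1)"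
    using volume_conditions_measure[OF assms(1-4)] by blast
  have d1: "1 \<le> d" by (rule dimension_ge_1[OF sets assms(1) c V fin low up ann])
  have lowpos: "0 < c * min (r powr d) 1" if "0 < r" for r using c that by simp
  have "\<exists>S::'a set. countable S \<and> (\<forall>x. \<forall>e>0. \<exists>y\<in>S. dist x y < e)"
    using low lowpos by (intro separable_of_ball_lower_bound[OF sets fin]) blast
  moreover have "0 < measure M (ball x r)" if "0 < r" for x r
    using low[OF that, of x] lowpos[OF that] by linarith
  ultimately interpret thin_annulus_space M d D V
    using sets fin doubling up ann d1 D V by unfold_locales auto
  obtain E where E: "0 < E" "\<And>b \<delta> t \<tau>. 0 < b \<Longrightarrow> 0 < \<delta> \<Longrightarrow> \<delta> \<le> 1 \<Longrightarrow> 0 < t \<Longrightarrow>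
    (\<And>S. S \<in> \<tau> \<Longrightarrow> \<exists>j. dominated p b \<delta> (rad t j) S) \<Longrightarrow>
    R_bound p M \<tau> \<le> ennreal (E * b * loss \<delta> * (1 + \<bar>ln \<delta>\<bar>)\<^sup>2)"
    using R_bound_dominated[OF p] by blast
  obtain B where B: "0 < B" "\<And>\<delta> t j. 0 < \<delta> \<Longrightarrow> \<delta> \<le> 1 \<Longrightarrow> 0 < t \<Longrightarrow> \<exists>j'. \<forall>x y.
    1 / measure M (ball x (rad t j)) * profile d \<delta> (dist x y / rad t j) \<le> B * ker \<delta> (rad t j') x y"
    using volume_kernel_dominated[OF c low low_inf] by blast
  show "\<exists>C''::real. \<forall>\<theta>\<in>{-pi/2<..<pi/2}. \<forall>t>0.
           (\<forall>j::int. Lp_extensions p M (T (cis \<theta> * complex_of_real (2 powi j * t))) \<noteq> {}) \<and>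
           R_bound p M (\<Union>j::int. Lp_extensions p M (T (cis \<theta> * complex_of_real (2 powi j * t))))
             \<le> ennreal (C'' * cos \<theta> powr (- (d - 1) / 2 - \<beta>) * (1 + \<bar>ln (cos \<theta>)\<bar>)\<^sup>2)"
  proof (intro exI[of _ "E * ((C + 1) * B)"] ballI allI impI)
    fix \<theta> t :: real assume \<theta>: "\<theta> \<in> {-pi/2<..<pi/2}" and t: "0 < t"
    define \<delta> where "\<delta> = cos \<theta>"
    have \<delta>: "0 < \<delta>" "\<delta> \<le> 1" using \<theta> by (auto simp: \<delta>_def intro!: cos_gt_zero_pi)
    define z where "z j = cis \<theta> * complex_of_real (2 powi j * t)" for j :: int
    have zr: "z j = cis \<theta> * complex_of_real (rad t j)" for j by (simp add: z_def rad_def)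
    have r: "0 < rad t j" for j using t by (rule rad_pos)
    have z: "0 < Re (z j)" "norm (z j) = rad t j" "Arg (z j) = \<theta>" for j
    proof -
      show "0 < Re (z j)" using r[of j] \<delta> by (simp add: zr \<delta>_def)
      show n: "norm (z j) = rad t j" using r[of j] by (simp add: zr norm_mult)
      have "sgn (z j) = cis \<theta>" using r[of j] by (simp add: sgn_div_norm n) (simp add: zr scaleR_conv_of_real)
      then show "Arg (z j) = \<theta>" using \<theta> r[of j] by (intro cis_Arg_unique) auto
    qed
    \<comment> \<open>One is added to \<open>C\<close> to have a positive constant in any case.\<close>
    define b where "b = (C + 1) * \<delta> powr (- \<beta>) * B"
    have b: "0 < b" using assms(9) \<delta> B(1) by (simp add: b_def)
    have dom: "\<exists>j'. \<forall>x y. norm (k (z j) x y) \<le> b * ker \<delta> (rad t j') x y" for j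
    proof -
      obtain j' where j': "\<And>x y. 1 / measure M (ball x (rad t j)) * profile d \<delta> (dist x y / rad t j) \<le> B * ker \<delta> (rad t j') x y"
        using B(2)[OF \<delta> t] by blast
      have "norm (k (z j) x y) \<le> b * ker \<delta> (rad t j') x y" for x y
      proof -
        have "norm (k (z j) x y) \<le> C * \<delta> powr (- \<beta>) * (1 / measure M (ball x (rad t j))) * profile d \<delta> (dist x y / rad t j)"
        proof -
          have factor: "1 / norm (1 + complex_of_real ((dist x y)\<^sup>2) / (z j)\<^sup>2) powr ((d + 1) / 2) = profile d \<delta> (dist x y / rad t j)"
            unfolding zr \<delta>_def by (rule ray_kernel_factor[OF r])
          show ?thesis
            using k_bound[OF z(1), of j x y] unfolding z(2,3) factor \<delta>_def[symmetric] .
        qed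
        also have "\<dots> = (C * \<delta> powr (- \<beta>)) * (1 / measure M (ball x (rad t j)) * profile d \<delta> (dist x y / rad t j))"
          by (simp only: mult.assoc)
        also have "\<dots> \<le> ((C + 1) * \<delta> powr (- \<beta>)) * (B * ker \<delta> (rad t j') x y)"
        proof (rule mult_mono[OF _ j'])
          show "C * \<delta> powr (- \<beta>) \<le> (C + 1) * \<delta> powr (- \<beta>)" by (intro mult_right_mono) auto
          show "0 \<le> (C + 1) * \<delta> powr (- \<beta>)" using assms(9) by simp
          show "0 \<le> 1 / measure M (ball x (rad t j)) * profile d \<delta> (dist x y / rad t j)"
            by (simp add: profile_def)
        qed
        finally show ?thesis by (simp add: b_def mult.assoc)
      qed
      then show ?thesis by blast
    qed
    have ext: "kernel_op (k (z j)) \<in> Lp_extensions p M (T (z j))"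
      "\<exists>j'. \<forall>S\<in>Lp_extensions p M (T (z j)). dominated p b \<delta> (rad t j') S" for j
    proof -
      obtain j' where j': "\<And>x y. norm (k (z j) x y) \<le> b * ker \<delta> (rad t j') x y" using dom by blast
      have hk: "has_integral_kernel M (T (z j)) (k (z j))" by (rule kernel[OF z(1)])
      then have meas: "(\<lambda>(x, y). k (z j) x y) \<in> borel_measurable (M \<Otimes>\<^sub>M M)" by (simp add: has_integral_kernel_def)
      show "kernel_op (k (z j)) \<in> Lp_extensions p M (T (z j))"
        by (rule extensions_dominated(1)[OF p b \<delta> t meas j' hk])
      show "\<exists>j'. \<forall>S\<in>Lp_extensions p M (T (z j)). dominated p b \<delta> (rad t j') S"
        using extensions_dominated(2)[OF p b \<delta> t meas j' hk] by blast
    qed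
    have "R_bound p M (\<Union>j. Lp_extensions p M (T (z j))) \<le> ennreal (E * b * loss \<delta> * (1 + \<bar>ln \<delta>\<bar>)\<^sup>2)"
      using ext(2) by (intro E(2)[OF b \<delta> t]) blast
    also have "E * b * loss \<delta> * (1 + \<bar>ln \<delta>\<bar>)\<^sup>2 = E * ((C + 1) * B) * \<delta> powr (- (d - 1) / 2 - \<beta>) * (1 + \<bar>ln \<delta>\<bar>)\<^sup>2"
    proof -
      have "\<delta> powr (- (d - 1) / 2 - \<beta>) = \<delta> powr (- (d - 1) / 2 + (- \<beta>))" by simp
      also have "\<dots> = loss \<delta> * \<delta> powr (- \<beta>)" unfolding loss_def by (rule powr_add)
      finally show ?thesis by (simp add: b_def)
    qed
    finally show "(\<forall>j::int. Lp_extensions p M (T (cis \<theta> * complex_of_real (2 powi j * t))) \<noteq> {}) \<and>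
           R_bound p M (\<Union>j::int. Lp_extensions p M (T (cis \<theta> * complex_of_real (2 powi j * t))))
             \<le> ennreal (E * ((C + 1) * B) * cos \<theta> powr (- (d - 1) / 2 - \<beta>) * (1 + \<bar>ln (cos \<theta>)\<bar>)\<^sup>2)"
      using ext(1) unfolding z_def \<delta>_def by blast
  qed
qed

end
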